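(* Let $\mathcal T$ be a radial distribution grid tree with non-substation (load) node set $\mathcal V_{\mathcal T}$ and operational edge set $\mathcal E_{\mathcal T}$, whose load power injections $P=(P_a)_{a\in\mathcal V_{\mathcal T}}$ are mutually independent continuous random variables with p.d.f.s $\mathcal P_a$, and suppose that the relation between injections $P$ and load voltages $V=(V_a)_{a\in\mathcal V_{\mathcal T}}$ is invertible on the domain of consideration, so that the p.d.f. of the load voltages is $$\mathcal P(V)=\frac{1}{|J_P(V)|}\prod_{a\in\mathcal V_{\mathcal T}}\mathcal P_a\Big(\sum_{b:(ab)\in\mathcal E_{\mathcal T}}V_a(V_a^*-V_b^* )/z_{ab}^*\Big),$$ where $|J_P(V)|$ is the determinant of the Jacobian $J_P(V)=\frac{\partial V}{\partial P}$ of the transformation from $P$ to $V$. For each node $a\in\mathcal V_{\mathcal T}$, let $N_2(a)$ be the set of all nodes at distance one or two hops from $a$ in $\mathcal T$. Suppose that for each node $a$ there is a set $B\subset N_2(a)$ such that $|J_P(V)|$ is product separable with respect to $B\cup\{a\}$, i.e. $|J_P(V)|$ is the product of a function of the voltages at the nodes in $B\cup\{a\}$ only and a function of the voltages at the nodes outside $B\cup\{a\}$ only. Then the graphical model $\mathcal{GM}$ of the load voltage vector $V$ is the graph on $\mathcal V_{\mathcal T}$ obtained from $\mathcal T$ (restricted to the load nodes) by inserting additional edges between every pair of neighbors of each node in $\mathcal T$.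
   Context: Grid and power flow: $\mathcal T$ is a tree whose root is a substation, taken as the reference bus with fixed known voltage and connected by an edge to exactly one load node; $\mathcal V_{\mathcal T}$ denotes the non-reference (load) nodes. The undirected edge between $a$ and $b$ is $(ab)$; each edge has complex impedance $z_{ab}=r_{ab}+\mathrm{i}\,x_{ab}$. Each node $a$ has complex voltage $V_a=v_a e^{\mathrm{i}\theta_a}$ and complex power injection $P_a=p_a+\mathrm{i}q_a$ satisfying $P_a=\sum_{b:(ab)\in\mathcal E_{\mathcal T}}V_a(V_a^*-V_b^* )/z_{ab}^*$, where $^*$ is complex conjugation. Standing assumptions: (1) the random variables representing power consumption at different load nodes are independent, so $P$ has p.d.f. $\mathcal P(P)=\prod_{a\in\mathcal V_{\mathcal T}}\mathcal P_a(P_a)$; (2) the relation between power injections and nodal voltages is invertible within the domain of consideration. Graphical model: for a random vector $X=(X_1,\dots,X_n)$, the graphical model $\mathcal{GM}$ is the undirected graph with one vertex per variable, in which the neighbor set $N(i)$ of each vertex $i$ is the smallest set of vertices not containing $i$ such that for any vertex set $C$ disjoint from $\{i\}\cup N(i)$, $\mathcal P(X_i\mid X_{N(i)},X_C)=\mathcal P(X_i\mid X_{N(i)})$, where $X_C$ denotes the variables indexed by $C$. Here the variables are the complex load voltages $V_a$, $a\in\mathcal V_{\mathcal T}$. *)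

theory Defs
  imports "HOL-Probability.Probability"
begin

text \<open>
  The load nodes are the elements of a finite type \<open>'v\<close>. The buses of the grid form the type
  \<open>'v option\<close>, where \<open>None\<close> is the substation. Undirected edges are two-element sets of buses.
\<close>

definition adj_rel :: "'n set set \<Rightarrow> ('n \<times> 'n) set" where
  "adj_rel E = {(a, b). {a, b} \<in> E}"

definition is_cycle :: "'n set set \<Rightarrow> 'n list \<Rightarrow> bool" where
  "is_cycle E xs \<longleftrightarrow>
     3 \<le> length xs \<and> distinct xs \<and>
     (\<forall>i<length xs. {xs ! i, xs ! (Suc i mod length xs)} \<in> E)"

definition is_tree :: "'n set set \<Rightarrow> bool" where
  "is_tree E \<longleftrightarrow>
     (\<forall>e\<in>E. card e = 2) \<and> (\<forall>a b. (a, b) \<in> (adj_rel E)\<^sup>*) \<and> (\<nexists>xs. is_cycle E xs)"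

definition radial_grid :: "'v option set set \<Rightarrow> bool" where
  "radial_grid E \<longleftrightarrow> is_tree E \<and> (\<exists>!a. {None, Some a} \<in> E)"

definition hop_dist :: "'n set set \<Rightarrow> 'n \<Rightarrow> 'n \<Rightarrow> nat" where
  "hop_dist E a b = (LEAST k. (a, b) \<in> adj_rel E ^^ k)"

definition N2 :: "'n set set \<Rightarrow> 'n \<Rightarrow> 'n set" where
  "N2 E a = {b. hop_dist E a b = 1 \<or> hop_dist E a b = 2}"

definition two_hop_graph :: "'v option set set \<Rightarrow> 'v set set" where
  "two_hop_graph E =
     {{a, c} | a c. {Some a, Some c} \<in> E} \<union>
     {{a, c} | a c. a \<noteq> c \<and> (\<exists>b. {Some a, b} \<in> E \<and> {b, Some c} \<in> E)}"

definition bus_voltage :: "complex \<Rightarrow> complex ^ 'v \<Rightarrow> 'v option \<Rightarrow> complex" where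
  "bus_voltage V0 v n = (case n of None \<Rightarrow> V0 | Some a \<Rightarrow> v $ a)"

definition injection ::
  "'v option set set \<Rightarrow> ('v option set \<Rightarrow> complex) \<Rightarrow> complex \<Rightarrow> complex ^ 'v \<Rightarrow> complex ^ 'v" where
  "injection E z V0 v =
     (\<chi> a. \<Sum>b | {Some a, b} \<in> E.
        v $ a * (cnj (v $ a) - cnj (bus_voltage V0 v b)) / cnj (z {Some a, b}))"

definition invertible_on ::
  "('a::real_normed_vector \<Rightarrow> 'b::real_normed_vector) \<Rightarrow> 'a set \<Rightarrow> bool" where
  "invertible_on F D \<longleftrightarrow>
     open D \<and> inj_on F D \<and> (\<forall>p\<in>F ` D. inv_into D F differentiable (at p))"

text \<open>
  The Jacobian of a map on complex vectors is the real one with respect to the coordinates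
  \<open>(Re x\<^sub>a, Im x\<^sub>a)\<close>, because densities of complex random vectors are taken with respect to
  \<open>lborel\<close>, the Lebesgue measure in these coordinates.
\<close>

definition re_im_basis :: "'v + 'v \<Rightarrow> complex ^ 'v" where
  "re_im_basis k = (case k of Inl a \<Rightarrow> axis a 1 | Inr a \<Rightarrow> axis a \<i>)"

definition jacobian ::
  "(complex ^ 'v \<Rightarrow> complex ^ 'v) \<Rightarrow> complex ^ 'v \<Rightarrow> real ^ ('v + 'v) ^ ('v::finite + 'v)" where
  "jacobian F x = (\<chi> i j. frechet_derivative F (at x) (re_im_basis j) \<bullet> re_im_basis i)"

text \<open>
  The inverse map \<open>P \<mapsto> V\<close> is differentiated at the injection produced by the voltage \<open>v\<close>, so
  that \<open>\<partial>V / \<partial>P\<close> becomes a function of the voltages.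
\<close>

definition abs_J_P ::
  "'v option set set \<Rightarrow> ('v option set \<Rightarrow> complex) \<Rightarrow> complex \<Rightarrow> (complex ^ 'v) set \<Rightarrow>
   complex ^ 'v::finite \<Rightarrow> real" where
  "abs_J_P E z V0 D v =
     \<bar>det (jacobian (inv_into D (injection E z V0)) (injection E z V0 v))\<bar>"

definition depends_only_on :: "('a ^ 'v \<Rightarrow> 'b) \<Rightarrow> 'v set \<Rightarrow> bool" where
  "depends_only_on g S \<longleftrightarrow> (\<forall>v w. (\<forall>k\<in>S. v $ k = w $ k) \<longrightarrow> g v = g w)"

definition product_separable :: "('a ^ 'v) set \<Rightarrow> ('a ^ 'v \<Rightarrow> real) \<Rightarrow> 'v set \<Rightarrow> bool" where
  "product_separable D F S \<longleftrightarrow>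
     (\<exists>g h. depends_only_on g S \<and> depends_only_on h (- S) \<and> (\<forall>v\<in>D. F v = g v * h v))"

definition sigma_gen :: "'w measure \<Rightarrow> ('w \<Rightarrow> 'b::topological_space ^ 'v) \<Rightarrow> 'v set \<Rightarrow> 'w measure" where
  "sigma_gen M X S =
     vimage_algebra (space M) (\<lambda>\<omega>. \<lambda>j\<in>S. X \<omega> $ j) (PiM S (\<lambda>_. borel))"

definition cond_prob ::
  "'w measure \<Rightarrow> ('w \<Rightarrow> 'b::topological_space ^ 'v) \<Rightarrow> 'v \<Rightarrow> 'v set \<Rightarrow> 'b set \<Rightarrow> 'w \<Rightarrow> real" where
  "cond_prob M X i S A =
     real_cond_exp M (sigma_gen M X S) (indicator {\<omega> \<in> space M. X \<omega> $ i \<in> A})"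

definition shields ::
  "'w measure \<Rightarrow> ('w \<Rightarrow> 'b::topological_space ^ 'v) \<Rightarrow> 'v \<Rightarrow> 'v set \<Rightarrow> bool" where
  "shields M X i N \<longleftrightarrow>
     i \<notin> N \<and>
     (\<forall>C. C \<inter> ({i} \<union> N) = {} \<longrightarrow>
        (\<forall>A\<in>sets borel. AE \<omega> in M. cond_prob M X i (N \<union> C) A \<omega> = cond_prob M X i N A \<omega>))"

definition neighbors :: "'v set set \<Rightarrow> 'v \<Rightarrow> 'v set" where
  "neighbors G i = {j. {i, j} \<in> G}"

definition graphical_model ::
  "'w measure \<Rightarrow> ('w \<Rightarrow> 'b::topological_space ^ 'v) \<Rightarrow> 'v set set \<Rightarrow> bool" where
  "graphical_model M X G \<longleftrightarrow>
     (\<forall>e\<in>G. card e = 2) \<and>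
     (\<forall>i. shields M X i (neighbors G i) \<and> (\<forall>N. shields M X i N \<longrightarrow> neighbors G i \<subseteq> N))"

lemma graphical_model_unique:
  assumes "graphical_model M X G" and "graphical_model M X H"
  shows "G = H"
proof -
  have nb: "neighbors G i = neighbors H i" for i
    using assms unfolding graphical_model_def by (meson subset_antisym)
  have "e \<in> G \<longleftrightarrow> e \<in> H" for e
  proof (cases "card e = 2")
    case True
    then obtain i j where "e = {i, j}"
      by (meson card_2_iff)
    then show ?thesis
      using nb[of i] by (auto simp: neighbors_def)
  next
    case False
    then show ?thesis
      using assms by (auto simp: graphical_model_def)
  qed
  then show ?thesis
    by blast
qed

end

theory Submission
  imports Defs
begin

text \<open>
  Write \<open>\<Delta>(V)\<close> for the real Jacobian determinant of the power flow map \<open>V \<mapsto> P\<close>. It is a real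
  polynomial in the load voltages, \<open>|J\<^sub>P| = 1 / |\<Delta>|\<close> on the domain, and the voltages have the density
  \<open>|\<Delta>(V)| \<Prod>\<^sub>k f\<^sub>k(P\<^sub>k(V))\<close> there.

  \<^emph>\<open>Separability leaves only stars.\<close> If \<open>|J\<^sub>P|\<close> is separable with respect to \<open>S\<close>, then
  \<open>\<Delta>(V)\<^sup>2 \<Delta>(W)\<^sup>2 = \<Delta>(V')\<^sup>2 \<Delta>(W')\<^sup>2\<close> whenever \<open>V'\<close>, \<open>W'\<close> arise from \<open>V\<close>, \<open>W\<close> by exchanging the voltages
  on \<open>S\<close>; near a point of the domain this is the hypothesis, and polynomials extend it to all
  voltages. Suppose that \<open>S\<close> is neither empty nor full and take a lowest edge \<open>(i j)\<close> of the
  tree that crosses its boundary, \<open>i\<close> above \<open>j\<close>. Scaling the voltages by powers of \<open>\<epsilon>\<close> that grow with the depth and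
  taking leading terms as \<open>\<epsilon> \<rightarrow> 0\<close> (called freezing below) decouples every node except \<open>i\<close> and
  the subtree of \<open>j\<close>. With a constant voltage on that subtree, the determinant that is left belongs to a
  centre with a single leaf and can be discussed by hand; it refutes the exchange identity
  (\<open>separable_imp_UNIV\<close>). Hence any two loads are within two hops, the loads form a star
  (\<open>star_centre\<close>), and the two-hop graph is complete. Its Markov property is then void, and
  what has to be shown is minimality: no load can be dropped from the neighbourhood of another one.

  \<^emph>\<open>No conditional independence.\<close> If \<open>j\<close> could be dropped from the neighbourhood of \<open>i\<close>, the density would
  be a product of a function that ignores \<open>V\<^sub>j\<close> and a function that ignores \<open>V\<^sub>i\<close>
  (\<open>shields_factorisation\<close>). So \<open>|\<Delta>|\<close> is, on a set of positive measure, a product of functions and of reciprocals of functions about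
  which nothing is known except through which combinations of voltages they depend on \<open>V\<close>. They are
  eliminated by comparing \<open>|\<Delta>|\<close> at two families of points chosen such that each unknown function takes
  the same values on both. The points are images of one voltage vector under small isometries; by a density
  argument all images lie in the given set for a non-null set of vectors, and on a non-null set a polynomial
  identity holds only if it holds everywhere (\<open>cycle_identity\<close>).

  With at least three loads, let \<open>b\<close> be the centre and \<open>a\<close>, \<open>c\<close> two of its neighbours. The injection at \<open>b\<close> feels
  the voltages of \<open>a\<close> and \<open>c\<close> only through the sum of two currents, so that a hexagon of pairs
  of currents with matching entries and matching sums works, once for each of two
  voltages at \<open>b\<close> (\<open>hexagon_identity\<close>). With two loads only one such current is
  available, but rotating all phases amounts to rotating the voltage of the substation, and a hexagon
  built from rotations takes over (\<open>turn_identity\<close>). In each case voltages are exhibited for which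
  one of the two products of values of \<open>\<Delta>\<close> (frozen in the case of three loads) vanishes while the other does not.
\<close>

section \<open>Layers of a tree\<close>

definition is_walk :: "'n set set \<Rightarrow> 'n list \<Rightarrow> bool" where
  "is_walk E xs \<longleftrightarrow> (\<forall>i. Suc i < length xs \<longrightarrow> {xs ! i, xs ! Suc i} \<in> E)"

lemma is_walk_append:
  assumes "is_walk E (xs @ [a])" "is_walk E (a # ys)"
  shows "is_walk E (xs @ a # ys)"
  unfolding is_walk_def
proof (intro allI impI)
  fix i assume i: "Suc i < length (xs @ a # ys)"
  show "{(xs @ a # ys) ! i, (xs @ a # ys) ! Suc i} \<in> E"
  proof (cases "i < length xs")
    case True
    then have "{(xs @ [a]) ! i, (xs @ [a]) ! Suc i} \<in> E"
      using assms(1) by (simp add: is_walk_def)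
    then show ?thesis
      using True by (cases "Suc i < length xs") (auto simp: nth_append)
  next
    case False
    define k where "k = i - length xs"
    have "Suc k < length (a # ys)" using i False by (simp add: k_def)
    then have "{(a # ys) ! k, (a # ys) ! Suc k} \<in> E"
      using assms(2) by (simp add: is_walk_def)
    moreover have "i = length xs + k" using False by (simp add: k_def)
    ultimately show ?thesis
      by (metis add_Suc_right nth_append_length_plus)
  qed
qed

lemma is_walk_appendD1: "is_walk E (xs @ ys) \<Longrightarrow> is_walk E xs"
  unfolding is_walk_def
  by (metis Suc_lessD length_append nth_append trans_less_add1)

lemma is_walk_appendD2: "is_walk E (xs @ ys) \<Longrightarrow> is_walk E ys"
  unfolding is_walk_def
  by (metis add_Suc_right length_append nat_add_left_cancel_less nth_append_length_plus)

text \<open>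
  Cutting out the part of a walk between two visits of a vertex shortens it and keeps its ends.
\<close>

lemma walk_to_path:
  assumes "is_walk E xs" "xs \<noteq> []"
  shows "\<exists>ys. is_walk E ys \<and> distinct ys \<and> ys \<noteq> [] \<and> hd ys = hd xs \<and> last ys = last xs
           \<and> set ys \<subseteq> set xs"
  using assms
proof (induction "length xs" arbitrary: xs rule: less_induct)
  case less
  show ?case
  proof (cases "distinct xs")
    case True
    then show ?thesis using less.prems by blast
  next
    case False
    then obtain as bs cs a where xs: "xs = as @ [a] @ bs @ [a] @ cs"
      using not_distinct_decomp by blast
    let ?zs = "as @ a # cs"
    have "is_walk E (as @ [a])"
      using less.prems(1) is_walk_appendD1[of E "as @ [a]" "bs @ [a] @ cs"] by (simp add: xs)
    moreover have "is_walk E (a # cs)"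
      using less.prems(1) is_walk_appendD2[of E "as @ [a] @ bs" "a # cs"] by (simp add: xs)
    ultimately have "is_walk E ?zs"
      by (rule is_walk_append)
    moreover have "length ?zs < length xs" "?zs \<noteq> []" by (auto simp: xs)
    ultimately obtain ys where ys: "is_walk E ys" "distinct ys" "ys \<noteq> []" "hd ys = hd ?zs"
        "last ys = last ?zs" "set ys \<subseteq> set ?zs"
      using less.hyps by blast
    moreover have "hd ?zs = hd xs" "last ?zs = last xs" "set ?zs \<subseteq> set xs"
      by (cases as; auto simp: xs)+
    ultimately show ?thesis by (metis subset_trans)
  qed
qed

text \<open>
  A path that joins two different neighbours of \<open>a\<close> without visiting \<open>a\<close>
  would close a cycle through \<open>a\<close>.
\<close>

lemma no_detour_in_tree:
  assumes tree: "is_tree E" and w: "is_walk E xs" "xs \<noteq> []" "a \<notin> set xs"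
    and E: "{a, hd xs} \<in> E" "{a, last xs} \<in> E"
  shows "hd xs = last xs"
proof (rule ccontr)
  assume ne: "hd xs \<noteq> last xs"
  obtain ys where ys: "is_walk E ys" "distinct ys" "ys \<noteq> []" "hd ys = hd xs" "last ys = last xs"
      "set ys \<subseteq> set xs"
    using walk_to_path[OF w(1,2)] by blast
  have len: "2 \<le> length ys"
    using ne ys(3-5) by (cases ys; cases "tl ys") auto
  have "is_cycle E (a # ys)"
    unfolding is_cycle_def
  proof (intro conjI allI impI)
    show "3 \<le> length (a # ys)" using len by simp
    show "distinct (a # ys)" using ys w(3) by auto
    fix i assume i: "i < length (a # ys)"
    show "{(a # ys) ! i, (a # ys) ! (Suc i mod length (a # ys))} \<in> E"
    proof (cases i)
      case 0
      then show ?thesis using E(1) ys(3,4) by (simp add: hd_conv_nth)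
    next
      case (Suc k)
      show ?thesis
      proof (cases "Suc k = length ys")
        case True
        then have "(a # ys) ! i = last xs"
          using ys(3,5) Suc by (metis diff_Suc_1 last_conv_nth nth_Cons_Suc)
        moreover have "Suc i mod length (a # ys) = 0" using True Suc by simp
        ultimately show ?thesis using E(2) by (simp add: insert_commute)
      next
        case False
        then show ?thesis using ys(1) Suc i by (simp add: is_walk_def)
      qed
    qed
  qed
  with tree show False by (auto simp: is_tree_def)
qed

lemma relpow_imp_walk:
  assumes "(a, b) \<in> adj_rel E ^^ k"
  shows "\<exists>xs. is_walk E xs \<and> length xs = Suc k \<and> hd xs = a \<and> last xs = b"
  using assms
proof (induction k arbitrary: b)
  case 0
  then show ?case by (intro exI[of _ "[a]"]) (simp add: is_walk_def)
next
  case (Suc k)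
  then obtain c where c: "(a, c) \<in> adj_rel E ^^ k" "(c, b) \<in> adj_rel E"
    by auto
  then obtain xs where xs: "is_walk E xs" "length xs = Suc k" "hd xs = a" "last xs = c"
    using Suc.IH by blast
  then have dec: "xs = butlast xs @ [c]"
    by (metis Zero_not_Suc append_butlast_last_id list.size(3))
  have "is_walk E (butlast xs @ c # [b])"
  proof (rule is_walk_append)
    show "is_walk E (butlast xs @ [c])" using xs(1) dec by metis
    show "is_walk E [c, b]" using c(2) by (simp add: is_walk_def adj_rel_def)
  qed
  moreover have "length (butlast xs @ c # [b]) = Suc (Suc k)" using xs(2) by simp
  moreover have "hd (butlast xs @ c # [b]) = a"
    using xs(3) dec by (metis append_Cons append_Nil append_assoc hd_append list.sel(1))
  moreover have "last (butlast xs @ c # [b]) = b" by simp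
  ultimately show ?case by blast
qed

lemma walk_nth_relpow:
  assumes "is_walk E xs" "i < length xs"
  shows "(hd xs, xs ! i) \<in> adj_rel E ^^ i"
  using assms(2)
proof (induction i)
  case 0
  then show ?case by (simp add: hd_conv_nth)
next
  case (Suc i)
  then have "(xs ! i, xs ! Suc i) \<in> adj_rel E"
    using assms(1) by (simp add: is_walk_def adj_rel_def)
  with Suc show ?case by auto
qed

lemma hop_dist_relpow:
  assumes "is_tree E" shows "(a, b) \<in> adj_rel E ^^ hop_dist E a b"
  unfolding hop_dist_def
  using assms by (metis (mono_tags, lifting) LeastI is_tree_def rtrancl_power)

lemma hop_dist_le: "(a, b) \<in> adj_rel E ^^ k \<Longrightarrow> hop_dist E a b \<le> k"
  by (simp add: hop_dist_def Least_le)

lemma hop_dist_eq_0_iff: "is_tree E \<Longrightarrow> hop_dist E a b = 0 \<longleftrightarrow> a = b"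
  using hop_dist_relpow[of E a b] hop_dist_le[of a b 0 E] by (cases "hop_dist E a b") auto

text \<open>
  This is what makes parents unique. All vertices of a shortest walk from \<open>r\<close> to
  \<open>b\<close>, except perhaps \<open>b\<close> itself, are closer to \<open>r\<close> than
  \<open>a\<close>, and the same holds for \<open>c\<close>; so two different vertices
  \<open>b\<close> and \<open>c\<close> would be joined by a detour around \<open>a\<close>.
\<close>

lemma at_most_one_upper_neighbour:
  assumes tree: "is_tree E" and b: "{a, b} \<in> E" "hop_dist E r b \<le> hop_dist E r a"
    and c: "{a, c} \<in> E" "hop_dist E r c \<le> hop_dist E r a"
  shows "b = c"
proof -
  have avoid: "\<exists>xs. is_walk E xs \<and> xs \<noteq> [] \<and> hd xs = r \<and> last xs = x \<and> a \<notin> set xs"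
    if x: "{a, x} \<in> E" "hop_dist E r x \<le> hop_dist E r a" for x
  proof -
    obtain xs where xs: "is_walk E xs" "length xs = Suc (hop_dist E r x)" "hd xs = r" "last xs = x"
      using relpow_imp_walk[OF hop_dist_relpow[OF tree, of r x]] by blast
    have "a \<notin> set xs"
    proof
      assume "a \<in> set xs"
      then obtain i where i: "i < length xs" "xs ! i = a" by (auto simp: in_set_conv_nth)
      have "x \<noteq> a" using x(1) tree by (force simp: is_tree_def)
      then have "i \<noteq> hop_dist E r x"
        using i xs(2,4) by (metis diff_Suc_1 last_conv_nth length_0_conv nat.distinct(1))
      then have "i < hop_dist E r x" using i xs(2) by simp
      moreover have "hop_dist E r a \<le> i"
        using walk_nth_relpow[OF xs(1) i(1)] i(2) xs(3) by (simp add: hop_dist_le)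
      ultimately show False using x(2) by simp
    qed
    then show ?thesis using xs by (metis length_0_conv nat.distinct(1))
  qed
  obtain xs where xs: "is_walk E xs" "xs \<noteq> []" "hd xs = r" "last xs = b" "a \<notin> set xs"
    using avoid[OF b] by blast
  obtain ys where ys: "is_walk E ys" "ys \<noteq> []" "hd ys = r" "last ys = c" "a \<notin> set ys"
    using avoid[OF c] by blast
  have rev: "is_walk E (rev xs)"
    unfolding is_walk_def
  proof (intro allI impI)
    fix i assume i: "Suc i < length (rev xs)"
    define k where "k = length xs - Suc (Suc i)"
    have "{xs ! k, xs ! Suc k} \<in> E" using xs(1) i by (simp add: is_walk_def k_def)
    moreover have "rev xs ! i = xs ! Suc k" "rev xs ! Suc i = xs ! k"
      using i by (simp_all add: rev_nth k_def Suc_diff_Suc)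
    ultimately show "{rev xs ! i, rev xs ! Suc i} \<in> E" by (simp add: insert_commute)
  qed
  have dec: "rev xs = rev (tl xs) @ [r]" "ys = r # tl ys"
    using xs(2,3) ys(2,3) by (metis list.collapse rev.simps(2), metis list.collapse)
  define zs where "zs = rev (tl xs) @ r # tl ys"
  have "is_walk E zs" unfolding zs_def
  proof (rule is_walk_append)
    show "is_walk E (rev (tl xs) @ [r])" using rev dec(1) by metis
    show "is_walk E (r # tl ys)" using ys(1) dec(2) by metis
  qed
  moreover have "zs \<noteq> []" by (simp add: zs_def)
  moreover have "hd zs = b"
    using xs(2,4) dec(1) unfolding zs_def
    by (metis append_Cons append_Nil append_assoc hd_append hd_rev list.discI)
  moreover have "last zs = c"
    using ys dec(2) by (metis last_appendR list.discI zs_def)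
  moreover have "a \<notin> set zs"
  proof -
    have "set zs = set (rev xs) \<union> set ys" unfolding zs_def by (subst dec(1), subst dec(2)) auto
    then show ?thesis using xs(5) ys(5) by simp
  qed
  ultimately show ?thesis
    using no_detour_in_tree[OF tree, of zs a] b(1) c(1) by simp
qed

locale grid =
  fixes E :: "'v::finite option set set"
  assumes radial: "radial_grid E"
begin

abbreviation depth :: "'v option \<Rightarrow> nat" where "depth \<equiv> hop_dist E None"

definition par :: "'v \<Rightarrow> 'v option" where
  "par a = (THE b. {Some a, b} \<in> E \<and> depth b < depth (Some a))"

lemma tree: "is_tree E" using radial by (simp add: radial_grid_def)

lemma no_loop [simp]: "{a} \<notin> E"
  using tree by (force simp: is_tree_def)

lemma depth_None [simp]: "depth None = 0"
  by (simp add: hop_dist_eq_0_iff tree)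

lemma depth_Some_pos: "0 < depth (Some a)"
  using hop_dist_eq_0_iff[OF tree, of None "Some a"] by simp

lemma ex1_par: "\<exists>!b. {Some a, b} \<in> E \<and> depth b < depth (Some a)"
proof -
  obtain k where k: "depth (Some a) = Suc k" using depth_Some_pos[of a] gr0_conv_Suc by blast
  then obtain b where b: "(None, b) \<in> adj_rel E ^^ k" "(b, Some a) \<in> adj_rel E"
    using hop_dist_relpow[OF tree, of None "Some a"] by auto
  then have "{Some a, b} \<in> E \<and> depth b < depth (Some a)"
    using hop_dist_le[OF b(1)] k by (simp add: adj_rel_def insert_commute)
  then show ?thesis
    using at_most_one_upper_neighbour[OF tree] by (meson less_imp_le)
qed

lemma par_edge: "{Some a, par a} \<in> E" and par_less: "depth (par a) < depth (Some a)"
  using theI'[OF ex1_par[of a]] by (simp_all add: par_def)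

lemma edge_cases:
  assumes "{Some a, b} \<in> E"
  shows "b = par a \<or> (\<exists>c. b = Some c \<and> par c = Some a)"
proof (cases "b = par a")
  case False
  have nle: "\<not> depth b \<le> depth (Some a)"
    using at_most_one_upper_neighbour[OF tree assms _ par_edge[of a], of None] False par_less[of a]
    by auto
  then obtain c where c: "b = Some c" by (cases b) auto
  have "Some a = par c"
    using nle at_most_one_upper_neighbour[OF tree, of "Some c" "Some a" None "par c"]
      assms par_edge[of c] par_less[of c] by (simp add: c insert_commute)
  with c show ?thesis by simp
qed simp

lemma edge_iff: "{Some a, Some c} \<in> E \<longleftrightarrow> par a = Some c \<or> par c = Some a"
  using edge_cases[of a "Some c"] par_edge[of a] par_edge[of c] by (auto simp: insert_commute)

lemma edge_None_iff: "{Some a, None} \<in> E \<longleftrightarrow> par a = None"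
  using edge_cases[of a None] par_edge[of a] by auto

lemma par_None_unique: "par a = None \<Longrightarrow> par b = None \<Longrightarrow> a = b"
  using radial par_edge[of a] par_edge[of b]
  by (auto simp: radial_grid_def insert_commute)

lemma par_ne_self [simp]: "par a \<noteq> Some a"
  using par_less[of a] by auto

lemma par_asym: "par a = Some b \<Longrightarrow> par b \<noteq> Some a"
  using par_less[of a] par_less[of b] by auto

end

section \<open>Real determinants and the inverse map\<close>

text \<open>
  Determinants live on matrices over an index type; these two maps translate between complex vectors
  and their \<open>(Re, Im)\<close> coordinates, so that results on matrices apply.
\<close>

definition coords :: "complex ^ 'v \<Rightarrow> real ^ ('v::finite + 'v)" where
  "coords X = (\<chi> k. X \<bullet> re_im_basis k)"

definition of_coords :: "real ^ ('v::finite + 'v) \<Rightarrow> complex ^ 'v" where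
  "of_coords r = (\<chi> a. Complex (r $ Inl a) (r $ Inr a))"

definition real_det :: "(complex ^ 'v \<Rightarrow> complex ^ 'v) \<Rightarrow> real" where
  "real_det T = det (\<chi> i j. T (re_im_basis j) \<bullet> re_im_basis (i :: 'v::finite + 'v))"

lemma axis_inner_complex: "X \<bullet> axis a (c::complex) = X $ a \<bullet> c"
  by (simp add: inner_axis)

lemma coords_nth [simp]: "coords X $ Inl a = Re (X $ a)" "coords X $ Inr a = Im (X $ a)"
  by (simp_all add: coords_def re_im_basis_def axis_inner_complex inner_complex_def)

lemma coords_of_coords [simp]: "coords (of_coords r) = r"
  by (simp add: vec_eq_iff of_coords_def split_sum_all)

lemma of_coords_coords [simp]: "of_coords (coords X) = X"
  by (simp add: vec_eq_iff of_coords_def)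

lemma linear_coords: "linear coords"
  by (auto simp: coords_def linear_iff vec_eq_iff inner_add_left)

lemma linear_of_coords: "linear of_coords"
  by (auto simp: of_coords_def linear_iff vec_eq_iff complex_eq_iff)

lemma of_coords_axis: "of_coords (axis k 1) = re_im_basis k"
  by (cases k) (auto simp: of_coords_def re_im_basis_def vec_eq_iff axis_def complex_eq_iff)

lemma real_det_eq: "real_det T = det (matrix (coords \<circ> T \<circ> of_coords))"
  by (simp add: real_det_def matrix_def of_coords_axis coords_def)

lemma real_det_compose:
  fixes S T :: "complex ^ 'v \<Rightarrow> complex ^ 'v::finite"
  assumes "linear S" "linear T" shows "real_det (S \<circ> T) = real_det S * real_det T"
proof -
  have "coords \<circ> (S \<circ> T) \<circ> of_coords = (coords \<circ> S \<circ> of_coords) \<circ> (coords \<circ> T \<circ> of_coords)"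
    by (auto simp: fun_eq_iff)
  moreover have "linear (coords \<circ> S \<circ> of_coords)" "linear (coords \<circ> T \<circ> of_coords)"
    using assms by (auto intro!: linear_compose linear_coords linear_of_coords)
  ultimately show ?thesis
    by (simp add: real_det_eq matrix_compose det_mul)
qed

lemma real_det_id: "real_det (\<lambda>X :: complex ^ 'v::finite. X) = 1"
proof -
  have "coords \<circ> (\<lambda>X :: complex ^ 'v. X) \<circ> of_coords = id" by (auto simp: fun_eq_iff)
  then show ?thesis unfolding real_det_eq by (simp only: matrix_id_mat_1 det_I)
qed

lemma real_det_eq_0_iff:
  fixes T :: "complex ^ 'v \<Rightarrow> complex ^ 'v::finite"
  assumes "linear T" shows "real_det T = 0 \<longleftrightarrow> (\<exists>X. X \<noteq> 0 \<and> T X = 0)"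
proof -
  let ?f = "coords \<circ> T \<circ> of_coords"
  have lin: "linear ?f"
    using assms by (auto intro!: linear_compose linear_coords linear_of_coords)
  have "real_det T \<noteq> 0 \<longleftrightarrow> invertible (matrix ?f)"
    by (simp add: real_det_eq invertible_det_nz)
  also have "\<dots> \<longleftrightarrow> inj ?f"
    using lin by (simp add: matrix_left_invertible_injective invertible_left_inverse matrix_works)
  also have "\<dots> \<longleftrightarrow> (\<forall>r. ?f r = 0 \<longrightarrow> r = 0)"
    using lin by (simp add: linear_injective_0)
  also have "\<dots> \<longleftrightarrow> (\<forall>X. T X = 0 \<longrightarrow> X = 0)"
  proof safe
    fix X assume "\<forall>r. ?f r = 0 \<longrightarrow> r = 0" "T X = 0"
    then have "?f (coords X) = 0" using linear_0[OF linear_coords] by simp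
    then have "coords X = 0" using \<open>\<forall>r. ?f r = 0 \<longrightarrow> r = 0\<close> by blast
    then show "X = 0" by (metis linear_0 linear_of_coords of_coords_coords)
  next
    fix r assume "\<forall>X. T X = 0 \<longrightarrow> X = 0" "?f r = 0"
    moreover from this(2) have "T (of_coords r) = 0"
      by (metis comp_apply linear_0 linear_of_coords of_coords_coords)
    ultimately show "r = 0" by (metis coords_of_coords linear_0 linear_coords)
  qed
  finally show ?thesis by blast
qed

lemma real_det_rows_scaled:
  fixes T :: "complex ^ 'v \<Rightarrow> complex ^ 'v::finite" and c :: "'v \<Rightarrow> real"
  assumes "\<And>X a. S X $ a = c a *\<^sub>R (T X $ a)"
  shows "real_det S = (\<Prod>k\<in>UNIV. c (case k of Inl a \<Rightarrow> a | Inr a \<Rightarrow> a)) * real_det T"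
proof -
  let ?c = "\<lambda>k. c (case k of Inl a \<Rightarrow> a | Inr a \<Rightarrow> a)"
  let ?A = "\<lambda>i. \<chi> j. T (re_im_basis j) \<bullet> re_im_basis (i :: 'v + 'v)"
  have "(\<chi> i j. S (re_im_basis j) \<bullet> re_im_basis i) = (\<chi> i. ?c i *s ?A i)"
    by (auto simp: vec_eq_iff re_im_basis_def axis_inner_complex assms split: sum.split)
  then show ?thesis
    using det_rows_mul[of ?c ?A] by (simp add: real_det_def)
qed

lemma tendsto_real_det:
  assumes "\<And>X. ((\<lambda>e. T e X) \<longlongrightarrow> S X) F"
  shows "((\<lambda>e. real_det (T e)) \<longlongrightarrow> real_det S) F"
  unfolding real_det_def det_def by (auto intro!: tendsto_intros assms)

lemma real_polynomial_function_real_det: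
  assumes "\<And>X i. real_polynomial_function (\<lambda>v. T v X \<bullet> re_im_basis i)"
  shows "real_polynomial_function (\<lambda>v. real_det (T v))"
  unfolding real_det_def det_def
  by (intro real_polynomial_function_sum real_polynomial_function.intros(4)
        real_polynomial_function.intros(2) real_polynomial_function_prod)
     (auto intro: assms finite_permutations)

text \<open>
  The Jacobian of the theorem belongs to the inverse map, which is known only abstractly. By the
  chain rule its determinant is the reciprocal of the determinant of the explicit forward map.
\<close>

lemma jacobian_det_inverse:
  fixes F :: "complex ^ 'v \<Rightarrow> complex ^ 'v::finite"
  assumes inv: "invertible_on F D" and v: "v \<in> D" and F: "(F has_derivative F') (at v)"
  shows "det (jacobian (inv_into D F) (F v)) * real_det F' = 1"
proof -
  let ?G = "inv_into D F"
  let ?G' = "frechet_derivative ?G (at (F v))"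
  have G: "(?G has_derivative ?G') (at (F v))"
    using inv v by (auto simp: invertible_on_def frechet_derivative_works)
  have "open D" "inj_on F D" using inv by (auto simp: invertible_on_def)
  have "(?G \<circ> F has_derivative ?G' \<circ> F') (at v)"
    using diff_chain_at[OF F G] .
  moreover have "(?G \<circ> F has_derivative (\<lambda>X. X)) (at v)"
  proof (rule has_derivative_transform_within_open[OF has_derivative_ident \<open>open D\<close> v])
    fix x assume "x \<in> D"
    then show "x = (?G \<circ> F) x" using \<open>inj_on F D\<close> by simp
  qed
  ultimately have eq: "?G' \<circ> F' = (\<lambda>X. X)"
    by (rule has_derivative_unique)
  have "linear ?G'" "linear F'"
    using G F by (auto intro: has_derivative_linear)
  then have "real_det ?G' * real_det F' = 1"
    using real_det_compose[of ?G' F'] by (simp add: eq real_det_id)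
  then show ?thesis by (simp add: jacobian_def real_det_def)
qed

section \<open>The linearised power flow\<close>

locale power_grid = grid E for E :: "'v::finite option set set" +
  fixes z :: "'v option set \<Rightarrow> complex" and V0 :: complex
  assumes z_ne: "\<And>e. e \<in> E \<Longrightarrow> z e \<noteq> 0"
begin

text \<open>
  Conjugate admittances, the form in which the impedances enter the injections.
\<close>

definition y :: "'v \<Rightarrow> 'v option \<Rightarrow> complex" where
  "y a b = 1 / cnj (z {Some a, b})"

definition nbrs :: "'v \<Rightarrow> 'v option set" where
  "nbrs a = {b. {Some a, b} \<in> E}"

text \<open>
  The derivative of the injection map at \<open>V\<close>. The substation voltage is constant, hence
  it contributes \<open>V0\<close> to the coefficients and \<open>0\<close> to the increment
  \<open>X\<close>.
\<close>

definition lin :: "complex ^ 'v \<Rightarrow> complex ^ 'v \<Rightarrow> complex ^ 'v" where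
  "lin V X = (\<chi> a. \<Sum>b\<in>nbrs a. y a b *
     (X $ a * (cnj (V $ a) - cnj (bus_voltage V0 V b)) +
      V $ a * (cnj (X $ a) - cnj (bus_voltage 0 X b))))"

definition Delta :: "complex ^ 'v \<Rightarrow> real" where
  "Delta V = real_det (lin V)"

abbreviation F :: "complex ^ 'v \<Rightarrow> complex ^ 'v" where
  "F \<equiv> injection E z V0"

lemma F_nth: "F V $ a = (\<Sum>b\<in>nbrs a. y a b * (V $ a * (cnj (V $ a) - cnj (bus_voltage V0 V b))))"
  by (simp add: injection_def nbrs_def y_def)

lemma y_ne: "b \<in> nbrs a \<Longrightarrow> y a b \<noteq> 0"
  by (simp add: y_def nbrs_def z_ne)

lemma y_sym: "y a (Some b) = y b (Some a)"
  by (simp add: y_def insert_commute)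

lemma bus_voltage_add: "bus_voltage (c + d) (v + w) b = bus_voltage c v b + bus_voltage d w b"
  by (simp add: bus_voltage_def split: option.split)

lemma bus_voltage_scaleR: "bus_voltage (r *\<^sub>R c) (r *\<^sub>R v) b = r *\<^sub>R bus_voltage c v b"
  by (simp add: bus_voltage_def split: option.split)

lemma linear_lin: "linear (lin V)"
proof (rule linearI)
  fix X X' show "lin V (X + X') = lin V X + lin V X'"
    using bus_voltage_add[of 0 0 X X']
    by (simp add: lin_def vec_eq_iff algebra_simps flip: sum.distrib)
next
  fix r X show "lin V (r *\<^sub>R X) = r *\<^sub>R lin V X"
    using bus_voltage_scaleR[of r 0 X]
    by (simp add: lin_def vec_eq_iff algebra_simps scaleR_sum_right)
qed

lemma bus_voltage_has_derivative [derivative_intros]: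
  "((\<lambda>V. bus_voltage V0 V b) has_derivative (\<lambda>X. bus_voltage 0 X b)) (at V)"
proof (cases b)
  case None
  then show ?thesis by (simp add: bus_voltage_def)
next
  case (Some a)
  then show ?thesis
    by (auto simp: bus_voltage_def intro!: bounded_linear_imp_has_derivative bounded_linear_vec_nth)
qed

lemma nth_has_derivative [derivative_intros]:
  "((\<lambda>V. V $ a) has_derivative (\<lambda>X. X $ a)) (at (V :: complex ^ 'v))"
  by (intro bounded_linear_imp_has_derivative bounded_linear_vec_nth)

lemma F_has_derivative: "(F has_derivative lin V) (at V)"
proof -
  have nth: "((\<lambda>V. F V $ a) has_derivative (\<lambda>X. lin V X $ a)) (at V)" for a
    unfolding F_nth
    by (auto intro!: derivative_eq_intros has_derivative_cnj simp: lin_def fun_eq_iff algebra_simps)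
  have "((\<lambda>V. F V \<bullet> axis a c) has_derivative (\<lambda>X. lin V X \<bullet> axis a c)) (at V)" for a c
    unfolding axis_inner_complex by (rule has_derivative_inner_left[OF nth])
  then show ?thesis
    by (subst has_derivative_componentwise_within) (auto simp: Basis_vec_def)
qed

lemma abs_J_P_eq:
  assumes "invertible_on F D" "v \<in> D"
  shows "abs_J_P E z V0 D v = 1 / \<bar>Delta v\<bar>" and "Delta v \<noteq> 0"
proof -
  have *: "det (jacobian (inv_into D F) (F v)) * Delta v = 1"
    using jacobian_det_inverse[OF assms F_has_derivative] by (simp add: Delta_def)
  then show "Delta v \<noteq> 0" by auto
  then show "abs_J_P E z V0 D v = 1 / \<bar>Delta v\<bar>"
    using * by (simp add: abs_J_P_def field_simps flip: abs_mult)
qed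

lemma Delta_eq_0_iff: "Delta V = 0 \<longleftrightarrow> (\<exists>X. X \<noteq> 0 \<and> lin V X = 0)"
  by (simp add: Delta_def real_det_eq_0_iff linear_lin)

lemma real_polynomial_function_Re_Im_nth:
  "real_polynomial_function (\<lambda>v :: complex ^ 'v. Re (v $ a))"
  "real_polynomial_function (\<lambda>v :: complex ^ 'v. Im (v $ a))"
  by (auto intro!: real_polynomial_function.intros(1) bounded_linear_compose[OF bounded_linear_Re]
      bounded_linear_compose[OF bounded_linear_Im] bounded_linear_vec_nth)

lemma real_polynomial_function_bus:
  "real_polynomial_function (\<lambda>v :: complex ^ 'v. Re (bus_voltage V0 v b))"
  "real_polynomial_function (\<lambda>v :: complex ^ 'v. Im (bus_voltage V0 v b))"
  by (cases b; auto simp: bus_voltage_def real_polynomial_function_Re_Im_nth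
      intro: real_polynomial_function.intros(2))+

lemma real_polynomial_function_Delta: "real_polynomial_function Delta"
proof -
  have "real_polynomial_function (\<lambda>v. lin v X \<bullet> re_im_basis i)" for X i
    by (cases i)
       (simp_all add: re_im_basis_def axis_inner_complex inner_complex_def lin_def Re_sum Im_sum,
        (intro real_polynomial_function_sum real_polynomial_function.intros(4) real_polynomial_function.intros(3)
           real_polynomial_function_diff real_polynomial_function.intros(2)
           real_polynomial_function_Re_Im_nth real_polynomial_function_bus
           real_polynomial_function_minus | simp)+)
  then show ?thesis
    unfolding Delta_def[abs_def] by (rule real_polynomial_function_real_det)
qed

end

section \<open>A centre with one leaf\<close>

text \<open>
  The equation \<open>(cnj v - cnj u) * b + v * (cnj b - cnj k) = 0\<close> is the linearised power
  flow at a leaf with voltage \<open>v\<close> whose only neighbour has voltage \<open>u\<close>;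
  \<open>b\<close> and \<open>k\<close> are the increments of \<open>v\<close> and \<open>u\<close>.
  Here is the determinant \<open>|v - u|\<^sup>2 - |v|\<^sup>2\<close> of this equation as a
  real-linear one for \<open>b\<close>.
\<close>

definition leaf_det :: "complex \<Rightarrow> complex \<Rightarrow> real" where
  "leaf_det u v = (cmod u)\<^sup>2 - 2 * Re (v * cnj u)"

text \<open>
  Eliminating the leaf increment leaves an equation \<open>A * k + B * cnj k = 0\<close> for the
  centre, whose determinant \<open>|A|\<^sup>2 - |B|\<^sup>2\<close> is \<open>leaf_det u v\<close>
  times the following polynomial. The centre has total admittance \<open>Y\<close>, \<open>s\<close>
  is the current that feeds it from above, and \<open>y\<close> belongs to the edge to the leaf.
\<close>

definition branch_det :: "complex \<Rightarrow> complex \<Rightarrow> complex \<Rightarrow> complex \<Rightarrow> complex \<Rightarrow> real" where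
  "branch_det Y s y u v = leaf_det u v * ((cmod s)\<^sup>2 - 2 * Re (cnj Y * s * u)) - 2 * Re (cnj y * s * u) * (cmod v)\<^sup>2"

lemma cmod_sq: "(cmod z)\<^sup>2 = Re z * Re z + Im z * Im z"
  by (simp add: cmod_power2 flip: power2_eq_square)

lemma of_real_leaf_det: "of_real (leaf_det u v) = u * cnj u - v * cnj u - cnj v * u"
  unfolding leaf_det_def cmod_sq by (simp add: complex_eq_iff)

text \<open>
  Cramer's rule for the leaf equation, written without a division so that it remains informative
  when the determinant vanishes.
\<close>

lemma leaf_response:
  assumes "(cnj v - cnj u) * b + v * (cnj b - cnj k) = 0"
  shows "of_real (leaf_det u v) * b = v * (v - u) * cnj k - v * cnj v * k"
proof -
  have c: "(v - u) * cnj b + cnj v * (b - k) = 0"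
    using arg_cong[OF assms, of cnj] by simp
  have "of_real (leaf_det u v) * b = (v - u) * ((cnj v - cnj u) * b + v * (cnj b - cnj k))
        - v * ((v - u) * cnj b + cnj v * (b - k)) + v * (v - u) * cnj k - v * cnj v * k"
    unfolding of_real_leaf_det by (simp add: algebra_simps)
  then show ?thesis using assms c by simp
qed

lemma leaf_balance:
  assumes "(cnj v - cnj u) * b + v * (cnj b - cnj k) = 0"
  shows "Im (cnj v * k + u * cnj b) = 0"
proof -
  have "Im ((cnj v - cnj u) * b + v * (cnj b - cnj k)) = 0" using assms by simp
  then show ?thesis by (simp add: algebra_simps)
qed

text \<open>
  A leaf with singular equation cannot answer an arbitrary increment of the centre: solvability
  confines \<open>k\<close> to the real line of rotations \<open>\<i> * u\<close> of the centre
  voltage.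
\<close>

lemma leaf_degenerate:
  assumes row: "(cnj v - cnj u) * b + v * (cnj b - cnj k) = 0"
    and q: "leaf_det u v = 0" "v \<noteq> 0"
  shows "Re (u * cnj k) = 0"
proof -
  have "v * ((v - u) * cnj k - cnj v * k) = 0"
    using leaf_response[OF row] q(1) by (simp add: algebra_simps)
  then have "(v - u) * cnj k - cnj v * k = 0" using q(2) by simp
  then have "Re ((v - u) * cnj k - cnj v * k) = 0" by simp
  then show ?thesis by (simp add: algebra_simps)
qed

text \<open>
  For \<open>k = \<i> \<kappa> u\<close> the balance says that
  \<open>\<kappa> * (\<i> * s * u)\<close> is a real multiple of \<open>y\<close>, which the
  hypothesis \<open>e\<close> rules out unless \<open>\<kappa> = 0\<close>.
\<close>

lemma rotation_residual:
  assumes k: "Re (u * cnj k) = 0" and e: "Re (cnj y * s * u) \<noteq> 0" and R: "Im R = 0"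
    and bal: "s * k + y * R = 0"
  shows "k = 0"
proof -
  have "u \<noteq> 0" "y \<noteq> 0" using e by auto
  have "cnj y * s * k = - (y * cnj y) * R"
    using arg_cong[OF bal, of "\<lambda>x. cnj y * x"]
    by (simp add: algebra_simps eq_neg_iff_add_eq_0)
  then have im: "Im (cnj y * s * k) = 0" using R by (simp add: algebra_simps)
  define w where "w = cnj y * s * u"
  have "k * cnj u = \<i> * of_real (Im (k * cnj u))"
    using k by (simp add: complex_eq_iff algebra_simps)
  moreover have "(cnj y * s * k) * (u * cnj u) = w * (k * cnj u)"
    unfolding w_def by (simp add: mult_ac)
  ultimately have "(cnj y * s * k) * (u * cnj u) = w * (\<i> * of_real (Im (k * cnj u)))"
    by metis
  then have "Im ((cnj y * s * k) * (u * cnj u)) = Re w * Im (k * cnj u)"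
    by simp
  moreover have "Im ((cnj y * s * k) * (u * cnj u)) = 0"
    using im by (simp add: complex_mult_cnj)
  ultimately have "Re w * Im (k * cnj u) = 0" by simp
  then have "Im (k * cnj u) = 0" using e by (simp add: w_def)
  then have "k * cnj u = 0" using k by (simp add: complex_eq_iff algebra_simps)
  then show ?thesis using \<open>u \<noteq> 0\<close> by simp
qed

text \<open>
  Along rotations of \<open>u\<close> the terms with the total admittance cancel, because
  \<open>|u|\<^sup>2\<close> does not change.
\<close>

lemma centre_without_admittance:
  assumes "Re (u * cnj k) = 0"
  shows "(Y * cnj u - t) * k + u * (Y * cnj k - r) = - (t * k + u * r)"
proof -
  have "cnj u * k + u * cnj k = 0" using assms by (simp add: complex_eq_iff algebra_simps)
  then have "Y * (cnj u * k + u * cnj k) = 0" by simp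
  then show ?thesis by (simp add: algebra_simps)
qed

text \<open>
  Two regimes: if the leaf equation is regular, the leaf is eliminated and \<open>branch_det\<close>
  decides; if it is singular, the centre can only rotate and the rotation is excluded by the
  remaining term of \<open>branch_det\<close>.
\<close>

lemma single_leaf_regular:
  assumes row: "(cnj v - cnj u) * b + v * (cnj b - cnj k) = 0"
    and centre: "(Y * cnj u - s - y * cnj v) * k + u * (Y * cnj k - y * cnj b) = 0"
    and P: "branch_det Y s y u v \<noteq> 0"
  shows "k = 0 \<and> b = 0"
proof (cases "leaf_det u v = 0")
  case True
  then have e: "Re (cnj y * s * u) \<noteq> 0" "v \<noteq> 0" using P by (auto simp: branch_det_def)
  have k: "Re (u * cnj k) = 0" using leaf_degenerate[OF row True e(2)] .
  have "(Y * cnj u - (s + y * cnj v)) * k + u * (Y * cnj k - y * cnj b) = 0"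
    using centre by (simp add: algebra_simps)
  then have "(s + y * cnj v) * k + u * (y * cnj b) = 0"
    unfolding centre_without_admittance[OF k] by (simp only: neg_equal_0_iff_equal)
  then have bal: "s * k + y * (cnj v * k + u * cnj b) = 0"
    by (simp add: algebra_simps)
  have k0: "k = 0"
    using rotation_residual[OF k e(1) leaf_balance[OF row] bal] .
  have "y \<noteq> 0" "u \<noteq> 0" using e(1) by auto
  then show ?thesis using k0 bal by simp
next
  case False
  define q where "q = leaf_det u v"
  define Z where "Z = of_real q * Y + y * (v * cnj v)"
  have qb: "of_real q * b = v * (v - u) * cnj k - v * cnj v * k"
    unfolding q_def by (rule leaf_response[OF row])
  have qbc: "of_real q * cnj b = cnj v * (cnj v - cnj u) * k - v * cnj v * cnj k"
  proof -
    have "of_real q * cnj b = cnj (of_real q * b)" by simp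
    also have "\<dots> = cnj (v * (v - u) * cnj k - v * cnj v * k)" by (simp only: qb)
    finally show ?thesis by (simp add: mult_ac)
  qed
  have qv: "of_real q = u * cnj u - v * cnj u - cnj v * u"
    unfolding q_def by (rule of_real_leaf_det)
  have "0 = of_real q * ((Y * cnj u - s - y * cnj v) * k + u * (Y * cnj k - y * cnj b))"
    using centre by simp
  also have "\<dots> = (of_real q * (Y * cnj u - s - y * cnj v)) * k + u * (of_real q * Y) * cnj k
      - u * y * (of_real q * cnj b)" by (simp add: algebra_simps)
  also have "\<dots> = (cnj u * Z - of_real q * s) * k + u * Z * cnj k"
    unfolding qbc Z_def by (simp add: qv algebra_simps)
  \<comment> \<open>The centre equation after elimination, of the form \<open>A * k + B * cnj k = 0\<close>: a nonzero solution needs \<open>|A| = |B|\<close>.\<close>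
  finally have eq: "(cnj u * Z - of_real q * s) * k = - (u * Z * cnj k)"
    by (simp add: eq_neg_iff_add_eq_0)
  have "k = 0"
  proof (rule ccontr)
    assume "k \<noteq> 0"
    have "cmod (cnj u * Z - of_real q * s) * cmod k = cmod (u * Z) * cmod k"
      using arg_cong[OF eq, of cmod] by (simp add: norm_mult)
    then have "(cmod (cnj u * Z - of_real q * s))\<^sup>2 = (cmod (u * Z))\<^sup>2" using \<open>k \<noteq> 0\<close> by simp
    moreover have "(cmod (cnj u * Z - of_real q * s))\<^sup>2 = (cmod (u * Z))\<^sup>2 + q * branch_det Y s y u v"
      unfolding branch_det_def q_def[symmetric] Z_def
      by (simp add: cmod_sq algebra_simps)
    ultimately show False using P False by (simp add: q_def)
  qed
  then show ?thesis using qb False by (simp add: q_def)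
qed

text \<open>
  Rotating centre and leaf by the same angle preserves the power between them, but not the balance
  with the feeding current. Moving the leaf along \<open>1 / cnj u\<close> restores the balance: by
  \<open>e\<close> a real multiple suffices, and by \<open>q\<close> the leaf equation does not
  notice it.
\<close>

lemma single_leaf_singular:
  assumes q: "leaf_det u v = 0" and e: "Re (cnj y * s * u) = 0" and ne: "u \<noteq> 0" "y \<noteq> 0"
  defines "k \<equiv> \<i> * u" and "b \<equiv> \<i> * v - (\<i> * cnj y * s * u) / ((cmod y)\<^sup>2 * cnj u)"
  shows "(cnj v - cnj u) * b + v * (cnj b - cnj k) = 0"
    and "(Y * cnj u - s - y * cnj v) * k + u * (Y * cnj k - y * cnj b) = 0"
proof -
  define \<rho> where "\<rho> = - Im (cnj y * s * u) / (cmod y)\<^sup>2"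
  have rho: "(\<i> * cnj y * s * u) / ((cmod y)\<^sup>2) = of_real \<rho>"
    using e by (simp add: \<rho>_def complex_eq_iff algebra_simps)
  have b: "b = \<i> * v - of_real \<rho> / cnj u"
    unfolding b_def rho[symmetric] by simp
  have qv: "v * cnj u + cnj v * u = u * cnj u"
    using of_real_leaf_det[of u v] q by (simp add: algebra_simps)
  have sy: "s * \<i> * u = y * of_real \<rho>"
  proof -
    have "y * of_real \<rho> = (y * cnj y) * (\<i> * s * u) / (cmod y)\<^sup>2"
      unfolding rho[symmetric] by simp
    then show ?thesis using ne by (simp add: complex_norm_square[symmetric] mult_ac)
  qed
  have "u * cnj u * ((cnj v - cnj u) * b + v * (cnj b - cnj k)) =
      of_real \<rho> * (u * cnj u - (v * cnj u + cnj v * u))"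
    unfolding b k_def using ne by (simp add: field_simps)
  then show "(cnj v - cnj u) * b + v * (cnj b - cnj k) = 0"
    unfolding qv using ne by simp
  have "(Y * cnj u - s - y * cnj v) * k + u * (Y * cnj k - y * cnj b) = y * of_real \<rho> - s * \<i> * u"
    unfolding b k_def using ne by (simp add: field_simps)
  then show "(Y * cnj u - s - y * cnj v) * k + u * (Y * cnj k - y * cnj b) = 0"
    using sy by simp
qed

section \<open>A centre with two leaves\<close>

text \<open>
  With \<open>v = \<nu> * u\<close> the response of a regular leaf to \<open>k\<close> is bounded by
  a multiple of \<open>|k|\<close> that does not depend on \<open>u\<close>, which allows
  \<open>u\<close> to shrink in the next lemma.
\<close>

lemma leaf_bound:
  assumes row: "(cnj (\<nu> * u) - cnj u) * b + \<nu> * u * (cnj b - cnj k) = 0"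
    and u: "u \<noteq> 0" and nu: "Re \<nu> \<noteq> 1/2"
  shows "cmod b \<le> (cmod \<nu> * cmod (\<nu> - 1) + (cmod \<nu>)\<^sup>2) / \<bar>1 - 2 * Re \<nu>\<bar> * cmod k"
proof -
  have q: "leaf_det u (\<nu> * u) = (cmod u)\<^sup>2 * (1 - 2 * Re \<nu>)"
    unfolding leaf_det_def cmod_sq by (simp add: algebra_simps)
  have "(cmod u)\<^sup>2 * (\<bar>1 - 2 * Re \<nu>\<bar> * cmod b) = cmod (of_real (leaf_det u (\<nu> * u)) * b)"
    by (simp only: norm_mult norm_of_real q) (simp add: abs_mult)
  also have "\<dots> = cmod (\<nu> * u * (\<nu> * u - u) * cnj k - \<nu> * u * cnj (\<nu> * u) * k)"
    using leaf_response[OF row] by simp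
  also have "\<dots> \<le> cmod (\<nu> * u * (\<nu> * u - u) * cnj k) + cmod (\<nu> * u * cnj (\<nu> * u) * k)"
    by (rule norm_triangle_ineq4)
  also have "\<nu> * u * (\<nu> * u - u) * cnj k = \<nu> * (\<nu> - 1) * u\<^sup>2 * cnj k"
    by (simp add: power2_eq_square algebra_simps)
  also have "cmod (\<nu> * (\<nu> - 1) * u\<^sup>2 * cnj k) + cmod (\<nu> * u * cnj (\<nu> * u) * k)
     = (cmod u)\<^sup>2 * ((cmod \<nu> * cmod (\<nu> - 1) + (cmod \<nu>)\<^sup>2) * cmod k)"
  proof -
    have "cmod (\<nu> * (\<nu> - 1) * u\<^sup>2 * cnj k) = cmod \<nu> * cmod (\<nu> - 1) * (cmod u)\<^sup>2 * cmod k"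
      by (simp add: norm_mult norm_power)
    moreover have "cmod (\<nu> * u * cnj (\<nu> * u) * k) = (cmod \<nu>)\<^sup>2 * (cmod u)\<^sup>2 * cmod k"
      by (simp add: norm_mult power2_eq_square)
    ultimately show ?thesis by (simp add: algebra_simps)
  qed
  finally have "\<bar>1 - 2 * Re \<nu>\<bar> * cmod b \<le> (cmod \<nu> * cmod (\<nu> - 1) + (cmod \<nu>)\<^sup>2) * cmod k"
    using u by simp
  then show ?thesis using nu by (simp add: field_simps)
qed

text \<open>
  For small \<open>u\<close> the term \<open>s * k\<close> dominates the centre equation, all other
  terms being \<open>O(|u| |k|)\<close>.
\<close>

lemma two_leaves_regular:
  fixes Y s ya yc \<nu>a \<nu>c :: complex
  assumes s: "s \<noteq> 0" and nu: "Re \<nu>a \<noteq> 1/2" "Re \<nu>c \<noteq> 1/2"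
  shows "\<exists>\<delta>>0. \<forall>u k ba bc. u \<noteq> 0 \<longrightarrow> cmod u < \<delta> \<longrightarrow>
    (cnj (\<nu>a * u) - cnj u) * ba + \<nu>a * u * (cnj ba - cnj k) = 0 \<longrightarrow>
    (cnj (\<nu>c * u) - cnj u) * bc + \<nu>c * u * (cnj bc - cnj k) = 0 \<longrightarrow>
    (Y * cnj u - s - ya * cnj (\<nu>a * u) - yc * cnj (\<nu>c * u)) * k
      + u * (Y * cnj k - ya * cnj ba - yc * cnj bc) = 0 \<longrightarrow> k = 0 \<and> ba = 0 \<and> bc = 0"
proof -
  define ca where "ca = (cmod \<nu>a * cmod (\<nu>a - 1) + (cmod \<nu>a)\<^sup>2) / \<bar>1 - 2 * Re \<nu>a\<bar>"
  define cc where "cc = (cmod \<nu>c * cmod (\<nu>c - 1) + (cmod \<nu>c)\<^sup>2) / \<bar>1 - 2 * Re \<nu>c\<bar>"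
  define C where "C = 2 * cmod Y + cmod ya * (cmod \<nu>a + ca) + cmod yc * (cmod \<nu>c + cc)"
  have "0 \<le> ca" "0 \<le> cc" by (auto simp: ca_def cc_def intro!: divide_nonneg_nonneg add_nonneg_nonneg)
  then have C: "0 \<le> C" by (simp add: C_def)
  show ?thesis
  proof (intro exI conjI allI impI)
    show "0 < cmod s / (C + 1)" using s C by simp
    fix u k ba bc
    assume u: "u \<noteq> 0" "cmod u < cmod s / (C + 1)"
    assume ra: "(cnj (\<nu>a * u) - cnj u) * ba + \<nu>a * u * (cnj ba - cnj k) = 0"
      and rc: "(cnj (\<nu>c * u) - cnj u) * bc + \<nu>c * u * (cnj bc - cnj k) = 0"
      and ce: "(Y * cnj u - s - ya * cnj (\<nu>a * u) - yc * cnj (\<nu>c * u)) * k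
      + u * (Y * cnj k - ya * cnj ba - yc * cnj bc) = 0"
    have ba: "cmod ba \<le> ca * cmod k" and bc: "cmod bc \<le> cc * cmod k"
      unfolding ca_def cc_def by (rule leaf_bound[OF ra u(1) nu(1)], rule leaf_bound[OF rc u(1) nu(2)])
    have "s * k = (Y * cnj u - ya * cnj (\<nu>a * u) - yc * cnj (\<nu>c * u)) * k
      + u * (Y * cnj k - ya * cnj ba - yc * cnj bc)"
      using ce by (simp add: algebra_simps)
    then have "cmod s * cmod k \<le> cmod (Y * cnj u - ya * cnj (\<nu>a * u) - yc * cnj (\<nu>c * u)) * cmod k
       + cmod u * cmod (Y * cnj k - ya * cnj ba - yc * cnj bc)"
      by (metis norm_mult norm_triangle_ineq)
    also have "cmod (Y * cnj u - ya * cnj (\<nu>a * u) - yc * cnj (\<nu>c * u)) \<le>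
       cmod Y * cmod u + cmod ya * (cmod \<nu>a * cmod u) + cmod yc * (cmod \<nu>c * cmod u)"
      by (rule order_trans[OF norm_triangle_ineq4] add_mono order_trans[OF norm_triangle_ineq4])+
         (simp_all add: norm_mult)
    also have "cmod (Y * cnj k - ya * cnj ba - yc * cnj bc) \<le>
       cmod Y * cmod k + cmod ya * cmod ba + cmod yc * cmod bc"
      by (rule order_trans[OF norm_triangle_ineq4] add_mono order_trans[OF norm_triangle_ineq4])+
         (simp_all add: norm_mult)
    also have "\<dots> \<le> cmod Y * cmod k + cmod ya * (ca * cmod k) + cmod yc * (cc * cmod k)"
      using ba bc by (intro add_mono mult_left_mono) auto
    finally have "cmod s * cmod k \<le> C * cmod u * cmod k"
      by (simp add: C_def algebra_simps mult_right_mono mult_left_mono)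
    moreover have "C * cmod u < cmod s"
    proof -
      have "(C + 1) * cmod u < cmod s" using u(2) C by (simp add: field_simps)
      then show ?thesis using norm_ge_zero[of u] by (simp add: algebra_simps del: norm_ge_zero)
    qed
    ultimately have "k = 0"
      by (metis linorder_not_le mult_le_cancel_right norm_ge_zero norm_eq_zero order_less_le)
    then show "k = 0" "ba = 0" "bc = 0" using ba bc by auto
  qed
qed

text \<open>
  The ratio \<open>1/2\<close> is the degenerate one. With exactly one leaf at this ratio the centre
  can only rotate; a leaf at another real ratio \<open>\<nu>\<close> follows this rotation and drops
  out of the balance, and \<open>rotation_residual\<close> applies as for a single leaf.
\<close>

lemma two_leaves_half_regular:
  assumes u: "u \<noteq> 0" and nu: "\<nu> \<noteq> (1/2::real)" and e: "Re (cnj ya * s * u) \<noteq> 0"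
    and ra: "(cnj (u/2) - cnj u) * ba + u/2 * (cnj ba - cnj k) = 0"
    and rc: "(cnj (\<nu> * u) - cnj u) * bc + \<nu> * u * (cnj bc - cnj k) = 0"
    and ce: "(Y * cnj u - s - ya * cnj (u/2) - yc * cnj (\<nu> * u)) * k
      + u * (Y * cnj k - ya * cnj ba - yc * cnj bc) = 0"
  shows "k = 0 \<and> ba = 0 \<and> bc = 0"
proof -
  have "leaf_det u (u/2) = 0" unfolding leaf_det_def cmod_sq by (simp add: algebra_simps)
  then have k: "Re (u * cnj k) = 0" using leaf_degenerate[OF ra] u by simp
  have q: "leaf_det u (\<nu> * u) = (cmod u)\<^sup>2 * (1 - 2 * \<nu>)"
    unfolding leaf_det_def cmod_sq by (simp add: algebra_simps)
  have ku: "u * cnj k = - (cnj u * k)" using k by (simp add: complex_eq_iff algebra_simps)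
  have "of_real (leaf_det u (\<nu> * u)) * bc = \<nu> * (\<nu> - 1) * u * (u * cnj k) - \<nu> * \<nu> * (u * cnj u) * k"
    using leaf_response[OF rc] by (simp add: algebra_simps)
  also have "\<dots> = of_real (leaf_det u (\<nu> * u)) * (\<nu> * k)"
    unfolding ku of_real_leaf_det by (simp add: algebra_simps)
  finally have "of_real (leaf_det u (\<nu> * u)) * bc = of_real (leaf_det u (\<nu> * u)) * (\<nu> * k)" .
  moreover have "leaf_det u (\<nu> * u) \<noteq> 0" using u nu by (simp add: q)
  ultimately have bc: "bc = \<nu> * k" by (simp only: mult_cancel_left of_real_eq_0_iff) simp
  have "(Y * cnj u - (s + ya * cnj (u/2) + yc * cnj (\<nu> * u))) * k
      + u * (Y * cnj k - (ya * cnj ba + yc * cnj bc)) = 0"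
    using ce by (simp add: algebra_simps)
  then have "(s + ya * cnj (u/2) + yc * cnj (\<nu> * u)) * k + u * (ya * cnj ba + yc * cnj bc) = 0"
    unfolding centre_without_admittance[OF k] by (simp only: neg_equal_0_iff_equal)
  then have "s * k + ya * (cnj (u/2) * k + u * cnj ba) + yc * \<nu> * (cnj u * k + u * cnj k) = 0"
    unfolding bc by (simp add: algebra_simps)
  then have bal: "s * k + ya * (cnj (u/2) * k + u * cnj ba) = 0" using ku by simp
  have k0: "k = 0" using rotation_residual[OF k e leaf_balance[OF ra] bal] .
  have "ya \<noteq> 0" using e by auto
  then show ?thesis using k0 bal u bc by simp
qed

lemma real_dependence:
  fixes a b c :: complex
  shows "\<exists>x y z :: real. (x, y, z) \<noteq> (0, 0, 0) \<and> of_real x * a + of_real y * b + of_real z * c = 0"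
proof (cases "Im (b * cnj c) = 0")
  case True
  show ?thesis
  proof (cases "c = 0")
    case True then show ?thesis by (intro exI[of _ 0] exI[of _ 1]) auto
  next
    case False
    have "b * cnj c = of_real (Re (b * cnj c))"
      using \<open>Im (b * cnj c) = 0\<close> by (simp add: complex_eq_iff)
    then have "b * of_real ((cmod c)\<^sup>2) = of_real (Re (b * cnj c)) * c"
      by (metis complex_norm_square mult.assoc mult.commute)
    then have "of_real 0 * a + of_real ((cmod c)\<^sup>2) * b + of_real (- Re (b * cnj c)) * c = 0"
      by (simp only: mult.commute[of _ b] of_real_minus of_real_0 mult_zero_left add_0 mult_minus_left right_minus)
    then show ?thesis using False by (metis norm_eq_zero prod.inject power_eq_0_iff)
  qed
next
  case False
  have "of_real (Im (b * cnj c)) * a + of_real (Im (c * cnj a)) * b + of_real (Im (a * cnj b)) * c = 0"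
    by (simp add: complex_eq_iff algebra_simps)
  then show ?thesis using False by (metis prod.inject)
qed

text \<open>
  With both leaves at ratio \<open>1/2\<close> there are three real unknowns, the rotation of the
  centre and one free amplitude for each leaf, and a single complex equation.
\<close>

lemma two_leaves_singular:
  assumes u: "u \<noteq> 0"
  shows "\<exists>k ba bc. (k, ba, bc) \<noteq> (0, 0, 0) \<and>
    (cnj (u/2) - cnj u) * ba + u/2 * (cnj ba - cnj k) = 0 \<and>
    (cnj (u/2) - cnj u) * bc + u/2 * (cnj bc - cnj k) = 0 \<and>
    (Y * cnj u - s - ya * cnj (u/2) - yc * cnj (u/2)) * k
      + u * (Y * cnj k - ya * cnj ba - yc * cnj bc) = 0"
proof -
  obtain \<kappa> ta tc :: real where t: "(\<kappa>, ta, tc) \<noteq> (0, 0, 0)"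
    and dep: "of_real \<kappa> * (\<i> * s) + of_real ta * (cnj u * ya) + of_real tc * (cnj u * yc) = 0"
    using real_dependence by blast
  have dep': "\<i> * \<kappa> * s = - (ta * cnj u * ya) - tc * cnj u * yc"
    using dep by (simp add: algebra_simps eq_neg_iff_add_eq_0)
  let ?k = "\<i> * \<kappa> * u" let ?ba = "(ta + \<i> * \<kappa> / 2) * u" let ?bc = "(tc + \<i> * \<kappa> / 2) * u"
  have "(?k, ?ba, ?bc) \<noteq> (0, 0, 0)"
    using t u by (auto simp: complex_eq_iff)
  moreover have "(Y * cnj u - s - ya * cnj (u/2) - yc * cnj (u/2)) * ?k
      + u * (Y * cnj ?k - ya * cnj ?ba - yc * cnj ?bc)
     = - (\<i> * \<kappa> * s) * u - (ta * cnj u * ya) * u - tc * cnj u * yc * u"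
    by (simp add: algebra_simps)
  moreover have "\<dots> = 0" unfolding dep' by (simp add: algebra_simps)
  ultimately show ?thesis
    by (intro exI[of _ ?k] exI[of _ ?ba] exI[of _ ?bc]) (simp add: algebra_simps)
qed

section \<open>Freezing: leading terms of the determinant\<close>

context power_grid
begin

definition Desc :: "'v \<Rightarrow> 'v set" where
  "Desc j = {a. (a, j) \<in> {(c, d). par c = Some d}\<^sup>*}"

lemma Desc_self [simp]: "j \<in> Desc j"
  by (simp add: Desc_def)

lemma Desc_child: "par c = Some a \<Longrightarrow> a \<in> Desc j \<Longrightarrow> c \<in> Desc j"
  unfolding Desc_def by (simp add: converse_rtrancl_into_rtrancl)

lemma Desc_par: "a \<in> Desc j \<Longrightarrow> a \<noteq> j \<Longrightarrow> \<exists>b \<in> Desc j. par a = Some b"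
  unfolding Desc_def by (auto elim: converse_rtranclE)

lemma Desc_depth: "a \<in> Desc j \<Longrightarrow> depth (Some j) \<le> depth (Some a)"
proof (induction "depth (Some a)" arbitrary: a rule: less_induct)
  case less
  show ?case
  proof (cases "a = j")
    case False
    then obtain b where b: "b \<in> Desc j" "par a = Some b" using Desc_par less.prems by blast
    then have "depth (Some b) < depth (Some a)" using par_less[of a] by simp
    then show ?thesis using less.hyps[OF _ b(1)] by simp
  qed simp
qed

lemma nbrs_iff: "b \<in> nbrs a \<longleftrightarrow> b = par a \<or> (\<exists>c. b = Some c \<and> par c = Some a)"
  using edge_cases[of a b] par_edge[of a] edge_iff by (auto simp: nbrs_def)

lemma par_in_nbrs [simp]: "par a \<in> nbrs a"
  by (simp add: nbrs_iff)

text \<open>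
  The node \<open>b\<close> has the voltage \<open>\<epsilon> ^ exponent K i b * U\<^sub>b\<close>.
  Outside the active set \<open>K\<close> the exponent is the depth, so that in the limit each node
  sees nothing but its parent. On \<open>K\<close> all exponents agree with the one of the parent of
  the top node \<open>i\<close>, so that the equations of \<open>K\<close> and the current feeding
  \<open>i\<close> survive on the same scale.
\<close>

definition exponent :: "'v set \<Rightarrow> 'v \<Rightarrow> 'v option \<Rightarrow> nat" where
  "exponent K i b = (if b \<in> Some ` K then depth (par i) else depth b)"

text \<open>
  The power of \<open>\<epsilon>\<close> that divides the equation of \<open>a\<close> (see
  \<open>lin_rescaled\<close>).
\<close>

definition row_exponent :: "'v set \<Rightarrow> 'v \<Rightarrow> 'v \<Rightarrow> nat" where
  "row_exponent K i a = (if a \<in> K then depth (par i) else exponent K i (par a))"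

text \<open>
  \<open>K\<close> is a subtree with top node \<open>i\<close>, not necessarily closed under taking
  children.
\<close>

definition active :: "'v set \<Rightarrow> 'v \<Rightarrow> bool" where
  "active K i \<longleftrightarrow> i \<in> K \<and> (\<forall>a\<in>K. a \<noteq> i \<longrightarrow> par a \<in> Some ` K)"

definition rescaled :: "'v set \<Rightarrow> 'v \<Rightarrow> real \<Rightarrow> complex ^ 'v \<Rightarrow> complex ^ 'v" where
  "rescaled K i \<epsilon> U = (\<chi> a. \<epsilon> ^ exponent K i (Some a) *\<^sub>R U $ a)"

text \<open>
  The linearised flow at the rescaled voltages, with the equation of \<open>a\<close> divided by
  \<open>\<epsilon> ^ row_exponent K i a\<close>. As no exponent is negative, this makes sense at
  \<open>\<epsilon> = 0\<close>.
\<close>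

definition blow_up :: "'v set \<Rightarrow> 'v \<Rightarrow> real \<Rightarrow> complex ^ 'v \<Rightarrow> complex ^ 'v \<Rightarrow> complex ^ 'v" where
  "blow_up K i \<epsilon> U X = (\<chi> a. \<Sum>b\<in>nbrs a. y a b *
     (X $ a * (\<epsilon> ^ (exponent K i (Some a) - row_exponent K i a) *\<^sub>R cnj (U $ a)
        - \<epsilon> ^ (exponent K i b - row_exponent K i a) *\<^sub>R cnj (bus_voltage V0 U b)) +
      \<epsilon> ^ (exponent K i (Some a) - row_exponent K i a) *\<^sub>R U $ a * (cnj (X $ a) - cnj (bus_voltage 0 X b))))"

definition frozen_Delta :: "'v set \<Rightarrow> 'v \<Rightarrow> complex ^ 'v \<Rightarrow> real" where
  "frozen_Delta K i U = real_det (blow_up K i 0 U)"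

lemma active_depth:
  assumes "active K i" "a \<in> K" shows "depth (Some i) \<le> depth (Some a)"
  using assms(2)
proof (induction "depth (Some a)" arbitrary: a rule: less_induct)
  case less
  show ?case
  proof (cases "a = i")
    case False
    then obtain b where b: "b \<in> K" "par a = Some b" using assms(1) less.prems by (auto simp: active_def)
    then have "depth (Some b) < depth (Some a)" using par_less[of a] by simp
    then show ?thesis using less.hyps[OF _ b(1)] by simp
  qed simp
qed

lemma active_par_notin: "active K i \<Longrightarrow> par i \<notin> Some ` K"
  using active_depth par_less[of i] by fastforce

lemma exponent_self:
  assumes "active K i"
  shows "row_exponent K i a \<le> exponent K i (Some a)"
    and "a \<notin> K \<Longrightarrow> row_exponent K i a < exponent K i (Some a)"
proof -
  have *: "row_exponent K i a < exponent K i (Some a)" if "a \<notin> K"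
  proof (cases "par a \<in> Some ` K")
    case True
    then obtain b where b: "par a = Some b" "b \<in> K" by auto
    have "depth (par i) < depth (Some b)"
      using active_depth[OF assms b(2)] par_less[of i] by simp
    also have "\<dots> < depth (Some a)" using par_less[of a] b by simp
    finally show ?thesis using that True by (auto simp: row_exponent_def exponent_def)
  next
    case False
    then show ?thesis using that par_less[of a] by (auto simp: row_exponent_def exponent_def)
  qed
  then show "a \<notin> K \<Longrightarrow> row_exponent K i a < exponent K i (Some a)" .
  show "row_exponent K i a \<le> exponent K i (Some a)"
    using * by (cases "a \<in> K") (auto simp: row_exponent_def exponent_def)
qed

text \<open>
  The equation of \<open>a\<close> has the scale of its largest neighbour voltage: the parent
  outside \<open>K\<close>, and the common scale inside. Everything else is strictly smaller and
  disappears at \<open>\<epsilon> = 0\<close>.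
\<close>

lemma exponent_nbr:
  assumes "active K i" "b \<in> nbrs a"
  shows "row_exponent K i a \<le> exponent K i b"
    and "a \<notin> K \<Longrightarrow> b \<noteq> par a \<Longrightarrow> row_exponent K i a < exponent K i b"
    and "a \<in> K \<Longrightarrow> b \<notin> Some ` K \<Longrightarrow> b \<noteq> par i \<Longrightarrow> row_exponent K i a < exponent K i b"
proof -
  consider "b = par a" | c where "b = Some c" "par c = Some a"
    using assms(2) nbrs_iff by blast
  then have "row_exponent K i a \<le> exponent K i b \<and> (a \<notin> K \<and> b \<noteq> par a \<longrightarrow> row_exponent K i a < exponent K i b)
    \<and> (a \<in> K \<and> b \<notin> Some ` K \<and> b \<noteq> par i \<longrightarrow> row_exponent K i a < exponent K i b)"
  proof cases
    case 1
    show ?thesis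
    proof (cases "a \<in> K")
      case True
      then show ?thesis using assms(1) 1
        by (cases "a = i") (auto simp: active_def row_exponent_def exponent_def)
    next
      case False then show ?thesis using 1 by (simp add: row_exponent_def)
    qed
  next
    case 2
    have less: "depth (Some a) < depth (Some c)" using par_less[of c] 2 by simp
    show ?thesis
    proof (cases "a \<in> K")
      case True
      then have "depth (par i) < depth (Some a)"
        using active_depth[OF assms(1) True] par_less[of i] by simp
      then show ?thesis using True less 2 by (auto simp: row_exponent_def exponent_def)
    next
      case a: False
      show ?thesis
      proof (cases "c \<in> K")
        case True
        then have "c = i" using a 2 assms(1) by (auto simp: active_def)
        then have "exponent K i b = exponent K i (Some a)" using 2 True a by (auto simp: exponent_def)
        then show ?thesis using exponent_self(2)[OF assms(1) a] a by simp
      next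
        case False
        have "exponent K i (Some a) = depth (Some a)" "exponent K i b = depth (Some c)"
          using a False 2 by (auto simp: exponent_def)
        then show ?thesis using exponent_self(2)[OF assms(1) a] less a by simp
      qed
    qed
  qed
  then show "row_exponent K i a \<le> exponent K i b"
    and "a \<notin> K \<Longrightarrow> b \<noteq> par a \<Longrightarrow> row_exponent K i a < exponent K i b"
    and "a \<in> K \<Longrightarrow> b \<notin> Some ` K \<Longrightarrow> b \<noteq> par i \<Longrightarrow> row_exponent K i a < exponent K i b"
    by auto
qed

lemma bus_voltage_rescaled:
  "bus_voltage V0 (rescaled K i \<epsilon> U) b = \<epsilon> ^ exponent K i b *\<^sub>R bus_voltage V0 U b"
  by (cases b) (auto simp: bus_voltage_def rescaled_def exponent_def)

lemma lin_rescaled: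
  assumes "active K i"
  shows "lin (rescaled K i \<epsilon> U) X $ a = \<epsilon> ^ row_exponent K i a *\<^sub>R blow_up K i \<epsilon> U X $ a"
proof -
  let ?m = "row_exponent K i a"
  have p: "\<epsilon> ^ n = \<epsilon> ^ ?m * \<epsilon> ^ (n - ?m)" if "?m \<le> n" for n
    using that by (metis le_add_diff_inverse power_add)
  have self: "rescaled K i \<epsilon> U $ a = \<epsilon> ^ ?m *\<^sub>R \<epsilon> ^ (exponent K i (Some a) - ?m) *\<^sub>R U $ a"
    unfolding rescaled_def using p[OF exponent_self(1)[OF assms, of a]] by simp
  have nb: "bus_voltage V0 (rescaled K i \<epsilon> U) b
      = \<epsilon> ^ ?m *\<^sub>R \<epsilon> ^ (exponent K i b - ?m) *\<^sub>R bus_voltage V0 U b" if "b \<in> nbrs a" for b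
    unfolding bus_voltage_rescaled using p[OF exponent_nbr(1)[OF assms that]] by simp
  have "lin (rescaled K i \<epsilon> U) X $ a = (\<Sum>b\<in>nbrs a. \<epsilon> ^ ?m *\<^sub>R (y a b *
     (X $ a * (\<epsilon> ^ (exponent K i (Some a) - ?m) *\<^sub>R cnj (U $ a)
        - \<epsilon> ^ (exponent K i b - ?m) *\<^sub>R cnj (bus_voltage V0 U b)) +
      \<epsilon> ^ (exponent K i (Some a) - ?m) *\<^sub>R U $ a * (cnj (X $ a) - cnj (bus_voltage 0 X b)))))"
    unfolding lin_def vec_lambda_beta
    by (intro sum.cong refl) (simp only: self nb complex_cnj_scaleR, simp add: algebra_simps)
  then show ?thesis by (simp add: blow_up_def scaleR_sum_right)
qed

lemma linear_blow_up: "linear (blow_up K i \<epsilon> U)"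
proof (rule linearI)
  fix X X' show "blow_up K i \<epsilon> U (X + X') = blow_up K i \<epsilon> U X + blow_up K i \<epsilon> U X'"
    using bus_voltage_add[of 0 0 X X']
    by (simp add: blow_up_def vec_eq_iff algebra_simps flip: sum.distrib)
next
  fix r X show "blow_up K i \<epsilon> U (r *\<^sub>R X) = r *\<^sub>R blow_up K i \<epsilon> U X"
    using bus_voltage_scaleR[of r 0 X]
    by (simp add: blow_up_def vec_eq_iff algebra_simps scaleR_sum_right)
qed

definition scale_factor :: "'v set \<Rightarrow> 'v \<Rightarrow> real \<Rightarrow> real" where
  "scale_factor K i \<epsilon> = (\<Prod>k\<in>UNIV. \<epsilon> ^ row_exponent K i (case k of Inl a \<Rightarrow> a | Inr a \<Rightarrow> a))"

lemma Delta_rescaled: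
  assumes "active K i"
  shows "Delta (rescaled K i \<epsilon> U) = scale_factor K i \<epsilon> * real_det (blow_up K i \<epsilon> U)"
  unfolding Delta_def scale_factor_def
  by (rule real_det_rows_scaled) (rule lin_rescaled[OF assms])

lemma frozen_limit:
  assumes "active K i"
  shows "((\<lambda>\<epsilon>. Delta (rescaled K i \<epsilon> U) / scale_factor K i \<epsilon>) \<longlongrightarrow> frozen_Delta K i U) (at_right 0)"
proof -
  have "((\<lambda>\<epsilon>. real_det (blow_up K i \<epsilon> U)) \<longlongrightarrow> frozen_Delta K i U) (at_right 0)"
    unfolding frozen_Delta_def blow_up_def by (intro tendsto_real_det tendsto_vec_lambda) (auto intro!: tendsto_eq_intros)
  moreover have "\<forall>\<^sub>F \<epsilon> in at_right 0. real_det (blow_up K i \<epsilon> U) = Delta (rescaled K i \<epsilon> U) / scale_factor K i \<epsilon>"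
    using eventually_at_right_less[of 0]
  proof eventually_elim
    case (elim \<epsilon>)
    then have "scale_factor K i \<epsilon> \<noteq> 0" by (simp add: scale_factor_def)
    then show ?case by (simp add: Delta_rescaled[OF assms])
  qed
  ultimately show ?thesis by (rule Lim_transform_eventually)
qed

text \<open>
  All determinants are divided by the same power of \<open>\<epsilon>\<close>, so an identity
  between products with equally many factors passes to the limit.
\<close>

lemma frozen_identity:
  assumes "active K i" "finite I"
    and "\<And>\<epsilon>. \<epsilon> > 0 \<Longrightarrow> (\<Prod>k\<in>I. (Delta (rescaled K i \<epsilon> (U k)))\<^sup>2) = (\<Prod>k\<in>I. (Delta (rescaled K i \<epsilon> (W k)))\<^sup>2)"
  shows "(\<Prod>k\<in>I. (frozen_Delta K i (U k))\<^sup>2) = (\<Prod>k\<in>I. (frozen_Delta K i (W k))\<^sup>2)"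
proof -
  have "((\<lambda>\<epsilon>. \<Prod>k\<in>I. (Delta (rescaled K i \<epsilon> (U k)) / scale_factor K i \<epsilon>)\<^sup>2)
    \<longlongrightarrow> (\<Prod>k\<in>I. (frozen_Delta K i (U k))\<^sup>2)) (at_right 0)"
    by (intro tendsto_intros frozen_limit[OF assms(1)])
  moreover have "\<forall>\<^sub>F \<epsilon> in at_right 0. (\<Prod>k\<in>I. (Delta (rescaled K i \<epsilon> (U k)) / scale_factor K i \<epsilon>)\<^sup>2)
     = (\<Prod>k\<in>I. (Delta (rescaled K i \<epsilon> (W k)) / scale_factor K i \<epsilon>)\<^sup>2)"
    using eventually_at_right_less[of 0]
    by eventually_elim (simp add: power_divide prod_dividef assms(3))
  ultimately have "((\<lambda>\<epsilon>. \<Prod>k\<in>I. (Delta (rescaled K i \<epsilon> (W k)) / scale_factor K i \<epsilon>)\<^sup>2)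
    \<longlongrightarrow> (\<Prod>k\<in>I. (frozen_Delta K i (U k))\<^sup>2)) (at_right 0)"
    by (rule Lim_transform_eventually)
  moreover have "((\<lambda>\<epsilon>. \<Prod>k\<in>I. (Delta (rescaled K i \<epsilon> (W k)) / scale_factor K i \<epsilon>)\<^sup>2)
    \<longlongrightarrow> (\<Prod>k\<in>I. (frozen_Delta K i (W k))\<^sup>2)) (at_right 0)"
    by (intro tendsto_intros frozen_limit[OF assms(1)])
  ultimately show ?thesis
    using tendsto_unique trivial_limit_at_right_real by blast
qed

text \<open>
  What the equation of a node in \<open>K\<close> becomes at \<open>\<epsilon> = 0\<close>: voltages
  outside \<open>K\<close> read as \<open>0\<close>, except for the one above the top node.
\<close>

definition frozen_row :: "'v set \<Rightarrow> 'v \<Rightarrow> complex ^ 'v \<Rightarrow> complex ^ 'v \<Rightarrow> 'v \<Rightarrow> complex" where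
  "frozen_row K i U X a = (\<Sum>b\<in>nbrs a. y a b *
     (X $ a * (cnj (U $ a) - (if b \<in> Some ` K \<or> b = par i then cnj (bus_voltage V0 U b) else 0)) +
      U $ a * (cnj (X $ a) - cnj (bus_voltage 0 X b))))"

text \<open>
  A node outside \<open>K\<close> retains only the current from its parent, and its equation forces
  its increment to vanish. The determinant is thereby reduced to the system on \<open>K\<close>.
\<close>

lemma frozen_Delta_eq_0_iff:
  assumes act: "active K i" and ne: "\<And>a. a \<notin> K \<Longrightarrow> bus_voltage V0 U (par a) \<noteq> 0"
  shows "frozen_Delta K i U = 0 \<longleftrightarrow>
    (\<exists>X. X \<noteq> 0 \<and> (\<forall>a. a \<notin> K \<longrightarrow> X $ a = 0) \<and> (\<forall>a\<in>K. frozen_row K i U X a = 0))"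
proof -
  have out: "blow_up K i 0 U X $ a = - y a (par a) * cnj (bus_voltage V0 U (par a)) * X $ a" if a: "a \<notin> K" for a X
  proof -
    have "blow_up K i 0 U X $ a = (\<Sum>b\<in>nbrs a. if b = par a then - y a b * cnj (bus_voltage V0 U b) * X $ a else 0)"
      unfolding blow_up_def vec_lambda_beta
    proof (intro sum.cong refl)
      fix b assume b: "b \<in> nbrs a"
      have e1: "exponent K i (Some a) - row_exponent K i a \<noteq> 0" using exponent_self(2)[OF act a] by simp
      have e2: "b \<noteq> par a \<Longrightarrow> exponent K i b - row_exponent K i a \<noteq> 0"
        using exponent_nbr(2)[OF act b a] by simp
      have e3: "exponent K i (par a) - row_exponent K i a = 0" using a by (simp add: row_exponent_def)
      show "y a b * (X $ a * (0 ^ (exponent K i (Some a) - row_exponent K i a) *\<^sub>R cnj (U $ a)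
        - 0 ^ (exponent K i b - row_exponent K i a) *\<^sub>R cnj (bus_voltage V0 U b)) +
        0 ^ (exponent K i (Some a) - row_exponent K i a) *\<^sub>R U $ a * (cnj (X $ a) - cnj (bus_voltage 0 X b)))
        = (if b = par a then - y a b * cnj (bus_voltage V0 U b) * X $ a else 0)"
        using e1 e2 e3 by (simp add: power_0_left)
    qed
    then show ?thesis by simp
  qed
  have inside: "blow_up K i 0 U X $ a = frozen_row K i U X a" if a: "a \<in> K" for a X
    unfolding blow_up_def frozen_row_def vec_lambda_beta
  proof (intro sum.cong refl)
    fix b assume b: "b \<in> nbrs a"
    have e1: "exponent K i (Some a) - row_exponent K i a = 0" using a by (simp add: row_exponent_def exponent_def)
    have e2: "\<not> (b \<in> Some ` K \<or> b = par i) \<Longrightarrow> exponent K i b - row_exponent K i a \<noteq> 0"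
      using exponent_nbr(3)[OF act b a] by auto
    have e3: "b \<in> Some ` K \<or> b = par i \<Longrightarrow> exponent K i b - row_exponent K i a = 0"
      using a active_par_notin[OF act] by (auto simp: row_exponent_def exponent_def)
    show "y a b * (X $ a * (0 ^ (exponent K i (Some a) - row_exponent K i a) *\<^sub>R cnj (U $ a)
        - 0 ^ (exponent K i b - row_exponent K i a) *\<^sub>R cnj (bus_voltage V0 U b)) +
        0 ^ (exponent K i (Some a) - row_exponent K i a) *\<^sub>R U $ a * (cnj (X $ a) - cnj (bus_voltage 0 X b)))
     = y a b * (X $ a * (cnj (U $ a) - (if b \<in> Some ` K \<or> b = par i then cnj (bus_voltage V0 U b) else 0)) +
      U $ a * (cnj (X $ a) - cnj (bus_voltage 0 X b)))"
      using e1 e2 e3 by (cases "b \<in> Some ` K \<or> b = par i") (auto simp: power_0_left)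
  qed
  have "blow_up K i 0 U X = 0 \<longleftrightarrow> (\<forall>a. a \<notin> K \<longrightarrow> X $ a = 0) \<and> (\<forall>a\<in>K. frozen_row K i U X a = 0)" for X
    unfolding vec_eq_iff zero_index
    using out inside ne y_ne[OF par_in_nbrs] by (metis complex_cnj_zero_iff mult_eq_0_iff neg_equal_0_iff_equal)
  then show ?thesis
    unfolding frozen_Delta_def real_det_eq_0_iff[OF linear_blow_up] by blast
qed

end

section \<open>Frozen branches and frozen pairs of leaves\<close>

context power_grid
begin

definition Ysum :: "'v \<Rightarrow> complex" where
  "Ysum a = (\<Sum>b\<in>nbrs a. y a b)"

text \<open>
  The share of the parent in the conjugate current at \<open>i\<close>, called \<open>s\<close> in
  the sections on leaves.
\<close>

definition source :: "complex ^ 'v \<Rightarrow> 'v \<Rightarrow> complex" where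
  "source U i = y i (par i) * cnj (bus_voltage V0 U (par i))"

text \<open>
  The frozen equation of the top node in the form treated in the sections on leaves: inactive
  children contribute only to the total admittance.
\<close>

lemma top_row:
  assumes act: "active K i" and X: "\<And>a. a \<notin> K \<Longrightarrow> X $ a = 0"
  defines "Ch \<equiv> {c \<in> K. par c = Some i}"
  shows "frozen_row K i U X i =
     (Ysum i * cnj (U $ i) - source U i - (\<Sum>c\<in>Ch. y i (Some c) * cnj (U $ c))) * X $ i
      + U $ i * (Ysum i * cnj (X $ i) - (\<Sum>c\<in>Ch. y i (Some c) * cnj (X $ c)))"
proof -
  let ?a = "\<lambda>b. if b = par i then cnj (bus_voltage V0 U b) else 0"
  let ?b = "\<lambda>b. if b \<in> Some ` Ch then cnj (bus_voltage V0 U b) else 0"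
  let ?c = "\<lambda>b. if b \<in> Some ` Ch then cnj (bus_voltage 0 X b) else 0"
  have pn: "par i \<notin> Some ` K" using active_par_notin[OF act] .
  have Ch: "Some ` Ch \<subseteq> nbrs i" by (auto simp: Ch_def nbrs_iff)
  have "frozen_row K i U X i = (\<Sum>b\<in>nbrs i. y i b * (cnj (U $ i) * X $ i + U $ i * cnj (X $ i))
     - y i b * ?a b * X $ i - y i b * ?b b * X $ i - y i b * ?c b * U $ i)"
    unfolding frozen_row_def
  proof (intro sum.cong refl)
    fix b assume b: "b \<in> nbrs i"
    have 1: "(if b \<in> Some ` K \<or> b = par i then cnj (bus_voltage V0 U b) else 0) = ?a b + ?b b"
      using b pn by (auto simp: nbrs_iff Ch_def)
    have 2: "cnj (bus_voltage 0 X b) = ?c b"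
    proof (cases b)
      case (Some d)
      have "d \<notin> K" if "b \<notin> Some ` Ch"
      proof
        assume "d \<in> K"
        moreover from this have "b \<noteq> par i" using pn Some by (metis imageI)
        then have "par d = Some i" using b Some by (auto simp: nbrs_iff)
        ultimately show False using that Some by (auto simp: Ch_def)
      qed
      then show ?thesis using Some X by (auto simp: bus_voltage_def)
    qed (auto simp: bus_voltage_def)
    show "y i b * (X $ i * (cnj (U $ i) - (if b \<in> Some ` K \<or> b = par i then cnj (bus_voltage V0 U b) else 0)) +
           U $ i * (cnj (X $ i) - cnj (bus_voltage 0 X b)))
       = y i b * (cnj (U $ i) * X $ i + U $ i * cnj (X $ i))
     - y i b * ?a b * X $ i - y i b * ?b b * X $ i - y i b * ?c b * U $ i"
    proof -
      have "t * (x * (w' - (p + q)) + w * (x' - r)) = t * (w' * x + w * x') - t * p * x - t * q * x - t * r * w"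
        for t x x' w w' p q r :: complex by (simp add: algebra_simps)
      then show ?thesis by (subst 1, subst 2)
    qed
  qed
  also have "\<dots> = Ysum i * (cnj (U $ i) * X $ i + U $ i * cnj (X $ i))
     - (\<Sum>b\<in>nbrs i. y i b * ?a b) * X $ i - (\<Sum>b\<in>nbrs i. y i b * ?b b) * X $ i
     - (\<Sum>b\<in>nbrs i. y i b * ?c b) * U $ i"
    by (simp add: sum_subtractf sum_distrib_right Ysum_def)
  also have "(\<Sum>b\<in>nbrs i. y i b * ?a b) = source U i"
    by (simp add: source_def if_distrib[of "\<lambda>t. _ * t"] cong: if_cong)
  also have "(\<Sum>b\<in>nbrs i. y i b * ?b b) = (\<Sum>c\<in>Ch. y i (Some c) * cnj (U $ c))"
  proof -
    have "(\<Sum>b\<in>nbrs i. y i b * ?b b) = (\<Sum>b\<in>Some ` Ch. y i b * cnj (bus_voltage V0 U b))"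
      using Ch by (intro sum.mono_neutral_cong_right) auto
    then show ?thesis by (simp add: sum.reindex bus_voltage_def)
  qed
  also have "(\<Sum>b\<in>nbrs i. y i b * ?c b) = (\<Sum>c\<in>Ch. y i (Some c) * cnj (X $ c))"
  proof -
    have "(\<Sum>b\<in>nbrs i. y i b * ?c b) = (\<Sum>b\<in>Some ` Ch. y i b * cnj (bus_voltage 0 X b))"
      using Ch by (intro sum.mono_neutral_cong_right) auto
    then show ?thesis by (simp add: sum.reindex bus_voltage_def)
  qed
  finally show ?thesis by (simp add: algebra_simps)
qed

definition branch :: "'v \<Rightarrow> 'v \<Rightarrow> 'v set" where
  "branch i j = insert i (Desc j)"

context
  fixes i j :: 'v assumes ij: "par j = Some i"
begin

lemma i_notin_Desc: "i \<notin> Desc j"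
  using Desc_depth[of i j] par_less[of j] ij by auto

lemma active_branch: "active (branch i j) i"
  using Desc_par[of _ j] ij by (fastforce simp: active_def branch_def)

lemma branch_children: "{c \<in> branch i j. par c = Some i} = {j}"
  using Desc_par[of _ j] i_notin_Desc ij par_ne_self[of i] by (fastforce simp: branch_def)

lemma branch_nbrs:
  assumes "a \<in> Desc j" "b \<in> nbrs a"
  shows "b \<in> Some ` branch i j"
  using assms Desc_child[of _ a j] Desc_par[OF assms(1)] ij by (auto simp: nbrs_iff branch_def)

lemma lower_row:
  assumes U: "\<And>a. a \<in> Desc j \<Longrightarrow> U $ a = v" and a: "a \<in> Desc j" "a \<noteq> j"
  shows "frozen_row (branch i j) i U X a = v * (\<Sum>b\<in>nbrs a. y a b * (cnj (X $ a) - cnj (bus_voltage 0 X b)))"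
proof -
  have "bus_voltage V0 U b = v" if b: "b \<in> nbrs a" for b
    using b a Desc_child[of _ a j] Desc_par[OF a] U by (auto simp: nbrs_iff bus_voltage_def)
  then show ?thesis
    unfolding frozen_row_def sum_distrib_left using branch_nbrs[OF a(1)] U[OF a(1)]
    by (intro sum.cong) (auto simp: algebra_simps)
qed

text \<open>
  At a constant voltage the equation of a node says that its increments satisfy Kirchhoff's law
  without a load. From the bottom up, no current can flow towards the leaves, so that each increment
  equals the one of the parent.
\<close>

lemma no_current_drop:
  assumes U: "\<And>a. a \<in> Desc j \<Longrightarrow> U $ a = v" and v: "v \<noteq> 0 \<or> Desc j = {j}"
    and rows: "\<And>a. a \<in> Desc j \<Longrightarrow> frozen_row (branch i j) i U X a = 0"
    and a: "a \<in> Desc j" "a \<noteq> j"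
  shows "bus_voltage 0 X (par a) = X $ a"
  using a
\<comment> \<open>Induction from the deepest nodes upwards.\<close>
proof (induction "Max (range (\<lambda>a. depth (Some a))) - depth (Some a)" arbitrary: a rule: less_induct)
  case less
  have v0: "v \<noteq> 0" using v less.prems by auto
  have ch: "bus_voltage 0 X b = X $ a" if b: "b \<in> nbrs a" "b \<noteq> par a" for b
  proof -
    obtain c where c: "b = Some c" "par c = Some a" using b by (auto simp: nbrs_iff)
    have "depth (Some c) \<le> Max (range (\<lambda>a. depth (Some a)))" by (intro Max_ge) auto
    moreover have "depth (Some a) < depth (Some c)" using par_less[of c] c by simp
    moreover have "c \<in> Desc j" "c \<noteq> j"
      using Desc_child[OF c(2) less.prems(1)] Desc_depth[OF less.prems(1)] \<open>depth (Some a) < depth (Some c)\<close>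
      by auto
    ultimately have "bus_voltage 0 X (par c) = X $ c"
      by (intro less.hyps diff_less_mono2) (auto elim: less_le_trans)
    then show ?thesis by (simp add: c bus_voltage_def)
  qed
  have "0 = v * (\<Sum>b\<in>nbrs a. y a b * (cnj (X $ a) - cnj (bus_voltage 0 X b)))"
    using rows[OF less.prems(1)] lower_row[OF U less.prems] by simp
  also have "(\<Sum>b\<in>nbrs a. y a b * (cnj (X $ a) - cnj (bus_voltage 0 X b)))
    = (\<Sum>b\<in>{par a}. y a b * (cnj (X $ a) - cnj (bus_voltage 0 X b)))"
    by (intro sum.mono_neutral_right) (auto simp: ch)
  finally have "cnj (X $ a) - cnj (bus_voltage 0 X (par a)) = 0"
    using v0 y_ne[OF par_in_nbrs] by simp
  then show ?case by simp
qed

lemma constant_on_Desc: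
  assumes "\<And>a. a \<in> Desc j \<Longrightarrow> a \<noteq> j \<Longrightarrow> bus_voltage 0 X (par a) = X $ a" "a \<in> Desc j"
  shows "X $ a = X $ j"
  using assms(2)
proof (induction "depth (Some a)" arbitrary: a rule: less_induct)
  case less
  show ?case
  proof (cases "a = j")
    case False
    then obtain b where b: "b \<in> Desc j" "par a = Some b" using Desc_par less.prems by blast
    then have "X $ b = X $ j" using less.hyps[of b] par_less[of a] by simp
    then show ?thesis using assms(1)[OF less.prems False] b by (simp add: bus_voltage_def)
  qed simp
qed

lemma junction_row:
  assumes U: "\<And>a. a \<in> Desc j \<Longrightarrow> U $ a = v" and X: "\<And>a. a \<in> Desc j \<Longrightarrow> X $ a = X $ j"
  shows "frozen_row (branch i j) i U X j
    = y i (Some j) * ((cnj v - cnj (U $ i)) * X $ j + v * (cnj (X $ j) - cnj (X $ i)))"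
proof -
  have "frozen_row (branch i j) i U X j = (\<Sum>b\<in>{Some i}. y j b *
     (X $ j * (cnj (U $ j) - (if b \<in> Some ` branch i j \<or> b = par i then cnj (bus_voltage V0 U b) else 0)) +
      U $ j * (cnj (X $ j) - cnj (bus_voltage 0 X b))))"
    unfolding frozen_row_def
  proof (intro sum.mono_neutral_right)
    show "\<forall>b\<in>nbrs j - {Some i}. y j b *
     (X $ j * (cnj (U $ j) - (if b \<in> Some ` branch i j \<or> b = par i then cnj (bus_voltage V0 U b) else 0)) +
      U $ j * (cnj (X $ j) - cnj (bus_voltage 0 X b))) = 0"
    proof
      fix b assume b: "b \<in> nbrs j - {Some i}"
      then obtain c where c: "b = Some c" "par c = Some j" using ij by (auto simp: nbrs_iff)
      then have "c \<in> Desc j" by (simp add: Desc_child)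
      then show "y j b *
     (X $ j * (cnj (U $ j) - (if b \<in> Some ` branch i j \<or> b = par i then cnj (bus_voltage V0 U b) else 0)) +
      U $ j * (cnj (X $ j) - cnj (bus_voltage 0 X b))) = 0"
        using c U[of c] U[of j] X[of c] by (auto simp: bus_voltage_def branch_def)
    qed
  qed (use ij in \<open>auto simp: nbrs_iff\<close>)
  then show ?thesis using U[of j] by (auto simp: branch_def bus_voltage_def y_sym[of j i] algebra_simps)
qed

text \<open>
  With one voltage \<open>v\<close> on all descendants of \<open>j\<close> the whole subtree behaves
  like a single leaf, so that the results on a single leaf decide about the frozen determinant.
\<close>

lemma frozen_branch:
  assumes U: "\<And>a. a \<in> Desc j \<Longrightarrow> U $ a = v" and v: "v \<noteq> 0 \<or> Desc j = {j}"
    and ne: "\<And>a. a \<notin> branch i j \<Longrightarrow> bus_voltage V0 U (par a) \<noteq> 0"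
  shows "branch_det (Ysum i) (source U i) (y i (Some j)) (U $ i) v \<noteq> 0 \<Longrightarrow> frozen_Delta (branch i j) i U \<noteq> 0"
    and "leaf_det (U $ i) v = 0 \<Longrightarrow> Re (cnj (y i (Some j)) * source U i * U $ i) = 0 \<Longrightarrow> U $ i \<noteq> 0
       \<Longrightarrow> frozen_Delta (branch i j) i U = 0"
proof -
  have yij: "y i (Some j) \<noteq> 0" using ij by (intro y_ne) (simp add: nbrs_iff)
  have top: "frozen_row (branch i j) i U X i = (Ysum i * cnj (U $ i) - source U i - y i (Some j) * cnj v) * X $ i
      + U $ i * (Ysum i * cnj (X $ i) - y i (Some j) * cnj (X $ j))" if "\<And>a. a \<notin> branch i j \<Longrightarrow> X $ a = 0" for X
    using top_row[OF active_branch that, of U] U[of j] by (simp add: branch_children)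
  note iff = frozen_Delta_eq_0_iff[OF active_branch ne]
  show "frozen_Delta (branch i j) i U \<noteq> 0" if P: "branch_det (Ysum i) (source U i) (y i (Some j)) (U $ i) v \<noteq> 0"
  proof
    assume "frozen_Delta (branch i j) i U = 0"
    then obtain X where X: "X \<noteq> 0" "\<And>a. a \<notin> branch i j \<Longrightarrow> X $ a = 0"
        "\<And>a. a \<in> branch i j \<Longrightarrow> frozen_row (branch i j) i U X a = 0"
      using iff by blast
    have rows: "frozen_row (branch i j) i U X a = 0" if "a \<in> Desc j" for a
      using X(3) that by (simp add: branch_def)
    have c: "X $ a = X $ j" if "a \<in> Desc j" for a
      by (rule constant_on_Desc[OF no_current_drop[OF U v rows] that])
    have "X $ i = 0 \<and> X $ j = 0"
    proof (rule single_leaf_regular[OF _ _ P])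
      show "(cnj v - cnj (U $ i)) * X $ j + v * (cnj (X $ j) - cnj (X $ i)) = 0"
        using junction_row[OF U c] rows[of j] yij by simp
      show "(Ysum i * cnj (U $ i) - source U i - y i (Some j) * cnj v) * X $ i
        + U $ i * (Ysum i * cnj (X $ i) - y i (Some j) * cnj (X $ j)) = 0"
        using top[OF X(2)] X(3)[of i] by (simp add: branch_def)
    qed
    then have "X $ a = 0" for a
      using c[of a] X(2)[of a] by (cases "a = i"; cases "a \<in> Desc j") (auto simp: branch_def)
    then have "X = 0" by (simp add: vec_eq_iff)
    then show False using X(1) by simp
  qed
  show "frozen_Delta (branch i j) i U = 0"
    if q: "leaf_det (U $ i) v = 0" and e: "Re (cnj (y i (Some j)) * source U i * U $ i) = 0" and u: "U $ i \<noteq> 0"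
  proof -
    define k where "k = \<i> * U $ i"
    define b where "b = \<i> * v - (\<i> * cnj (y i (Some j)) * source U i * U $ i) / ((cmod (y i (Some j)))\<^sup>2 * cnj (U $ i))"
    define X where "X = (\<chi> a. if a = i then k else if a \<in> Desc j then b else 0)"
    have Xi: "X $ i = k" and Xd: "\<And>a. a \<in> Desc j \<Longrightarrow> X $ a = b" and X0: "\<And>a. a \<notin> branch i j \<Longrightarrow> X $ a = 0"
      using i_notin_Desc by (auto simp: X_def branch_def)
    have leaf: "(cnj v - cnj (U $ i)) * b + v * (cnj b - cnj k) = 0"
      and centre: "(Ysum i * cnj (U $ i) - source U i - y i (Some j) * cnj v) * k
        + U $ i * (Ysum i * cnj k - y i (Some j) * cnj b) = 0"
      using single_leaf_singular[OF q e u yij] by (simp_all add: k_def b_def)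
    have "frozen_row (branch i j) i U X a = 0" if a: "a \<in> branch i j" for a
    proof (cases "a = i \<or> a = j")
      case True
      then show ?thesis
      proof
        assume "a = i" then show ?thesis using top[OF X0] centre Xi Xd[of j] by simp
      next
        assume "a = j" then show ?thesis
          using junction_row[OF U, of X] leaf Xi Xd by simp
      qed
    next
      case False
      then have a: "a \<in> Desc j" "a \<noteq> j" using a by (auto simp: branch_def)
      have "bus_voltage 0 X b' = X $ a" if "b' \<in> nbrs a" for b'
        using that a Desc_child[of _ a j] Desc_par[OF a] Xd by (auto simp: nbrs_iff bus_voltage_def)
      then show ?thesis by (simp add: lower_row[OF U a])
    qed
    moreover have "X \<noteq> 0" using Xi u by (auto simp: k_def)
    ultimately show ?thesis using iff X0 by blast
  qed
qed

end

context
  fixes i a c :: 'v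
  assumes ac: "par a = Some i" "par c = Some i" "a \<noteq> c" "nbrs a = {Some i}" "nbrs c = {Some i}"
begin

lemma active_triple: "active {i, a, c} i"
  using ac(1,2) by (auto simp: active_def)

lemma triple_children: "{b \<in> {i, a, c}. par b = Some i} = {a, c}"
  using ac(1,2) par_ne_self[of i] by auto

lemma leaf_row:
  "frozen_row {i, a, c} i U X a = y i (Some a) *
     ((cnj (U $ a) - cnj (U $ i)) * X $ a + U $ a * (cnj (X $ a) - cnj (X $ i)))"
  "frozen_row {i, a, c} i U X c = y i (Some c) *
     ((cnj (U $ c) - cnj (U $ i)) * X $ c + U $ c * (cnj (X $ c) - cnj (X $ i)))"
  unfolding frozen_row_def ac(4,5) using y_sym[of a i] y_sym[of c i]
  by (simp_all add: bus_voltage_def algebra_simps)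

lemma frozen_triple:
  assumes ne: "\<And>d. d \<notin> {i, a, c} \<Longrightarrow> bus_voltage V0 U (par d) \<noteq> 0"
  shows "frozen_Delta {i, a, c} i U = 0 \<longleftrightarrow> (\<exists>k ba bc. (k, ba, bc) \<noteq> (0, 0, 0) \<and>
     (cnj (U $ a) - cnj (U $ i)) * ba + U $ a * (cnj ba - cnj k) = 0 \<and>
     (cnj (U $ c) - cnj (U $ i)) * bc + U $ c * (cnj bc - cnj k) = 0 \<and>
     (Ysum i * cnj (U $ i) - source U i - y i (Some a) * cnj (U $ a) - y i (Some c) * cnj (U $ c)) * k
      + U $ i * (Ysum i * cnj k - y i (Some a) * cnj ba - y i (Some c) * cnj bc) = 0)"
    (is "?L \<longleftrightarrow> ?R")
proof -
  have ya: "y i (Some a) \<noteq> 0" "y i (Some c) \<noteq> 0" using ac(1,2) by (auto intro!: y_ne simp: nbrs_iff)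
  have dist: "i \<noteq> a" "i \<noteq> c" using ac(1,2) by auto
  have rows: "(\<forall>b\<in>{i, a, c}. frozen_row {i, a, c} i U X b = 0) \<longleftrightarrow>
     (cnj (U $ a) - cnj (U $ i)) * X $ a + U $ a * (cnj (X $ a) - cnj (X $ i)) = 0 \<and>
     (cnj (U $ c) - cnj (U $ i)) * X $ c + U $ c * (cnj (X $ c) - cnj (X $ i)) = 0 \<and>
     (Ysum i * cnj (U $ i) - source U i - y i (Some a) * cnj (U $ a) - y i (Some c) * cnj (U $ c)) * X $ i
      + U $ i * (Ysum i * cnj (X $ i) - y i (Some a) * cnj (X $ a) - y i (Some c) * cnj (X $ c)) = 0"
    if "\<And>b. b \<notin> {i, a, c} \<Longrightarrow> X $ b = 0" for X
  proof -
    have "frozen_row {i, a, c} i U X i =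
      (Ysum i * cnj (U $ i) - source U i - y i (Some a) * cnj (U $ a) - y i (Some c) * cnj (U $ c)) * X $ i
      + U $ i * (Ysum i * cnj (X $ i) - y i (Some a) * cnj (X $ a) - y i (Some c) * cnj (X $ c))"
    proof -
      have S: "(\<Sum>d\<in>{a, c}. g d) = g a + g c" for g :: "'v \<Rightarrow> complex" using ac(3) by simp
      show ?thesis
        using top_row[OF active_triple that, of U] unfolding triple_children S by (simp add: algebra_simps)
    qed
    moreover have "(\<forall>b\<in>{i, a, c}. R b = 0) \<longleftrightarrow> R i = 0 \<and> R a = 0 \<and> R c = 0" for R :: "'v \<Rightarrow> complex"
      by blast
    ultimately show ?thesis using ya by (simp only: leaf_row mult_eq_0_iff simp_thms conj_ac)
  qed
  have iff: "?L \<longleftrightarrow> (\<exists>X. X \<noteq> 0 \<and> (\<forall>b. b \<notin> {i, a, c} \<longrightarrow> X $ b = 0) \<and>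
      (\<forall>b\<in>{i, a, c}. frozen_row {i, a, c} i U X b = 0))"
    by (rule frozen_Delta_eq_0_iff[OF active_triple ne])
  show ?thesis
  proof
    assume ?L
    then obtain X where X: "X \<noteq> 0" "\<And>b. b \<notin> {i, a, c} \<Longrightarrow> X $ b = 0"
      "\<forall>b\<in>{i, a, c}. frozen_row {i, a, c} i U X b = 0" using iff by blast
    have "(X $ i, X $ a, X $ c) \<noteq> (0, 0, 0)" 
    proof
      assume "(X $ i, X $ a, X $ c) = (0, 0, 0)"
      then have "X $ b = 0" for b using X(2)[of b] by (cases "b \<in> {i, a, c}") auto
      then show False using X(1) by (simp add: vec_eq_iff)
    qed
    then show ?R using X(3) rows[OF X(2)] by blast
  next
    assume ?R
    then obtain k ba bc where k: "(k, ba, bc) \<noteq> (0, 0, 0)"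
     "(cnj (U $ a) - cnj (U $ i)) * ba + U $ a * (cnj ba - cnj k) = 0"
     "(cnj (U $ c) - cnj (U $ i)) * bc + U $ c * (cnj bc - cnj k) = 0"
     "(Ysum i * cnj (U $ i) - source U i - y i (Some a) * cnj (U $ a) - y i (Some c) * cnj (U $ c)) * k
      + U $ i * (Ysum i * cnj k - y i (Some a) * cnj ba - y i (Some c) * cnj bc) = 0" by blast
    define X :: "complex ^ 'v" where "X = (\<chi> b. if b = i then k else if b = a then ba else if b = c then bc else 0)"
    have X: "X $ i = k" "X $ a = ba" "X $ c = bc" "\<And>b. b \<notin> {i, a, c} \<Longrightarrow> X $ b = 0"
      using dist ac(3) by (auto simp: X_def)
    have "X \<noteq> 0" using k(1) X by (metis zero_index)
    moreover have "\<forall>b\<in>{i, a, c}. frozen_row {i, a, c} i U X b = 0"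
    proof (subst rows)
      show "\<And>b. b \<notin> {i, a, c} \<Longrightarrow> X $ b = 0" by (rule X(4))
    qed (unfold X(1-3), intro conjI k(2-4))
    ultimately show ?L using iff X(4) by blast
  qed
qed

end

end

section \<open>Separability of the Jacobian forces a star\<close>

lemma Re_of_real_mult: "Re (of_real r * w) = r * Re w"
  by simp

lemma real_polynomial_function_on_line:
  fixes p :: "'a::real_normed_vector \<Rightarrow> real"
  assumes p: "real_polynomial_function p" and inf: "infinite {t. p (x + t *\<^sub>R d) = 0}"
  shows "p (x + t *\<^sub>R d) = 0"
proof -
  have "polynomial_function (\<lambda>t. x + t *\<^sub>R d)"
    by (intro polynomial_function_add polynomial_function_const polynomial_function_bounded_linear
        bounded_linear_scaleR_left)
  then have "real_polynomial_function (p \<circ> (\<lambda>t. x + t *\<^sub>R d))"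
    using p by (rule real_polynomial_function_compose)
  then obtain a n where an: "p \<circ> (\<lambda>t. x + t *\<^sub>R d) = (\<lambda>t. \<Sum>i\<le>n. a i * t ^ i)"
    using real_polynomial_function_iff_sum by blast
  have eq: "p (x + t *\<^sub>R d) = (\<Sum>i\<le>n. a i * t ^ i)" for t using fun_cong[OF an, of t] by simp
  have "infinite {t. (\<Sum>i\<le>n. a i * t ^ i) = 0}" using inf by (simp add: eq)
  then have "\<forall>i\<le>n. a i = 0" using polyfun_finite_roots[of a n] by blast
  then show ?thesis by (simp add: eq)
qed

lemma real_polynomial_function_eq_0_if_open:
  fixes p :: "'a::real_normed_vector \<Rightarrow> real"
  assumes p: "real_polynomial_function p" and S: "open S" "x0 \<in> S" "\<And>x. x \<in> S \<Longrightarrow> p x = 0"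
  shows "p x = 0"
proof -
  have "((\<lambda>t. x0 + t *\<^sub>R (x - x0)) \<longlongrightarrow> x0 + 0 *\<^sub>R (x - x0)) (at_right 0)"
    by (intro tendsto_intros)
  then have "\<forall>\<^sub>F t in at_right 0. x0 + t *\<^sub>R (x - x0) \<in> S"
    by (rule topological_tendstoD) (use S in auto)
  then obtain e where e: "e > 0" "\<And>t. 0 < t \<Longrightarrow> t < e \<Longrightarrow> x0 + t *\<^sub>R (x - x0) \<in> S"
    unfolding eventually_at_right_field by auto
  have "{0<..<e} \<subseteq> {t. p (x0 + t *\<^sub>R (x - x0)) = 0}" using e S(3) by auto
  then have "infinite {t. p (x0 + t *\<^sub>R (x - x0)) = 0}"
    using infinite_Ioo[OF e(1)] finite_subset by blast
  from real_polynomial_function_on_line[OF p this, of 1] show ?thesis by simp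
qed

lemma real_polynomial_function_linear_compose:
  fixes p :: "'b::euclidean_space \<Rightarrow> real" and f :: "'a::euclidean_space \<Rightarrow> 'b"
  assumes "real_polynomial_function p" "linear f"
  shows "real_polynomial_function (\<lambda>x. p (f x))"
  using real_polynomial_function_compose[OF polynomial_function_bounded_linear assms(1), of f]
    assms(2) by (simp add: linear_conv_bounded_linear o_def)

definition mix :: "'v set \<Rightarrow> 'a ^ 'v \<Rightarrow> 'a ^ 'v \<Rightarrow> 'a ^ 'v" where
  "mix S V W = (\<chi> a. if a \<in> S then V $ a else W $ a)"

lemma mix_nth [simp]: "mix S V W $ a = (if a \<in> S then V $ a else W $ a)"
  by (simp add: mix_def)

lemma dist_mix_less:
  fixes V W :: "complex ^ 'v::finite"
  assumes "dist x V < r" "dist x W < r" shows "dist x (mix S V W) < 2 * r"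
proof -
  have "norm (mix S (x - V) 0) \<le> norm (x - V)" "norm (mix S 0 (x - W)) \<le> norm (x - W)"
    by (auto intro!: norm_le_componentwise_cart simp: mix_def)
  moreover have "x - mix S V W = mix S (x - V) 0 + mix S 0 (x - W)"
    by (auto simp: vec_eq_iff)
  ultimately show ?thesis
    using assms norm_triangle_ineq[of "mix S (x - V) 0" "mix S 0 (x - W)"] by (simp add: dist_norm)
qed

context power_grid
begin

text \<open>
  Near \<open>x0\<close> both sides equal \<open>1 / (g V * h V * g W * h W)\<^sup>2\<close>; the
  squares remove the absolute values and make both sides polynomial in \<open>(V, W)\<close>, so
  equality on an open set suffices.
\<close>

lemma separable_identity:
  assumes sep: "product_separable D (abs_J_P E z V0 D) S"
    and inv: "invertible_on F D" and x0: "x0 \<in> D"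
  shows "(Delta V)\<^sup>2 * (Delta W)\<^sup>2 = (Delta (mix S V W))\<^sup>2 * (Delta (mix S W V))\<^sup>2"
proof -
  obtain g h where g: "depends_only_on g S" and h: "depends_only_on h (- S)"
    and gh: "\<And>v. v \<in> D \<Longrightarrow> abs_J_P E z V0 D v = g v * h v"
    using sep by (auto simp: product_separable_def)
  obtain r where r: "r > 0" "ball x0 r \<subseteq> D"
    using inv x0 by (auto simp: invertible_on_def open_contains_ball)
  have D: "(Delta v)\<^sup>2 = 1 / (g v * h v)\<^sup>2" if "v \<in> D" for v
  proof -
    have "g v * h v = 1 / \<bar>Delta v\<bar>" using abs_J_P_eq(1)[OF inv that] gh[OF that] by simp
    then show ?thesis by (simp add: power_divide)
  qed
  define p where "p = (\<lambda>VW. (Delta (fst VW))\<^sup>2 * (Delta (snd VW))\<^sup>2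
     - (Delta (mix S (fst VW) (snd VW)))\<^sup>2 * (Delta (mix S (snd VW) (fst VW)))\<^sup>2)"
  have lin: "linear (\<lambda>VW. mix S (fst VW) (snd VW) :: complex ^ 'v)"
      "linear (\<lambda>VW. mix S (snd VW) (fst VW) :: complex ^ 'v)"
    by (auto intro!: linearI simp: vec_eq_iff)
  have "real_polynomial_function p"
    unfolding p_def
    by (intro real_polynomial_function_diff real_polynomial_function.intros(4) real_polynomial_function_power
        real_polynomial_function_linear_compose[OF real_polynomial_function_Delta] lin
        linear_fst linear_snd)
  moreover have "p VW = 0" if "VW \<in> ball x0 (r/2) \<times> ball x0 (r/2)" for VW
  proof -
    obtain V W where VW: "VW = (V, W)" by (cases VW)
    have d: "dist x0 V < r/2" "dist x0 W < r/2" using that VW by auto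
    then have inD: "V \<in> D" "W \<in> D" "mix S V W \<in> D" "mix S W V \<in> D"
      using r dist_mix_less[OF d] dist_mix_less[OF d(2,1)] by auto
    have "g (mix S V W) = g V" "g (mix S W V) = g W" "h (mix S V W) = h W" "h (mix S W V) = h V"
      using g h by (auto simp: depends_only_on_def)
    then show ?thesis by (simp add: p_def VW D inD power_mult_distrib)
  qed
  moreover have "open (ball x0 (r/2) \<times> ball x0 (r/2))" "(x0, x0) \<in> ball x0 (r/2) \<times> ball x0 (r/2)"
    using r(1) by (auto intro: open_Times)
  ultimately have "p (V, W) = 0"
    using real_polynomial_function_eq_0_if_open by blast
  then show ?thesis by (simp add: p_def)
qed

text \<open>
  Without substation voltage a common rotation of all phases changes no injection, so the map could
  not be invertible.
\<close>

lemma V0_ne_0: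
  assumes "invertible_on F D" "x0 \<in> D" shows "V0 \<noteq> 0"
proof
  assume 0: "V0 = 0"
  have "open D" using assms by (simp add: invertible_on_def)
  then have "D \<noteq> {0}" using not_open_singleton by metis
  then obtain v where v: "v \<in> D" "v \<noteq> 0" using assms(2) by auto
  define X where "X = (\<chi> a. \<i> * v $ a)"
  have bX: "bus_voltage 0 X b = \<i> * bus_voltage V0 v b" for b
    by (cases b) (auto simp: bus_voltage_def X_def 0)
  have "lin v X = 0"
    unfolding lin_def bX by (simp add: vec_eq_iff X_def algebra_simps)
  moreover have "X \<noteq> 0" using v(2) by (auto simp: vec_eq_iff X_def)
  ultimately have "Delta v = 0" using Delta_eq_0_iff by blast
  then show False using abs_J_P_eq(2)[OF assms(1) v(1)] by simp
qed

text \<open>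
  The exchange identity is applied to a frozen branch across the boundary of \<open>S\<close>. The
  edge is chosen as low as possible, so the subtree of \<open>j\<close> lies on one side of the
  boundary and its voltage \<open>v\<close> can be exchanged against the voltage \<open>u\<close> of
  \<open>i\<close>. Then \<open>G(u, v) * G(u', v') = G(u, v') * G(u', v)\<close> for the frozen
  determinants \<open>G\<close>, and it remains to find \<open>u, v, u', v'\<close> with a zero on
  the left side only.
\<close>

lemma separable_imp_UNIV:
  assumes sep: "product_separable D (abs_J_P E z V0 D) S"
    and inv: "invertible_on F D" and x0: "x0 \<in> D" and S: "a0 \<in> S"
  shows "S = UNIV"
proof (rule ccontr)
  assume "S \<noteq> UNIV"
  define crossing where "crossing = {j. \<exists>i. par j = Some i \<and> (i \<in> S) \<noteq> (j \<in> S)}"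
  obtain r where r: "par r = None"
    using radial edge_None_iff by (auto simp: radial_grid_def insert_commute)
  have "crossing \<noteq> {}"
  proof
    assume none: "crossing = {}"
    have "(a \<in> S) = (r \<in> S)" for a
    proof (induction "depth (Some a)" arbitrary: a rule: less_induct)
      case less
      show ?case
      proof (cases "par a")
        case None then show ?thesis using par_None_unique[OF r] by simp
      next
        case (Some b)
        then have "(b \<in> S) = (a \<in> S)" using none by (auto simp: crossing_def)
        moreover have "(b \<in> S) = (r \<in> S)" using less[of b] par_less[of a] Some by simp
        ultimately show ?thesis by simp
      qed
    qed
    then show False using S \<open>S \<noteq> UNIV\<close> by auto
  qed
  then have "Max ((\<lambda>k. depth (Some k)) ` crossing) \<in> (\<lambda>k. depth (Some k)) ` crossing"
    by (intro Max_in) auto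
  then obtain j where "j \<in> crossing" and max: "Max ((\<lambda>k. depth (Some k)) ` crossing) = depth (Some j)"
    by auto
  moreover have "depth (Some k) \<le> depth (Some j)" if "k \<in> crossing" for k
    unfolding max[symmetric] using that by (intro Max_ge) auto
  ultimately have j: "j \<in> crossing" "\<And>k. k \<in> crossing \<Longrightarrow> depth (Some k) \<le> depth (Some j)"
    by auto
  then obtain i where ij: "par j = Some i" "(i \<in> S) \<noteq> (j \<in> S)" by (auto simp: crossing_def)
  have side: "(a \<in> S) = (j \<in> S)" if "a \<in> Desc j" for a
    using that
  proof (induction "depth (Some a)" arbitrary: a rule: less_induct)
    case less
    show ?case
    proof (cases "a = j")
      case False
      then obtain b where b: "b \<in> Desc j" "par a = Some b" using Desc_par less.prems by blast
      then have "depth (Some b) < depth (Some a)" using par_less[of a] by simp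
      moreover from this have "a \<notin> crossing"
        using j(2)[of a] Desc_depth[OF b(1)] by auto
      then have "(b \<in> S) = (a \<in> S)" using b by (auto simp: crossing_def)
      ultimately show ?thesis using less.hyps[OF _ b(1)] by simp
    qed simp
  qed
  have inot: "i \<notin> Desc j" by (rule i_notin_Desc[OF ij(1)])
  define U where "U u v = (\<chi> a. if a = i then u else if a \<in> Desc j then v else 1)" for u v :: complex
  have Ui [simp]: "U u v $ i = u" for u v by (simp add: U_def)
  have Ud: "a \<in> Desc j \<Longrightarrow> U u v $ a = v" for u v a using inot by (auto simp: U_def)
  have mixU: "{mix S (U u v) (U u' v'), mix S (U u' v') (U u v)} = {U u v', U u' v}" for u v u' v'
  proof (cases "j \<in> S")
    case True
    then have "\<And>a. a \<in> Desc j \<Longrightarrow> a \<in> S" "i \<notin> S" using ij(2) side by blast+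
    then have "mix S (U u v) (U u' v') = (\<chi> a. if a = i then u' else if a \<in> Desc j then v else 1)"
      for u v u' v' by (simp add: vec_eq_iff U_def)
    then have "mix S (U u v) (U u' v') = U u' v" for u v u' v' by (simp only: U_def)
    then show ?thesis by auto
  next
    case False
    then have "\<And>a. a \<in> Desc j \<Longrightarrow> a \<notin> S" "i \<in> S" using ij(2) side by blast+
    then have "mix S (U u v) (U u' v') = (\<chi> a. if a = i then u else if a \<in> Desc j then v' else 1)"
      for u v u' v' by (simp add: vec_eq_iff U_def)
    then have "mix S (U u v) (U u' v') = U u v'" for u v u' v' by (simp only: U_def)
    then show ?thesis by auto
  qed
  let ?K = "branch i j" and ?y = "y i (Some j)"
  note act = active_branch[OF ij(1)]
  have V0: "V0 \<noteq> 0" by (rule V0_ne_0[OF inv x0])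
  have ident: "(frozen_Delta ?K i (U u v))\<^sup>2 * (frozen_Delta ?K i (U u' v'))\<^sup>2
     = (frozen_Delta ?K i (U u v'))\<^sup>2 * (frozen_Delta ?K i (U u' v))\<^sup>2" for u v u' v'
  proof -
    have "(\<Prod>k\<in>UNIV. (frozen_Delta ?K i (if k then U u v else U u' v'))\<^sup>2) =
       (\<Prod>k\<in>UNIV. (frozen_Delta ?K i (if k then mix S (U u v) (U u' v') else mix S (U u' v') (U u v)))\<^sup>2)"
    proof (rule frozen_identity[OF act])
      fix e :: real assume "e > 0"
      have "rescaled ?K i e (mix S A B) = mix S (rescaled ?K i e A) (rescaled ?K i e B)" for A B
        by (simp add: vec_eq_iff rescaled_def)
      then show "(\<Prod>k\<in>UNIV. (Delta (rescaled ?K i e (if k then U u v else U u' v')))\<^sup>2) =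
       (\<Prod>k\<in>UNIV. (Delta (rescaled ?K i e (if k then mix S (U u v) (U u' v') else mix S (U u' v') (U u v))))\<^sup>2)"
        using separable_identity[OF sep inv x0] by (simp add: UNIV_bool mult.commute)
    qed simp
    then have "(frozen_Delta ?K i (U u v))\<^sup>2 * (frozen_Delta ?K i (U u' v'))\<^sup>2
     = (frozen_Delta ?K i (mix S (U u v) (U u' v')))\<^sup>2 * (frozen_Delta ?K i (mix S (U u' v') (U u v)))\<^sup>2"
      by (simp add: UNIV_bool mult.commute)
    also have "\<dots> = (frozen_Delta ?K i (U u v'))\<^sup>2 * (frozen_Delta ?K i (U u' v))\<^sup>2"
      using mixU[of u v u' v'] by (auto simp: doubleton_eq_iff mult.commute)
    finally show ?thesis .
  qed
  define s where "s = source (U 0 0) i"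
  have src: "source (U u v) i = s" for u v
  proof -
    have "bus_voltage V0 (U u v) (par i) = bus_voltage V0 (U 0 0) (par i)"
      using par_ne_self[of i] active_par_notin[OF act]
      by (cases "par i") (auto simp: bus_voltage_def U_def branch_def)
    then show ?thesis by (simp add: s_def source_def)
  qed
  have s0: "s \<noteq> 0"
    unfolding s_def source_def
    using y_ne[OF par_in_nbrs[of i]] V0 par_ne_self[of i] active_par_notin[OF act]
    by (cases "par i") (auto simp: bus_voltage_def U_def branch_def)
  have y0: "?y \<noteq> 0" using ij(1) by (intro y_ne) (simp add: nbrs_iff)
  have ne: "bus_voltage V0 (U u v) (par a) \<noteq> 0" if "u \<noteq> 0" "v \<noteq> 0" for u v a
    using that V0 by (cases "par a") (auto simp: bus_voltage_def U_def)
  \<comment> \<open>The direction of \<open>u\<close> makes \<open>Re (cnj y * s * u)\<close> vanish for \<open>u\<close> and \<open>2 * u\<close>, so that \<open>branch_det\<close> reduces to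
    \<open>leaf_det\<close> times a factor that is nonzero for small \<open>t\<close>; and \<open>leaf_det u v\<close> vanishes at \<open>v = u/2\<close>.\<close>
  define R where "R = Re (\<i> * ?y * cnj (Ysum i))"
  define t where "t = 1 / (8 * (1 + \<bar>R\<bar>))"
  have t: "t > 0" "\<bar>4 * t * R\<bar> < 1"
    by (auto simp: t_def abs_mult field_simps)
  define u where "u = of_real t * \<i> * ?y * cnj s"
  have u0: "u \<noteq> 0" using t s0 y0 by (simp add: u_def)
  have Ezero: "Re (cnj ?y * s * (of_real c * u)) = 0" for c
  proof -
    have "cnj ?y * s * (of_real c * u) = \<i> * of_real (c * t * (cmod ?y)\<^sup>2 * (cmod s)\<^sup>2)"
      unfolding of_real_mult complex_norm_square by (simp add: u_def algebra_simps)
    then show ?thesis by (simp only: Re_i_times Im_complex_of_real neg_equal_0_iff_equal)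
  qed
  have Cne: "(cmod s)\<^sup>2 - 2 * Re (cnj (Ysum i) * s * (of_real c * u)) \<noteq> 0" if "c = 1 \<or> c = 2" for c
  proof -
    have "cnj (Ysum i) * s * (of_real c * u) = of_real (c * t * (cmod s)\<^sup>2) * (\<i> * ?y * cnj (Ysum i))"
      unfolding of_real_mult complex_norm_square by (simp add: u_def algebra_simps)
    then have "Re (cnj (Ysum i) * s * (of_real c * u)) = c * t * (cmod s)\<^sup>2 * R"
      unfolding R_def by (simp only: Re_of_real_mult)
    then have "(cmod s)\<^sup>2 - 2 * Re (cnj (Ysum i) * s * (of_real c * u)) = (cmod s)\<^sup>2 * (1 - 2 * c * t * R)"
      by (simp add: algebra_simps)
    moreover have "1 - 2 * c * t * R \<noteq> 0" using that t(2) by auto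
    ultimately show ?thesis using s0 by simp
  qed
  have Q: "leaf_det u (u/2) = 0" "leaf_det u (u/4) = (cmod u)\<^sup>2 / 2" "leaf_det (2*u) (u/2) = 2 * (cmod u)\<^sup>2"
    unfolding leaf_det_def cmod_sq by (simp_all add: algebra_simps)
  have sing: "frozen_Delta ?K i (U u (u/2)) = 0"
    by (rule frozen_branch(2)[OF ij(1) Ud[of _ u "u/2"]])
       (use Q u0 ne[of u "u/2"] Ezero[of 1] in \<open>auto simp: src\<close>)
  have "frozen_Delta ?K i (U u (u/4)) \<noteq> 0"
    by (rule frozen_branch(1)[OF ij(1) Ud[of _ u "u/4"]])
       (use Q u0 ne[of u "u/4"] Ezero[of 1] Cne[of 1] in \<open>auto simp: src branch_det_def\<close>)
  moreover have "frozen_Delta ?K i (U (2*u) (u/2)) \<noteq> 0"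
    by (rule frozen_branch(1)[OF ij(1) Ud[of _ "2*u" "u/2"]])
       (use Q u0 ne[of "2*u" "u/2"] Ezero[of 2] Cne[of 2] in \<open>auto simp: src branch_det_def\<close>)
  ultimately show False
    using ident[of u "u/2" "2*u" "u/4"] sing by simp
qed

lemma N2_cases:
  assumes "Some c \<in> N2 E (Some a)"
  shows "{Some a, Some c} \<in> E \<or> (\<exists>b. {Some a, b} \<in> E \<and> {b, Some c} \<in> E)"
proof -
  have rel: "(Some a, Some c) \<in> adj_rel E ^^ hop_dist E (Some a) (Some c)"
    by (rule hop_dist_relpow[OF tree])
  then show ?thesis
    using assms by (auto simp: N2_def adj_rel_def numeral_2_eq_2)
qed

text \<open>
  If all other loads are children of the root load \<open>r\<close>, it is the centre. Otherwise
  some load \<open>k\<close> has distance two from \<open>r\<close>, and its parent \<open>b\<close>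
  is the centre: a load outside the star of \<open>b\<close>, or else its parent, would be three
  hops away from \<open>k\<close>, on the other side of \<open>r\<close>.
\<close>

lemma star_centre:
  assumes two: "\<And>a c. a \<noteq> c \<Longrightarrow> Some c \<in> N2 E (Some a)"
  shows "\<exists>b. \<forall>a. a \<noteq> b \<longrightarrow> par a = Some b \<or> par b = Some a"
proof -
  obtain r where r: "par r = None"
    using radial edge_None_iff by (auto simp: radial_grid_def insert_commute)
  have rr: "par a = None \<longleftrightarrow> a = r" for a using par_None_unique[OF _ r, of a] r by blast
  have near: "par a = Some c \<or> par c = Some a \<or> (\<exists>m. {Some a, Some m} \<in> E \<and> {Some m, Some c} \<in> E)"
    if "a \<noteq> c" for a c
  proof -
    have "{Some a, None} \<in> E \<and> {None, Some c} \<in> E \<Longrightarrow> a = c"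
      using edge_None_iff[of a] edge_None_iff[of c] by (simp add: insert_commute rr)
    then show ?thesis
      using N2_cases[OF two[OF that]] that edge_iff by (metis option.exhaust)
  qed
  have near': "par a = Some c \<or> par c = Some a \<or>
     (\<exists>m. (par a = Some m \<or> par m = Some a) \<and> (par m = Some c \<or> par c = Some m))"
    if "a \<noteq> c" for a c
    using near[OF that] by (auto simp: edge_iff)
  show ?thesis
  proof (cases "\<forall>a. a \<noteq> r \<longrightarrow> par a = Some r")
    case True
    then show ?thesis by blast
  next
    case False
    then obtain k where k: "k \<noteq> r" "par k \<noteq> Some r" by blast
    obtain b where b: "par k = Some b" using k(1) rr by (cases "par k") auto
    have br: "par b = Some r"
    proof -
      have "par r \<noteq> Some m" for m using r by simp
      then show ?thesis using near'[OF k(1)] k(2) b by auto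
    qed
    have "par l = Some b \<or> par b = Some l" if l: "l \<noteq> b" for l
    proof (rule ccontr)
      assume n: "\<not> (par l = Some b \<or> par b = Some l)"
      then have lr: "l \<noteq> r" "l \<noteq> k" using br b by auto
      obtain m where m: "par l = Some m" using lr rr by (cases "par l") auto
      have "m \<noteq> b" using n m by auto
      have nk: "par k \<noteq> Some l" using b l by auto
      show False
      proof (cases "m = r")
        case True
        have "par l \<noteq> Some k" using m True k(1) by auto
        then obtain x where x: "par l = Some x \<or> par x = Some l" "par x = Some k \<or> par k = Some x"
          using near'[OF lr(2)] nk by auto
        then show False using m True b br n r k lr by (auto dest: par_asym)
      next
        case False
        have "par m = Some r"
        proof -
          have "par r \<noteq> Some x" for x using r by simp
          then show ?thesis using near'[OF lr(1)] m False by auto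
        qed
        have mk: "m \<noteq> k" using k \<open>par m = Some r\<close> by auto
        have "par m \<noteq> Some k" using \<open>par m = Some r\<close> k by auto
        moreover have "par k \<noteq> Some m" using b \<open>m \<noteq> b\<close> by auto
        ultimately obtain x where x: "par m = Some x \<or> par x = Some m" "par x = Some k \<or> par k = Some x"
          using near'[OF mk] by auto
        then show False using \<open>par m = Some r\<close> b br r k \<open>m \<noteq> b\<close> by (auto dest: par_asym)
      qed
    qed
    then show ?thesis by blast
  qed
qed

lemma star_leaf_nbrs:
  assumes star: "\<And>a. a \<noteq> b \<Longrightarrow> par a = Some b \<or> par b = Some a" and a: "par a = Some b"
  shows "nbrs a = {Some b}" "Desc a = {a}"
proof -
  have no: "par c \<noteq> Some a" for c
  proof
    assume c: "par c = Some a"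
    then have "c \<noteq> b" "c \<noteq> a" using a by (auto dest: par_asym)
    then have "par c = Some b \<or> par b = Some c" using star by blast
    then show False
    proof
      assume "par c = Some b" then show False using c a by auto
    next
      assume "par b = Some c" then show False
        using c a par_less[of a] par_less[of b] par_less[of c] by simp
    qed
  qed
  then show "nbrs a = {Some b}" using a by (auto simp: nbrs_iff)
  have "d = a" if "d \<in> Desc a" for d
  proof (rule ccontr)
    assume "d \<noteq> a"
    have "(d, a) \<in> {(c, d). par c = Some d}\<^sup>*" using that by (simp add: Desc_def)
    then show False using \<open>d \<noteq> a\<close> no by (auto elim: rtranclE)
  qed
  then show "Desc a = {a}" by auto
qed

end

section \<open>From a set of positive measure to polynomial identities\<close>

text \<open>
  Besides closeness to the identity, the only property of the moves that enters the recurrence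
  argument. Isometries have it, and so do contractions towards a point, which serve to recognise
  polynomials that vanish.
\<close>

definition expanding :: "('a::euclidean_space \<Rightarrow> 'a) \<Rightarrow> bool" where
  "expanding T \<longleftrightarrow> T \<in> borel_measurable borel \<and>
     (\<forall>A\<in>sets borel. emeasure lborel A \<le> emeasure lborel (T -` A))"

text \<open>
  Closeness to the identity is demanded only where the image stays in a fixed ball, because a
  rotation is not uniformly close to the identity.
\<close>

definition near_id :: "real \<Rightarrow> real \<Rightarrow> ('a::euclidean_space \<Rightarrow> 'a) \<Rightarrow> bool" where
  "near_id R \<delta> T \<longleftrightarrow> (\<forall>x. norm (T x) \<le> R \<longrightarrow> dist (T x) x < \<delta>)"

text \<open>
  A Steinhaus argument. A compact \<open>K \<subseteq> W\<close> nearly fills an open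
  \<open>B \<supseteq> K\<close>. If \<open>T\<close> moves points by less than the distance of
  \<open>K\<close> from the complement of \<open>B\<close>, then \<open>T -` K\<close> lies in
  \<open>B\<close> and is at least as large as \<open>K\<close>, hence nearly fills \<open>B\<close>
  too.
\<close>

lemma recurrence_core:
  fixes W :: "'a::euclidean_space set"
  assumes W: "W \<in> sets borel" "emeasure lborel W > 0" and N: "N > (0::nat)"
  obtains B R \<delta> where "\<delta> > 0" "B \<in> sets borel" "0 < emeasure lborel B" "emeasure lborel B < \<infinity>"
    "\<And>T. expanding T \<Longrightarrow> near_id R \<delta> T \<Longrightarrow> of_nat N * emeasure lborel (B - T -` W) < emeasure lborel B"
proof -
  have W_Un: "W = (\<Union>n. W \<inter> cball 0 (real n))"
    by (auto, meson mem_cball_0 real_arch_simple)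
  obtain n where n: "emeasure lborel (W \<inter> cball 0 (real n)) > 0"
  proof (rule ccontr)
    assume *: "\<not> thesis"
    have "emeasure lborel (\<Union>n. W \<inter> cball 0 (real n)) = 0"
    proof (rule emeasure_UN_eq_0)
      show "emeasure lborel (W \<inter> cball 0 (real n)) = 0" for n
        using * that[of n] by (cases "emeasure lborel (W \<inter> cball 0 (real n)) > 0") auto
    qed (use W(1) in auto)
    then show False using W W_Un by simp
  qed
  define R where "R = real n"
  define W' where "W' = W \<inter> cball 0 R"
  have W': "W' \<in> sets borel" "emeasure lborel W' > 0" using W n by (auto simp: W'_def R_def)
  have fin: "emeasure lborel W' < \<infinity>"
    using emeasure_bounded_finite[of W'] by (auto simp: W'_def bounded_Int)
  define w where "w = enn2real (emeasure lborel W')"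
  have w: "emeasure lborel W' = ennreal w" "w > 0"
    using W' fin by (auto simp: w_def enn2real_positive_iff)
  have leb: "W' \<in> sets lebesgue" using W'(1) by simp
  obtain K where K: "closed K" "K \<subseteq> W'" "W' - K \<in> lmeasurable" "emeasure lebesgue (W' - K) < ennreal (w/2)"
    by (rule sets_lebesgue_inner_closed[OF leb, of "w/2"]) (use w(2) in simp, rule that)
  have Kc: "compact K" using K(1,2) by (auto simp: compact_eq_bounded_closed W'_def intro: bounded_subset[of "cball 0 R"])
  then have Kb: "K \<in> sets borel" by (simp add: borel_compact)
  have "ennreal w \<le> emeasure lborel K + emeasure lborel (W' - K)"
  proof -
    have "W' = K \<union> (W' - K)" using K(2) by auto
    then have "ennreal w = emeasure lborel (K \<union> (W' - K))" using w(1) by simp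
    also have "\<dots> \<le> emeasure lborel K + emeasure lborel (W' - K)"
      using Kb W'(1) by (intro emeasure_subadditive) auto
    finally show ?thesis .
  qed
  moreover have "emeasure lborel (W' - K) < ennreal (w/2)"
    using K(4) Kb W'(1) by (simp add: emeasure_completion)
  ultimately have Kpos: "emeasure lborel K > 0"
    using w(2) by (metis add_0 ennreal_less_iff field_sum_of_halves gr_zeroI leD less_add_same_cancel1 half_gt_zero less_imp_le less_trans)
  have Kfin: "emeasure lborel K < \<infinity>" by (rule emeasure_compact_finite[OF Kc])
  define k where "k = enn2real (emeasure lborel K)"
  have k: "emeasure lborel K = ennreal k" "k > 0"
    using Kpos Kfin by (auto simp: k_def enn2real_positive_iff)
  obtain O' where O': "open O'" "K \<subseteq> O'" "emeasure lebesgue (O' - K) < ennreal (k / N)"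
    by (rule sets_lebesgue_outer_open[of K "k/N"]) (use Kb k(2) N in \<open>auto intro: that\<close>)
  have Ob: "O' \<in> sets borel" using O'(1) by simp
  have diff: "emeasure lborel (O' - K) < ennreal (k / N)"
    using O'(3) Kb Ob by (simp add: emeasure_completion)
  have Oeq: "emeasure lborel O' = emeasure lborel K + emeasure lborel (O' - K)"
    using O'(2) Kb Ob by (metis Diff_partition emeasure_Un plus_emeasure Diff_disjoint sets.Diff sets_lborel)
  obtain \<delta> where \<delta>: "\<delta> > 0" "\<And>x y. x \<in> K \<Longrightarrow> y \<in> - O' \<Longrightarrow> \<delta> \<le> dist x y"
  proof -
    have "K \<inter> - O' = {}" "closed (- O')" using O'(1,2) by auto
    then have "\<exists>\<delta>>0. \<forall>x\<in>K. \<forall>y\<in>- O'. \<delta> \<le> dist x y" using separate_compact_closed[OF Kc] by blast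
    then show ?thesis using that by blast
  qed
  show ?thesis
  proof
    show "\<delta> > 0" "O' \<in> sets borel" by fact+
    show "0 < emeasure lborel O'" unfolding Oeq by (rule add_pos_nonneg[OF Kpos]) simp
    show "emeasure lborel O' < \<infinity>"
      using Oeq Kfin diff by (metis ennreal_add_less_top infinity_ennreal_def ennreal_less_top order_less_trans)
    fix T :: "'a \<Rightarrow> 'a" assume T: "expanding T" "near_id R \<delta> T"
    have Tm: "T -` K \<in> sets borel" using T(1) Kb by (auto simp: expanding_def intro: measurable_sets_borel)
    have sub: "T -` K \<subseteq> O'"
    proof
      fix x assume x: "x \<in> T -` K"
      then have "T x \<in> K" by simp
      then have "norm (T x) \<le> R" using K(2) by (auto simp: W'_def)
      then have "dist (T x) x < \<delta>" using T(2) by (simp add: near_id_def)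
      then show "x \<in> O'" using \<delta>(2)[OF \<open>T x \<in> K\<close>, of x] by force
    qed
    have TW: "T -` W \<in> sets borel" using T(1) W(1) by (auto simp: expanding_def intro: measurable_sets_borel)
    have "emeasure lborel (O' - T -` W) \<le> emeasure lborel (O' - T -` K)"
      using K(2) Ob Tm by (intro emeasure_mono) (auto simp: W'_def)
    also have "\<dots> = emeasure lborel O' - emeasure lborel (T -` K)"
      using sub Tm Ob Kfin \<open>emeasure lborel O' < \<infinity>\<close>
      by (intro emeasure_Diff) (auto simp: top_unique dest: emeasure_mono[of _ _ lborel])
    also have "\<dots> \<le> emeasure lborel O' - emeasure lborel K"
      using T(1) Kb by (intro ennreal_mono_minus) (auto simp: expanding_def)
    also have "\<dots> \<le> emeasure lborel (O' - K)"
      unfolding Oeq using Kfin by simp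
    also have "\<dots> < ennreal (k / N)" by (rule diff)
    finally have "emeasure lborel (O' - T -` W) < ennreal (k / N)" .
    then have "of_nat N * emeasure lborel (O' - T -` W) < of_nat N * ennreal (k / N)"
      using N by (intro ennreal_mult_strict_left_mono) (auto simp: of_nat_less_top)
    also have "\<dots> = ennreal k" using N k(2) by (simp add: ennreal_of_nat_eq_real_of_nat ennreal_mult[symmetric])
    also have "\<dots> \<le> emeasure lborel O'" unfolding Oeq k(1) by simp
    finally show "of_nat N * emeasure lborel (O' - T -` W) < emeasure lborel O'" .
  qed
qed

text \<open>
  The bad sets of \<open>N\<close> moves, each of relative size below \<open>1 / (N + 1)\<close>,
  cannot cover \<open>B\<close>.
\<close>

lemma recurrence:
  fixes W :: "'a::euclidean_space set"
  assumes W: "W \<in> sets borel" "emeasure lborel W > 0"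
  shows "\<exists>R. \<exists>\<delta>>0. \<forall>(I::nat set) T. finite I \<longrightarrow> card I \<le> N \<longrightarrow>
       (\<forall>k\<in>I. expanding (T k) \<and> near_id R \<delta> (T k)) \<longrightarrow>
       {x. \<forall>k\<in>I. T k x \<in> W} \<in> sets borel \<and> emeasure lborel {x. \<forall>k\<in>I. T k x \<in> W} > 0"
proof -
  obtain B R \<delta> where B: "\<delta> > 0" "B \<in> sets borel" "0 < emeasure lborel B" "emeasure lborel B < \<infinity>"
    "\<And>T. expanding T \<Longrightarrow> near_id R \<delta> T \<Longrightarrow> of_nat (Suc N) * emeasure lborel (B - T -` W) < emeasure lborel B"
    by (rule recurrence_core[OF W zero_less_Suc[of N]]) (rule that)
  show ?thesis
  proof (rule exI[of _ R], rule exI[of _ \<delta>], intro conjI[OF B(1)] allI impI)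
    fix I :: "nat set" and T :: "nat \<Rightarrow> 'a \<Rightarrow> 'a"
    assume I: "finite I" "card I \<le> N" and "\<forall>k\<in>I. expanding (T k) \<and> near_id R \<delta> (T k)"
    then have T: "\<And>k. k \<in> I \<Longrightarrow> expanding (T k) \<and> near_id R \<delta> (T k)" by blast
    let ?S = "{x. \<forall>k\<in>I. T k x \<in> W}"
    have Tm: "T k -` W \<in> sets borel" if "k \<in> I" for k
      using T[OF that] W(1) by (auto simp: expanding_def intro: measurable_sets_borel)
    have S_eq: "?S = UNIV - (\<Union>k\<in>I. UNIV - T k -` W)" by auto
    show "?S \<in> sets borel \<and> 0 < emeasure lborel ?S"
    proof
      have "(\<Union>k\<in>I. UNIV - T k -` W) \<in> sets borel"
        using Tm I(1) by (intro sets.finite_UN) (auto intro: borel_comp simp: Compl_eq_Diff_UNIV[symmetric])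
      then show Sm: "?S \<in> sets borel" unfolding S_eq by (rule sets.Diff[rotated]) simp
      show "0 < emeasure lborel ?S"
      proof (rule ccontr)
        assume "\<not> 0 < emeasure lborel ?S"
        then have S0: "emeasure lborel ?S = 0" by simp
        have Um: "(\<Union>k\<in>I. B - T k -` W) \<in> sets borel"
          using Tm I(1) B(2) by (intro sets.finite_UN) auto
        have "emeasure lborel B \<le> emeasure lborel (?S \<union> (\<Union>k\<in>I. B - T k -` W))"
          using Sm Um by (intro emeasure_mono) (blast, simp)
        also have "\<dots> \<le> emeasure lborel ?S + emeasure lborel (\<Union>k\<in>I. B - T k -` W)"
          using Sm Um by (intro emeasure_subadditive) (simp_all only: sets_lborel)
        also have "\<dots> \<le> (\<Sum>k\<in>I. emeasure lborel (B - T k -` W))"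
          unfolding S0 add_0_left using Tm I(1) B(2) by (intro emeasure_subadditive_finite) auto
        finally have le: "emeasure lborel B \<le> (\<Sum>k\<in>I. emeasure lborel (B - T k -` W))" .
        have bd: "emeasure lborel (B - T k -` W) \<le> emeasure lborel B / of_nat (Suc N)" if "k \<in> I" for k
        proof -
          have "emeasure lborel (B - T k -` W) \<le> emeasure lborel B" using B(2) by (intro emeasure_mono) auto
          then have fin: "emeasure lborel (B - T k -` W) \<noteq> \<top>" using B(4) by (auto simp: top_unique)
          define x where "x = enn2real (emeasure lborel (B - T k -` W))"
          define b where "b = enn2real (emeasure lborel B)"
          have x: "emeasure lborel (B - T k -` W) = ennreal x" "x \<ge> 0"
            and b: "emeasure lborel B = ennreal b" "b \<ge> 0"
            using fin B(4) by (simp_all add: x_def b_def less_top)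
          have "ennreal (real (Suc N) * x) < ennreal b"
            using B(5)[of "T k"] T[OF that] x(2)
            unfolding x(1) b(1) ennreal_of_nat_eq_real_of_nat by (simp only: ennreal_mult of_nat_0_le_iff)
          then have "real (Suc N) * x < b" using x(2) by (subst (asm) ennreal_less_iff) auto
          then have "x \<le> b / real (Suc N)" by (simp add: field_simps)
          then show ?thesis
            unfolding x(1) b(1) ennreal_of_nat_eq_real_of_nat
            using b(2) by (subst divide_ennreal) (auto intro: ennreal_leI)
        qed
        have "(\<Sum>k\<in>I. emeasure lborel (B - T k -` W)) \<le> of_nat (card I) * (emeasure lborel B / of_nat (Suc N))"
          using sum_bounded_above[of I _ "emeasure lborel B / of_nat (Suc N)"] bd by simp
        also have "\<dots> \<le> of_nat N * (emeasure lborel B / of_nat (Suc N))"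
          using I(2) by (intro mult_right_mono) auto
        also have "\<dots> < emeasure lborel B"
        proof -
          define b where "b = enn2real (emeasure lborel B)"
          have b: "emeasure lborel B = ennreal b" "b > 0"
            using B(3,4) by (auto simp: b_def enn2real_positive_iff)
          have "of_nat N * (emeasure lborel B / of_nat (Suc N)) = ennreal (N * (b / Suc N))"
            unfolding b(1) ennreal_of_nat_eq_real_of_nat
            using b(2) by (subst divide_ennreal) (auto simp: ennreal_mult[symmetric])
          also have "\<dots> < ennreal b" using b(2) by (intro ennreal_lessI) (auto simp: field_simps)
          finally show ?thesis by (simp add: b)
        qed
        finally show False using le by simp
      qed
    qed
  qed
qed

lemma expanding_if_distr_eq:
  assumes "T \<in> borel_measurable borel" "distr lborel borel T = lborel"
  shows "expanding T"
proof -
  have "emeasure lborel (T -` A) = emeasure lborel A" if "A \<in> sets borel" for A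
    using emeasure_distr[of T lborel borel A] assms that by simp
  then show ?thesis using assms(1) by (simp add: expanding_def)
qed

lemma expanding_contraction:
  assumes c: "0 < c" "c \<le> 1"
  shows "expanding (\<lambda>x. a + c *\<^sub>R (x - a) :: 'a::euclidean_space)"
proof -
  let ?T = "\<lambda>x. (a - c *\<^sub>R a) + c *\<^sub>R x"
  have T: "(\<lambda>x. a + c *\<^sub>R (x - a)) = ?T" by (auto simp: algebra_simps)
  have "emeasure lborel A \<le> emeasure lborel (?T -` A)" if A: "A \<in> sets borel" for A
  proof -
    have m: "?T -` A \<in> sets borel" by (rule measurable_sets_borel[OF _ A]) measurable
    have "emeasure lborel A = emeasure (density (distr lborel borel ?T) (\<lambda>_. \<bar>c\<bar>^DIM('a))) A"
      using lborel_affine[of c "a - c *\<^sub>R a"] c by simp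
    also have "\<dots> = ennreal (\<bar>c\<bar>^DIM('a)) * emeasure lborel (?T -` A)"
      using A by (subst emeasure_density_const) (auto simp: emeasure_distr)
    also have "\<dots> \<le> 1 * emeasure lborel (?T -` A)"
      using c by (intro mult_right_mono) (auto simp: power_le_one)
    finally show ?thesis by simp
  qed
  then show ?thesis unfolding T by (auto simp: expanding_def)
qed

text \<open>
  By recurrence for contractions towards \<open>a\<close>, some line through \<open>a\<close> meets
  the zero set infinitely often; on this line the polynomial vanishes identically.
\<close>

lemma real_polynomial_function_eq_0_if_positive_measure:
  fixes p :: "'a::euclidean_space \<Rightarrow> real"
  assumes p: "real_polynomial_function p" and W: "W \<in> sets borel" "emeasure lborel W > 0"
    and zero: "\<And>x. x \<in> W \<Longrightarrow> p x = 0"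
  shows "p a = 0"
proof -
  obtain B R \<delta> where B: "\<delta> > 0" "B \<in> sets borel" "0 < emeasure lborel B" "emeasure lborel B < \<infinity>"
    "\<And>T. expanding T \<Longrightarrow> near_id R \<delta> T \<Longrightarrow> of_nat 2 * emeasure lborel (B - T -` W) < emeasure lborel B"
    by (rule recurrence_core[OF W pos2]) (rule that)
  define c where "c n = 1 - 1 / (real n + 2)" for n
  define T where "T n x = a + c n *\<^sub>R (x - a)" for n x
  have c: "0 < c n" "c n \<le> 1" "1/2 \<le> c n" for n by (auto simp: c_def field_simps)
  have Tm [measurable]: "T n \<in> borel_measurable borel" for n unfolding T_def by measurable
  define n0 where "n0 = nat \<lceil>2 * (\<bar>R\<bar> + norm a) / \<delta>\<rceil>"
  have near: "near_id R \<delta> (T n)" if n: "n \<ge> n0" for n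
    unfolding near_id_def
  proof (intro allI impI)
    fix x assume "norm (T n x) \<le> R"
    have "c n *\<^sub>R (x - a) = T n x - a" by (simp add: T_def)
    then have "c n * norm (x - a) = norm (T n x - a)" using c(1)[of n] by (metis abs_of_pos norm_scaleR)
    also have "\<dots> \<le> \<bar>R\<bar> + norm a" using \<open>norm (T n x) \<le> R\<close> norm_triangle_ineq4[of "T n x" a] by simp
    finally have "1/2 * norm (x - a) \<le> \<bar>R\<bar> + norm a"
      using c(3)[of n] by (meson mult_right_mono norm_ge_zero order_trans)
    then have xa: "norm (x - a) \<le> 2 * (\<bar>R\<bar> + norm a)" by simp
    have "T n x - x = (c n - 1) *\<^sub>R (x - a)" by (simp add: T_def algebra_simps)
    then have "dist (T n x) x = norm (x - a) / (real n + 2)"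
      by (simp add: dist_norm c_def)
    also have "\<dots> \<le> 2 * (\<bar>R\<bar> + norm a) / (real n + 2)" using xa by (intro divide_right_mono) auto
    also have "\<dots> < \<delta>"
    proof -
      have "2 * (\<bar>R\<bar> + norm a) / \<delta> \<le> real n"
        using n unfolding n0_def by linarith
      then show ?thesis using B(1) by (simp add: field_simps)
    qed
    finally show "dist (T n x) x < \<delta>" .
  qed
  \<comment> \<open>Points of \<open>B\<close> whose images avoid \<open>W\<close> from the contraction \<open>max m n0\<close> on; each such set fills at most half of \<open>B\<close>.\<close>
  define A where "A m = (\<Inter>n\<in>{max m n0..}. B - T n -` W)" for m
  have Wm: "T n -` W \<in> sets borel" for n by (rule measurable_sets_borel[OF Tm W(1)])
  have Am: "A m \<in> sets lborel" for m unfolding A_def using B(2) Wm by (auto intro!: sets.countable_INT')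
  have le: "2 * emeasure lborel (A m) \<le> emeasure lborel B" for m
  proof -
    have "emeasure lborel (A m) \<le> emeasure lborel (B - T (max m n0) -` W)"
      using B(2) Wm by (intro emeasure_mono) (auto simp: A_def)
    then have "2 * emeasure lborel (A m) \<le> 2 * emeasure lborel (B - T (max m n0) -` W)"
      by (intro mult_left_mono) auto
    also have "\<dots> \<le> emeasure lborel B"
      using B(5)[OF _ near[of "max m n0"]] expanding_contraction[OF c(1)[of "max m n0"] c(2)[of "max m n0"], of a]
      unfolding T_def by (simp add: less_imp_le)
    finally show ?thesis .
  qed
  have inc: "incseq A" unfolding A_def by (intro incseq_SucI INF_superset_mono) auto
  have "2 * emeasure lborel (\<Union>m. A m) = 2 * (SUP m. emeasure lborel (A m))"
    by (subst SUP_emeasure_incseq) (use Am inc in \<open>auto simp del: sets_lborel\<close>)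
  also have "\<dots> = (SUP m. 2 * emeasure lborel (A m))"
    by (rule SUP_mult_left_ennreal)
  also have "\<dots> \<le> emeasure lborel B" by (rule SUP_least) (rule le)
  finally have twice: "2 * emeasure lborel (\<Union>m. A m) \<le> emeasure lborel B" .
  have lt: "emeasure lborel (\<Union>m. A m) < emeasure lborel B"
  proof (rule ccontr)
    assume "\<not> ?thesis"
    then have "2 * emeasure lborel B \<le> 2 * emeasure lborel (\<Union>m. A m)"
      by (intro mult_left_mono) auto
    then have le2: "2 * emeasure lborel B \<le> emeasure lborel B" using twice by (rule order_trans)
    define b where "b = enn2real (emeasure lborel B)"
    have b: "emeasure lborel B = ennreal b" "b > 0"
      using B(3,4) by (auto simp: b_def enn2real_positive_iff)
    have "2 * ennreal b = ennreal (2 * b)" using b(2) by (simp add: ennreal_mult)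
    then have "ennreal (2 * b) \<le> ennreal b" using le2 by (simp add: b(1))
    then show False using b(2) by (simp add: ennreal_le_iff)
  qed
  have "(\<Union>m. A m) \<in> sets lborel" using Am by (intro sets.countable_UN) auto
  then have "\<not> B \<subseteq> (\<Union>m. A m)"
    using lt emeasure_mono[of B "\<Union>m. A m" lborel] leD by blast
  then obtain x where x: "x \<in> B" "\<And>m. x \<notin> A m" by auto
  have inf: "infinite {n. T n x \<in> W}"
    unfolding infinite_nat_iff_unbounded_le
  proof
    fix m from x(2)[of m] obtain n where "n \<ge> m" "T n x \<in> W" using x(1) by (auto simp: A_def)
    then show "\<exists>n\<ge>m. n \<in> {n. T n x \<in> W}" by auto
  qed
  have "inj c" by (rule injI) (auto simp: c_def field_simps)
  then have "inj_on c {n. T n x \<in> W}" by (rule inj_on_subset) simp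
  then have "infinite (c ` {n. T n x \<in> W})" using inf by (simp add: finite_image_iff)
  moreover have "c ` {n. T n x \<in> W} \<subseteq> {t. p (a + t *\<^sub>R (x - a)) = 0}"
    using zero by (auto simp: T_def)
  ultimately have "infinite {t. p (a + t *\<^sub>R (x - a)) = 0}" using finite_subset by blast
  from real_polynomial_function_on_line[OF p this, of 0] show ?thesis by simp
qed

text \<open>
  The image measure \<open>\<mu>\<close> is translation invariant and agrees with Lebesgue measure
  on the unit ball, which \<open>T\<close> preserves. Haar's uniqueness argument, a double integral
  over ball and test set evaluated in two orders, gives \<open>\<mu> = lborel\<close>.
\<close>

lemma distr_lborel_isometry:
  fixes T :: "'a::euclidean_space \<Rightarrow> 'a"
  assumes lin: "linear T" and iso: "\<And>x. norm (T x) = norm x"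
  shows "distr lborel borel T = lborel"
proof -
  define \<mu> where "\<mu> = distr lborel borel T"
  have Tm [measurable]: "T \<in> borel_measurable borel"
    using lin by (simp add: linear_continuous_on linear_conv_bounded_linear borel_measurable_continuous_onI)
  have "inj T" using lin iso by (metis linear_injective_0 norm_eq_zero)
  then have surj: "surj T" using lin linear_injective_imp_surjective by blast
  have sets: "sets \<mu> = sets borel" by (simp add: \<mu>_def)
  have em: "emeasure \<mu> A = emeasure lborel (T -` A)" if "A \<in> sets borel" for A
    using that by (simp add: \<mu>_def emeasure_distr)
  have shift: "emeasure \<mu> {w. x + w \<in> A} = emeasure \<mu> A" if A: "A \<in> sets borel" for A x
  proof -
    obtain w where w: "x = T w" using surj by (metis surjD)
    have m: "{w. x + w \<in> A} \<in> sets borel" using A by measurable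
    have "T -` {w. x + w \<in> A} = (\<lambda>z. w + z) -` (T -` A)"
      using lin by (auto simp: w linear_add)
    moreover have "emeasure lborel ((\<lambda>z. w + z) -` (T -` A)) = emeasure lborel (T -` A)"
      using lborel_distr_plus[of w] emeasure_distr[of "(+) w" lborel borel "T -` A"]
        measurable_sets_borel[OF Tm A] by simp
    ultimately show ?thesis using em[OF m] em[OF A] by simp
  qed
  have sh: "emeasure lborel {x. x + w \<in> A} = emeasure lborel A" if "A \<in> sets borel" for A and w :: 'a
    using lborel_distr_plus[of w] emeasure_distr[of "(+) w" lborel borel A] that
    by (simp add: vimage_def add.commute)
  let ?A = "ball 0 1 :: 'a set"
  have Am [measurable]: "?A \<in> sets borel" by simp
  have TA: "T -` ?A = ?A" using iso by auto
  have sf: "sigma_finite_measure \<mu>"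
  proof
    have "emeasure \<mu> (ball 0 (real n)) < \<infinity>" for n
    proof -
      have "T -` ball 0 (real n) = ball 0 (real n)" using iso by auto
      then show ?thesis using em[of "ball 0 (real n)"] emeasure_bounded_finite[OF bounded_ball] by simp
    qed
    moreover have "(\<Union>n. ball 0 (real n)) = (UNIV :: 'a set)"
      by (auto simp: reals_Archimedean2)
    ultimately show "\<exists>A. countable A \<and> A \<subseteq> sets \<mu> \<and> \<Union> A = space \<mu> \<and> (\<forall>a\<in>A. emeasure \<mu> a \<noteq> \<infinity>)"
      by (intro exI[of _ "range (\<lambda>n. ball 0 (real n))"]) (auto simp: \<mu>_def less_top)
  qed
  interpret \<mu>: sigma_finite_measure \<mu> by (rule sf)
  interpret pair_sigma_finite lborel \<mu> ..
  have "emeasure \<mu> B = emeasure lborel B" if B: "B \<in> sets borel" for B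
  proof -
    have Bm [measurable]: "B \<in> sets borel" by (rule B)
    have "emeasure lborel ?A * emeasure \<mu> B = (\<integral>\<^sup>+x. indicator ?A x * emeasure \<mu> {w. x + w \<in> B} \<partial>lborel)"
      unfolding shift[OF B] by (subst nn_integral_multc) (auto intro: borel_measurable_indicator)
    also have "\<dots> = (\<integral>\<^sup>+x. (\<integral>\<^sup>+w. indicator ?A x * indicator B (x + w) \<partial>\<mu>) \<partial>lborel)"
    proof (intro nn_integral_cong)
      fix x :: 'a
      have m: "{w. x + w \<in> B} \<in> sets \<mu>" unfolding sets by measurable
      have "(\<integral>\<^sup>+w. indicator ?A x * indicator B (x + w) \<partial>\<mu>) = indicator ?A x * (\<integral>\<^sup>+w. indicator {w. x + w \<in> B} w \<partial>\<mu>)"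
        by (subst nn_integral_cmult[symmetric])
           (auto intro!: nn_integral_cong simp: indicator_def \<mu>_def)
      then show "indicator ?A x * emeasure \<mu> {w. x + w \<in> B} = (\<integral>\<^sup>+w. indicator ?A x * indicator B (x + w) \<partial>\<mu>)"
        using m by simp
    qed
    also have "\<dots> = (\<integral>\<^sup>+w. (\<integral>\<^sup>+x. indicator ?A x * indicator B (x + w) \<partial>lborel) \<partial>\<mu>)"
    proof (rule Fubini'[of "\<lambda>x w. indicator ?A x * indicator B (x + w)", symmetric])
      show "(\<lambda>(x, w). indicator ?A x * indicator B (x + w) :: ennreal) \<in> borel_measurable (lborel \<Otimes>\<^sub>M \<mu>)"
        unfolding measurable_cong_sets[OF sets_pair_measure_cong[OF sets_lborel sets] refl] by measurable
    qed
    also have "\<dots> = (\<integral>\<^sup>+w. (\<integral>\<^sup>+x. indicator ?A (x - w) * indicator B x \<partial>lborel) \<partial>\<mu>)"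
    proof (rule nn_integral_cong)
      fix w :: 'a
      have "(\<integral>\<^sup>+x. indicator ?A (x - w) * indicator B x \<partial>lborel)
        = (\<integral>\<^sup>+x. indicator ?A (x - w) * indicator B x \<partial>(distr lborel borel ((+) w)))"
        by (simp add: lborel_distr_plus)
      also have "\<dots> = (\<integral>\<^sup>+x. indicator ?A x * indicator B (x + w) \<partial>lborel)"
        by (subst nn_integral_distr) (auto simp: add.commute)
      finally show "(\<integral>\<^sup>+x. indicator ?A x * indicator B (x + w) \<partial>lborel) =
         (\<integral>\<^sup>+x. indicator ?A (x - w) * indicator B x \<partial>lborel)" by simp
    qed
    also have "\<dots> = (\<integral>\<^sup>+x. (\<integral>\<^sup>+w. indicator ?A (x - w) * indicator B x \<partial>\<mu>) \<partial>lborel)"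
    proof (rule Fubini'[of "\<lambda>x w. indicator ?A (x - w) * indicator B x"])
      show "(\<lambda>(x, w). indicator ?A (x - w) * indicator B x :: ennreal) \<in> borel_measurable (lborel \<Otimes>\<^sub>M \<mu>)"
        unfolding measurable_cong_sets[OF sets_pair_measure_cong[OF sets_lborel sets] refl] by measurable
    qed
    also have "\<dots> = (\<integral>\<^sup>+x. emeasure \<mu> ?A * indicator B x \<partial>lborel)"
    proof (intro nn_integral_cong)
      fix x :: 'a
      have "{w. - x + w \<in> ?A} = {w. x - w \<in> ?A}"
        by (auto simp: dist_norm norm_minus_commute)
      then have "emeasure \<mu> {w. x - w \<in> ?A} = emeasure \<mu> ?A" using shift[of ?A "- x"] by simp
      moreover have "{w. x - w \<in> ?A} \<in> sets \<mu>" unfolding sets by measurable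
      moreover have "(\<integral>\<^sup>+w. indicator ?A (x - w) * indicator B x \<partial>\<mu>) = (\<integral>\<^sup>+w. indicator {w. x - w \<in> ?A} w \<partial>\<mu>) * indicator B x"
        by (subst nn_integral_multc[symmetric])
           (auto intro!: nn_integral_cong simp: indicator_def \<mu>_def)
      ultimately show "(\<integral>\<^sup>+w. indicator ?A (x - w) * indicator B x \<partial>\<mu>) = emeasure \<mu> ?A * indicator B x"
        by simp
    qed
    also have "\<dots> = emeasure \<mu> ?A * emeasure lborel B" by (simp add: nn_integral_cmult)
    also have "emeasure \<mu> ?A = emeasure lborel ?A" using em[of ?A] TA by simp
    finally have eq: "emeasure lborel ?A * emeasure \<mu> B = emeasure lborel ?A * emeasure lborel B" .
    have "emeasure lborel ?A \<noteq> 0" using content_ball_pos[of 1 "0 :: 'a"] by (auto simp: measure_def)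
    moreover have "emeasure lborel ?A \<noteq> \<infinity>" using emeasure_bounded_finite[OF bounded_ball, of 0 1] by (simp add: less_top)
    ultimately show ?thesis using eq by (simp add: ennreal_mult_cancel_left)
  qed
  then show ?thesis by (intro measure_eqI) (auto simp: \<mu>_def)
qed

definition small_moves :: "nat \<Rightarrow> real \<Rightarrow> real \<Rightarrow> (nat \<Rightarrow> 'a::euclidean_space \<Rightarrow> 'a) \<Rightarrow> bool" where
  "small_moves n R \<delta> T \<longleftrightarrow> (\<forall>k<n. expanding (T k) \<and> near_id R \<delta> (T k) \<and> polynomial_function (T k))"

definition balanced :: "nat \<Rightarrow> (nat \<Rightarrow> 'a \<Rightarrow> 'a) \<Rightarrow> (nat \<Rightarrow> 'a \<Rightarrow> 'a) \<Rightarrow> ('a \<Rightarrow> real) \<Rightarrow> bool" where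
  "balanced n T T' g \<longleftrightarrow> (\<forall>x. (\<Prod>k<n. g (T k x)) = (\<Prod>k<n. g (T' k x)))"

lemma balanced_mult: "balanced n T T' g \<Longrightarrow> balanced n T T' h \<Longrightarrow> balanced n T T' (\<lambda>x. g x * h x)"
  by (simp add: balanced_def prod.distrib)

lemma balanced_prod:
  "(\<And>k. k \<in> I \<Longrightarrow> balanced n T T' (g k)) \<Longrightarrow> balanced n T T' (\<lambda>x. \<Prod>k\<in>I. g k x)"
  unfolding balanced_def by (simp only: prod.swap[of _ I "{..<n}"] simp_thms cong: prod.cong)

text \<open>
  On a non-null set of \<open>x\<close> all images lie in \<open>W\<close> at once. There the
  factorisation turns a balance of \<open>A\<close> and \<open>B\<close> into a balance of
  \<open>p\<close>, and since \<open>p\<close> is polynomial, the balance spreads to all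
  \<open>x\<close>.
\<close>

lemma cycle_identity:
  fixes p :: "'a::euclidean_space \<Rightarrow> real" and A B :: "'a \<Rightarrow> real"
  assumes p: "real_polynomial_function p" and W: "W \<in> sets borel" "emeasure lborel W > 0"
    and fact: "\<And>x. x \<in> W \<Longrightarrow> \<bar>p x\<bar> * A x = B x \<and> A x \<noteq> 0"
  obtains R \<delta> where "\<delta> > 0"
    "\<And>T T'. small_moves n R \<delta> T \<Longrightarrow> small_moves n R \<delta> T' \<Longrightarrow> balanced n T T' A \<Longrightarrow> balanced n T T' B
       \<Longrightarrow> balanced n T T' (\<lambda>x. (p x)\<^sup>2)"
proof -
  obtain R \<delta> where R: "\<delta> > 0"
    "\<forall>(I::nat set) T. finite I \<longrightarrow> card I \<le> 2 * n \<longrightarrow>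
       (\<forall>k\<in>I. expanding (T k) \<and> near_id R \<delta> (T k)) \<longrightarrow>
       {x. \<forall>k\<in>I. T k x \<in> W} \<in> sets borel \<and> emeasure lborel {x. \<forall>k\<in>I. T k x \<in> W} > 0"
    using recurrence[OF W, of "2 * n"] by blast
  have "balanced n T T' (\<lambda>x. (p x)\<^sup>2)"
    if T: "small_moves n R \<delta> T" and T': "small_moves n R \<delta> T'"
      and A: "balanced n T T' A" and B: "balanced n T T' B" for T T'
    unfolding balanced_def
  proof
    fix x0
    define TT where "TT k = (if k < n then T k else T' (k - n))" for k
    define S where "S = {x. \<forall>k\<in>{..<2*n}. TT k x \<in> W}"
    have S: "S \<in> sets borel" "emeasure lborel S > 0"
      using R(2)[rule_format, of "{..<2*n}" TT] T T' unfolding S_def by (auto simp: TT_def small_moves_def)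
    have inW: "T k x \<in> W" "T' k x \<in> W" if "x \<in> S" "k < n" for x k
    proof -
      have "TT k x \<in> W" "TT (n + k) x \<in> W" using that by (auto simp: S_def)
      then show "T k x \<in> W" "T' k x \<in> W" using that(2) by (auto simp: TT_def)
    qed
    have poly: "real_polynomial_function (\<lambda>x. (\<Prod>k<n. (p (T k x))\<^sup>2) - (\<Prod>k<n. (p (T' k x))\<^sup>2))"
      using T T' real_polynomial_function_compose[OF _ p]
      by (intro real_polynomial_function_diff real_polynomial_function_prod real_polynomial_function_power)
         (auto simp: o_def small_moves_def)
    have "(\<Prod>k<n. (p (T k x))\<^sup>2) - (\<Prod>k<n. (p (T' k x))\<^sup>2) = 0" if x: "x \<in> S" for x
    proof -
      have 1: "(\<Prod>k<n. \<bar>p (T k x)\<bar>) * (\<Prod>k<n. A (T k x)) = (\<Prod>k<n. B (T k x))"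
        unfolding prod.distrib[symmetric] using fact inW[OF x] by (intro prod.cong) auto
      have 2: "(\<Prod>k<n. \<bar>p (T' k x)\<bar>) * (\<Prod>k<n. A (T' k x)) = (\<Prod>k<n. B (T' k x))"
        unfolding prod.distrib[symmetric] using fact inW[OF x] by (intro prod.cong) auto
      have "(\<Prod>k<n. A (T k x)) \<noteq> 0" using fact inW[OF x] by auto
      then have "(\<Prod>k<n. \<bar>p (T k x)\<bar>) = (\<Prod>k<n. \<bar>p (T' k x)\<bar>)"
        using 1 2 A B unfolding balanced_def by (metis mult_right_cancel)
      then have "(\<Prod>k<n. \<bar>p (T k x)\<bar>)\<^sup>2 = (\<Prod>k<n. \<bar>p (T' k x)\<bar>)\<^sup>2" by simp
      then show ?thesis by (simp only: prod_power_distrib power2_abs diff_self)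
    qed
    from real_polynomial_function_eq_0_if_positive_measure[OF poly S this]
    show "(\<Prod>k<n. (p (T k x0))\<^sup>2) = (\<Prod>k<n. (p (T' k x0))\<^sup>2)" by simp
  qed
  then show thesis using that R(1) by blast
qed

section \<open>Integrating out one coordinate\<close>

definition upd :: "'a ^ 'v \<Rightarrow> 'v \<Rightarrow> 'a \<Rightarrow> 'a ^ 'v" where
  "upd v i t = (\<chi> a. if a = i then t else v $ a)"

lemma upd_nth [simp]: "upd v i t $ a = (if a = i then t else v $ a)"
  by (simp add: upd_def)

lemma upd_upd [simp]: "upd (upd v i s) i t = upd v i t"
  by (simp add: vec_eq_iff)

lemma upd_commute: "i \<noteq> j \<Longrightarrow> upd (upd v i s) j t = upd (upd v j t) i s"
  by (auto simp: vec_eq_iff)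

lemma continuous_upd: "continuous_on UNIV (\<lambda>(t, v). upd v i (t :: complex))"
  unfolding upd_def case_prod_beta
proof (intro continuous_on_vec_lambda)
  show "continuous_on UNIV (\<lambda>x :: complex \<times> (complex ^ 'a). if a = i then fst x else snd x $ a)" for a
    by (cases "a = i") (auto intro!: continuous_intros)
qed

lemma measurable_upd [measurable (raw)]:
  assumes "f \<in> borel_measurable M" "g \<in> borel_measurable M"
  shows "(\<lambda>x. upd (g x) i (f x :: complex)) \<in> borel_measurable (M :: 'z measure)"
  using borel_measurable_continuous_Pair[OF assms, of "\<lambda>t v. upd v i t"] continuous_upd[of i]
  by (simp add: case_prod_beta')

lemma measurable_vec_nth [measurable]: "(\<lambda>v :: complex ^ 'v. v $ i) \<in> borel_measurable borel"
  by (intro borel_measurable_continuous_onI continuous_intros)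

definition free_of :: "'v \<Rightarrow> (complex ^ 'v \<Rightarrow> 'b) \<Rightarrow> bool" where
  "free_of i h \<longleftrightarrow> (\<forall>v t. h (upd v i t) = h v)"

definition marg :: "'v \<Rightarrow> (complex ^ 'v \<Rightarrow> ennreal) \<Rightarrow> complex ^ 'v::finite \<Rightarrow> ennreal" where
  "marg i g v = (\<integral>\<^sup>+t. g (upd v i t) \<partial>lborel)"

text \<open>
  A probability density on the complex plane. Integrating a coordinate out yields a function on the
  same vector space that ignores this coordinate; the weight makes integrals of such functions
  finite again and stands in for a decomposition of the space into two factors.
\<close>

definition unit_weight :: "complex \<Rightarrow> ennreal" where
  "unit_weight = indicator (cbox 0 One)"

lemma nn_integral_unit_weight: "(\<integral>\<^sup>+t. unit_weight t \<partial>lborel) = 1"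
  by (simp add: unit_weight_def emeasure_lborel_cbox_eq inner_sum_left inner_Basis)

lemma measurable_unit_weight [measurable]: "unit_weight \<in> borel_measurable borel"
  by (simp add: unit_weight_def)

lemma measurable_marg [measurable]:
  assumes [measurable]: "g \<in> borel_measurable borel"
  shows "marg i g \<in> borel_measurable borel"
proof -
  have "(\<lambda>v. \<integral>\<^sup>+t. g (upd v i t) \<partial>lborel) \<in> borel_measurable borel"
    by measurable
  then show ?thesis by (simp add: marg_def[abs_def])
qed

lemma free_of_marg_self: "free_of i (marg i g)"
  by (simp add: free_of_def marg_def)

lemma free_of_marg: "free_of j g \<Longrightarrow> free_of j (marg i g)"
  by (cases "i = j") (auto simp: free_of_def marg_def upd_commute)

lemma marg_mult_free:
  assumes [measurable]: "g \<in> borel_measurable borel" and h: "free_of i h"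
  shows "marg i (\<lambda>v. g v * h v) v = marg i g v * h v"
  unfolding marg_def using h by (subst nn_integral_multc[symmetric]) (auto simp: free_of_def)

text \<open>
  Introduce a further coordinate \<open>s\<close> with weight \<open>unit_weight\<close> and
  exchange it with the coordinate \<open>i\<close>. The exchange is a linear isometry, so it
  preserves Lebesgue measure, and Fubini does the rest.
\<close>

lemma nn_integral_marg:
  fixes g :: "complex ^ 'v::finite \<Rightarrow> ennreal"
  assumes [measurable]: "g \<in> borel_measurable borel"
  shows "(\<integral>\<^sup>+v. g v \<partial>lborel) = (\<integral>\<^sup>+v. marg i g v * unit_weight (v $ i) \<partial>lborel)"
proof -
  let ?\<sigma> = "(\<lambda>(t, v). (v $ i, upd v i t)) :: complex \<times> (complex ^ 'v) \<Rightarrow> complex \<times> (complex ^ 'v)"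
  have lin: "linear ?\<sigma>"
    by (auto intro!: linearI simp: vec_eq_iff)
  have iso: "norm (?\<sigma> x) = norm x" for x
  proof -
    obtain t v where x: "x = (t, v)" by (cases x)
    have s: "(norm w)\<^sup>2 = (cmod (w $ i))\<^sup>2 + (\<Sum>a\<in>UNIV - {i}. (cmod (w $ a))\<^sup>2)" for w :: "complex ^ 'v"
    proof -
      have "(norm w)\<^sup>2 = (\<Sum>a\<in>UNIV. (cmod (w $ a))\<^sup>2)"
        by (simp add: norm_vec_def L2_set_def sum_nonneg)
      then show ?thesis by (simp add: sum.remove[of UNIV i])
    qed
    have "(norm (?\<sigma> x))\<^sup>2 = (norm x)\<^sup>2"
      unfolding x by (simp add: norm_Pair s[of v] s[of "upd v i t"] add.left_commute cong: sum.cong_simp)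
    then show ?thesis by simp
  qed
  have \<sigma>m [measurable]: "?\<sigma> \<in> borel \<rightarrow>\<^sub>M borel"
    unfolding borel_prod[symmetric] by measurable
  define G where "G = (\<lambda>(s, x). unit_weight s * g x :: ennreal)"
  have Gm: "G \<in> borel_measurable (borel :: (complex \<times> (complex ^ 'v)) measure)"
    unfolding G_def borel_prod[symmetric] by measurable
  have "(\<integral>\<^sup>+v. g v \<partial>lborel) = (\<integral>\<^sup>+s. unit_weight s * (\<integral>\<^sup>+x. g x \<partial>lborel) \<partial>lborel)"
    by (simp add: nn_integral_multc nn_integral_unit_weight)
  also have "\<dots> = (\<integral>\<^sup>+s. (\<integral>\<^sup>+x. G (s, x) \<partial>lborel) \<partial>lborel)"
    by (simp add: G_def nn_integral_cmult)
  also have "\<dots> = (\<integral>\<^sup>+z. G z \<partial>(lborel \<Otimes>\<^sub>M lborel))"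
    using Gm by (intro lborel.nn_integral_fst) (simp add: lborel_prod)
  also have "\<dots> = (\<integral>\<^sup>+z. G z \<partial>lborel)" by (simp add: lborel_prod)
  also have "\<dots> = (\<integral>\<^sup>+z. G z \<partial>(distr lborel borel ?\<sigma>))"
    using distr_lborel_isometry[OF lin iso] by simp
  also have "\<dots> = (\<integral>\<^sup>+z. G (?\<sigma> z) \<partial>lborel)"
    using Gm by (subst nn_integral_distr) auto
  also have "\<dots> = (\<integral>\<^sup>+z. G (?\<sigma> z) \<partial>(lborel \<Otimes>\<^sub>M lborel))" by (simp add: lborel_prod)
  also have "\<dots> = (\<integral>\<^sup>+v. (\<integral>\<^sup>+t. G (?\<sigma> (t, v)) \<partial>lborel) \<partial>lborel)"
  proof -
    have "(\<lambda>z. G (?\<sigma> z)) \<in> borel_measurable (lborel \<Otimes>\<^sub>M lborel)"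
      using measurable_compose[OF \<sigma>m Gm] by (simp add: lborel_prod)
    then show ?thesis by (rule lborel_pair.nn_integral_snd[symmetric])
  qed
  also have "\<dots> = (\<integral>\<^sup>+v. marg i g v * unit_weight (v $ i) \<partial>lborel)"
    by (simp add: G_def marg_def nn_integral_cmult mult.commute)
  finally show ?thesis .
qed

lemma nn_integral_marg_mult:
  fixes g :: "complex ^ 'v::finite \<Rightarrow> ennreal"
  assumes [measurable]: "g \<in> borel_measurable borel" "h \<in> borel_measurable borel" and h: "free_of i h"
  shows "(\<integral>\<^sup>+v. g v * h v \<partial>lborel) = (\<integral>\<^sup>+v. marg i g v * h v * unit_weight (v $ i) \<partial>lborel)"
  by (subst nn_integral_marg[of _ i]) (auto simp: marg_mult_free[OF assms(1) h])

lemma free_of_mult: "free_of i g \<Longrightarrow> free_of i h \<Longrightarrow> free_of i (\<lambda>v. g v * h v)"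
  by (simp add: free_of_def)

lemma free_of_nth: "i \<noteq> j \<Longrightarrow> free_of i (\<lambda>v. h (v $ j))"
  by (simp add: free_of_def)

section \<open>Conditional independence factorises the density\<close>

locale density_vector = prob_space M for M :: "'w measure" +
  fixes V :: "'w \<Rightarrow> complex ^ 'v::finite" and p :: "complex ^ 'v \<Rightarrow> ennreal"
  assumes dist: "distributed M lborel V p"
begin

lemma p_meas [measurable]: "p \<in> borel_measurable borel"
  using dist by (simp add: distributed_def)

lemma V_meas [measurable]: "V \<in> M \<rightarrow>\<^sub>M borel"
  using dist by (simp add: distributed_def)

lemma law:
  assumes [measurable]: "h \<in> borel_measurable borel"
  shows "(\<integral>\<^sup>+\<omega>. h (V \<omega>) \<partial>M) = (\<integral>\<^sup>+v. p v * h v \<partial>lborel)"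
  using distributed_nn_integral[OF dist, of h] by simp

lemma total: "(\<integral>\<^sup>+v. p v \<partial>lborel) = 1"
  using law[of "\<lambda>_. 1"] by (simp add: emeasure_space_1)

abbreviation "restr S \<equiv> (\<lambda>\<omega>. \<lambda>k\<in>S. V \<omega> $ k)"

lemma restr_meas [measurable]: "restr S \<in> M \<rightarrow>\<^sub>M PiM S (\<lambda>_. borel)"
  by (intro measurable_restrict) measurable

lemma restr_space: "restr S \<in> space M \<rightarrow> space (PiM S (\<lambda>_. borel))"
  using measurable_space[OF restr_meas] by blast

lemma sigma_gen_subalgebra: "subalgebra M (sigma_gen M V S)"
  unfolding sigma_gen_def subalgebra_def
  using measurable_sets[OF restr_meas[of S]] by (auto simp: sets_vimage_algebra2[OF restr_space])

lemma subalg_locale: "sigma_finite_subalgebra M (sigma_gen M V S)"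
proof -
  interpret finite_measure_subalgebra M "sigma_gen M V S"
    by unfold_locales (rule sigma_gen_subalgebra)
  show ?thesis by unfold_locales
qed

text \<open>
  Events of the generated algebra are the Borel conditions on the selected coordinates; this and the
  next lemma are the dictionary between conditional expectations and integrals against the density.
\<close>

lemma sigma_gen_event:
  assumes "C \<in> sets (sigma_gen M V S)"
  obtains H where "H \<in> borel_measurable borel" "\<And>k. k \<notin> S \<Longrightarrow> free_of k H"
    "\<And>\<omega>. \<omega> \<in> space M \<Longrightarrow> indicator C \<omega> = (H (V \<omega>) :: ennreal)" "range H \<subseteq> {0, 1}"
proof -
  obtain B where B: "B \<in> sets (PiM S (\<lambda>_. borel))" "C = restr S -` B \<inter> space M"
    using assms by (auto simp: sigma_gen_def sets_vimage_algebra2[OF restr_space])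
  define H :: "complex ^ 'v \<Rightarrow> ennreal" where "H v = indicator B (\<lambda>k\<in>S. v $ k)" for v
  have "(\<lambda>v :: complex ^ 'v. \<lambda>k\<in>S. v $ k) \<in> borel \<rightarrow>\<^sub>M PiM S (\<lambda>_. borel)"
    by (intro measurable_restrict) measurable
  then have Hm: "H \<in> borel_measurable borel"
    unfolding H_def using B(1) by measurable
  have fr: "free_of k H" if "k \<notin> S" for k
  proof -
    have "(\<lambda>a\<in>S. upd v k t $ a) = (\<lambda>a\<in>S. v $ a)" for v :: "complex ^ 'v" and t
      using that by (auto simp: fun_eq_iff)
    then show ?thesis by (simp add: free_of_def H_def)
  qed
  have "indicator C \<omega> = H (V \<omega>)" if "\<omega> \<in> space M" for \<omega>
    using that by (simp add: H_def B(2) indicator_def)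
  moreover have "range H \<subseteq> {0, 1}" by (auto simp: H_def indicator_def)
  ultimately show ?thesis using that[OF Hm fr] by blast
qed

lemma sigma_gen_measurable:
  assumes [measurable]: "h \<in> borel_measurable borel" and free: "\<And>k. k \<notin> S \<Longrightarrow> free_of k h"
  shows "(\<lambda>\<omega>. h (V \<omega>) :: real) \<in> borel_measurable (sigma_gen M V S)"
proof -
  define ext :: "('v \<Rightarrow> complex) \<Rightarrow> complex ^ 'v" where "ext f = (\<chi> k. if k \<in> S then f k else 0)" for f
  have ext_meas: "ext \<in> PiM S (\<lambda>_. borel) \<rightarrow>\<^sub>M borel"
  proof (subst borel_measurable_euclidean_space, intro ballI)
    fix b :: "complex ^ 'v" assume "b \<in> Basis"
    then obtain k c where b: "b = axis k c" by (auto simp: Basis_vec_def)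
    show "(\<lambda>f. ext f \<bullet> b) \<in> borel_measurable (PiM S (\<lambda>_. borel))"
      unfolding b axis_inner_complex ext_def by (cases "k \<in> S") auto
  qed
  have zero_out: "h (\<chi> k. if k \<in> S then v $ k else 0) = h v" for v
  proof -
    have "h (\<chi> k. if k \<in> T then 0 else v $ k) = h v" if "finite T" "T \<inter> S = {}" for T
      using that
    proof (induction T rule: finite_induct)
      case empty
      then show ?case by simp
    next
      case (insert x T)
      have "(\<chi> k. if k \<in> insert x T then 0 else v $ k) = upd (\<chi> k. if k \<in> T then 0 else v $ k) x 0"
        by (auto simp: vec_eq_iff)
      then show ?case using insert free[of x] by (auto simp: free_of_def)
    qed
    from this[of "- S"] have "h (\<chi> k. if k \<in> - S then 0 else v $ k) = h v" by simp
    moreover have "(\<chi> k. if k \<in> - S then 0 else v $ k) = (\<chi> k. if k \<in> S then v $ k else 0)"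
      by (simp add: vec_eq_iff)
    ultimately show ?thesis by simp
  qed
  have "(\<lambda>f. h (ext f)) \<in> borel_measurable (PiM S (\<lambda>_. borel))"
    using ext_meas by measurable
  moreover have "restr S \<in> sigma_gen M V S \<rightarrow>\<^sub>M PiM S (\<lambda>_. borel)"
    unfolding sigma_gen_def by (rule measurable_vimage_algebra1[OF restr_space])
  ultimately have "(\<lambda>\<omega>. h (ext (restr S \<omega>))) \<in> borel_measurable (sigma_gen M V S)"
    by (rule measurable_compose[rotated])
  moreover have "h (ext (restr S \<omega>)) = h (V \<omega>)" for \<omega>
  proof -
    have "ext (restr S \<omega>) = (\<chi> k. if k \<in> S then V \<omega> $ k else 0)" by (simp add: ext_def cong: if_cong)
    then show ?thesis by (simp add: zero_out)
  qed
  ultimately show ?thesis by simp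
qed

end

context density_vector
begin

context
  fixes i j :: 'v assumes ij: "i \<noteq> j"
begin

abbreviation "r_ij \<equiv> marg j p"
abbreviation "q_ij \<equiv> marg i p"
abbreviation "m_ij \<equiv> marg i (marg j p)"

lemma rqm_free: "free_of j r_ij" "free_of i q_ij" "free_of i m_ij" "free_of j m_ij"
  by (auto simp: free_of_marg_self free_of_marg)

text \<open>
  The conditional probability that coordinate \<open>i\<close> lies in \<open>A\<close>, given all
  coordinates except \<open>i\<close> and \<open>j\<close>, as a function of the vector. Where the
  marginal \<open>m_ij\<close> is \<open>0\<close> or \<open>\<infinity>\<close> the quotient is at
  most \<open>1\<close> anyway.
\<close>

definition cond_mass :: "complex set \<Rightarrow> complex ^ 'v \<Rightarrow> ennreal" where
  "cond_mass A v = marg i (\<lambda>v. r_ij v * indicator A (v $ i)) v / m_ij v"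

lemma cond_mass_meas [measurable]:
  assumes [measurable]: "A \<in> sets borel"
  shows "cond_mass A \<in> borel_measurable borel"
  unfolding cond_mass_def[abs_def] by measurable

lemma cond_mass_free:
  assumes "k = i \<or> k = j" shows "free_of k (cond_mass A)"
proof -
  have "free_of k (marg i (\<lambda>v. r_ij v * indicator A (v $ i)))"
    using assms
  proof
    assume "k = i" then show ?thesis by (simp add: free_of_marg_self)
  next
    assume k: "k = j"
    have "free_of j (\<lambda>v. r_ij v * indicator A (v $ i) :: ennreal)"
      using ij by (intro free_of_mult free_of_nth free_of_marg_self) auto
    then show ?thesis unfolding k by (rule free_of_marg)
  qed
  moreover have "free_of k m_ij" using assms rqm_free by auto
  ultimately show ?thesis by (simp add: free_of_def cond_mass_def)
qed

lemma marg_le: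
  assumes [measurable]: "A \<in> sets borel"
  shows "marg i (\<lambda>v. r_ij v * indicator A (v $ i)) v \<le> m_ij v"
  unfolding marg_def[of i]
  by (intro nn_integral_mono) (auto simp: indicator_def)

lemma cond_mass_le_1:
  assumes "A \<in> sets borel" shows "cond_mass A v \<le> 1"
proof (cases "m_ij v = 0 \<or> m_ij v = \<infinity>")
  case True
  then show ?thesis
    using marg_le[OF assms, of v] by (auto simp: cond_mass_def ennreal_divide_zero divide_ennreal_def)
next
  case False
  have "cond_mass A v \<le> m_ij v / m_ij v" unfolding cond_mass_def by (intro divide_right_mono_ennreal marg_le[OF assms])
  also have "\<dots> = 1" using False by (intro ennreal_divide_self) (auto simp: less_top)
  finally show ?thesis .
qed

lemma m_finite: "AE v in lborel. m_ij v * unit_weight (v $ j) * unit_weight (v $ i) \<noteq> \<infinity>"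
proof -
  have "(\<integral>\<^sup>+v. m_ij v * unit_weight (v $ j) * unit_weight (v $ i) \<partial>lborel)
     = (\<integral>\<^sup>+v. r_ij v * unit_weight (v $ j) \<partial>lborel)"
    by (rule nn_integral_marg_mult[symmetric]) (use ij in \<open>auto intro: free_of_nth\<close>)
  also have "\<dots> = 1" unfolding nn_integral_marg[OF p_meas, symmetric] by (rule total)
  finally show ?thesis by (intro nn_integral_noteq_infinite) auto
qed

lemma m_cond_mass:
  assumes "A \<in> sets borel" "m_ij v \<noteq> \<infinity>"
  shows "m_ij v * cond_mass A v = marg i (\<lambda>v. r_ij v * indicator A (v $ i)) v"
proof (cases "m_ij v = 0")
  case True
  then show ?thesis using marg_le[OF assms(1), of v] by simp
next
  case False
  then show ?thesis using assms(2) unfolding cond_mass_def ennreal_times_divide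
    by (subst mult.commute) (rule mult_divide_eq_ennreal, auto)
qed

text \<open>
  Integrating out \<open>j\<close> and then \<open>i\<close> produces the numerator of
  \<open>cond_mass\<close>; replacing it by \<open>m_ij\<close> times the quotient and going back
  produces the right-hand side. The replacement is legitimate because \<open>m_ij\<close> is finite
  almost everywhere on the support of the weights.
\<close>

lemma cond_mass_integral:
  assumes A [measurable]: "A \<in> sets borel" and H [measurable]: "H \<in> borel_measurable borel"
    and Hf: "free_of i H" "free_of j H"
  shows "(\<integral>\<^sup>+\<omega>. indicator A (V \<omega> $ i) * H (V \<omega>) \<partial>M) = (\<integral>\<^sup>+\<omega>. cond_mass A (V \<omega>) * H (V \<omega>) \<partial>M)"
proof -
  let ?w = "\<lambda>v :: complex ^ 'v. unit_weight (v $ j)"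
  have "(\<integral>\<^sup>+\<omega>. indicator A (V \<omega> $ i) * H (V \<omega>) \<partial>M)
     = (\<integral>\<^sup>+v. p v * (indicator A (v $ i) * H v) \<partial>lborel)"
    by (rule law) measurable
  also have "\<dots> = (\<integral>\<^sup>+v. r_ij v * (indicator A (v $ i) * H v) * ?w v \<partial>lborel)"
    by (rule nn_integral_marg_mult) (auto intro!: free_of_mult free_of_nth Hf ij[symmetric])
  also have "\<dots> = (\<integral>\<^sup>+v. (r_ij v * indicator A (v $ i)) * (H v * ?w v) \<partial>lborel)"
    by (simp add: mult_ac)
  also have "\<dots> = (\<integral>\<^sup>+v. marg i (\<lambda>v. r_ij v * indicator A (v $ i)) v * (H v * ?w v) * unit_weight (v $ i) \<partial>lborel)"
    by (rule nn_integral_marg_mult) (auto intro!: free_of_mult free_of_nth Hf ij)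
  also have "\<dots> = (\<integral>\<^sup>+v. m_ij v * (cond_mass A v * H v * ?w v) * unit_weight (v $ i) \<partial>lborel)"
  proof (rule nn_integral_cong_AE)
    show "AE v in lborel. marg i (\<lambda>v. r_ij v * indicator A (v $ i)) v * (H v * ?w v) * unit_weight (v $ i)
      = m_ij v * (cond_mass A v * H v * ?w v) * unit_weight (v $ i)"
      using m_finite
    proof eventually_elim
      case (elim v)
      show ?case
      proof (cases "m_ij v = \<infinity>")
        case True
        then have "?w v * unit_weight (v $ i) = 0"
          using elim by (auto simp: ennreal_top_mult mult.assoc split: if_splits)
        then have "?w v = 0 \<or> unit_weight (v $ i) = 0" by simp
        then show ?thesis by auto
      next
        case False
        then show ?thesis by (simp add: m_cond_mass[OF A, symmetric] mult_ac)
      qed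
    qed
  qed
  also have "\<dots> = (\<integral>\<^sup>+v. r_ij v * (cond_mass A v * H v * ?w v) \<partial>lborel)"
    by (rule nn_integral_marg_mult[symmetric]) (auto intro!: free_of_mult free_of_nth Hf ij cond_mass_free)
  also have "\<dots> = (\<integral>\<^sup>+v. r_ij v * (cond_mass A v * H v) * ?w v \<partial>lborel)"
    by (simp add: mult_ac)
  also have "\<dots> = (\<integral>\<^sup>+v. p v * (cond_mass A v * H v) \<partial>lborel)"
    by (rule nn_integral_marg_mult[symmetric]) (auto intro!: free_of_mult Hf cond_mass_free)
  also have "\<dots> = (\<integral>\<^sup>+\<omega>. cond_mass A (V \<omega>) * H (V \<omega>) \<partial>M)"
    by (rule law[symmetric]) measurable
  finally show ?thesis .
qed

text \<open>
  An event of the generated algebra has an indicator that ignores both coordinates, and for such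
  functions \<open>cond_mass_integral\<close> is the identity that characterises a conditional
  expectation.
\<close>

lemma cond_prob_rest:
  assumes A [measurable]: "A \<in> sets borel"
  shows "AE \<omega> in M. cond_prob M V i (UNIV - {i, j}) A \<omega> = enn2real (cond_mass A (V \<omega>))"
proof -
  let ?S = "UNIV - {i, j}" and ?f = "indicator {\<omega> \<in> space M. V \<omega> $ i \<in> A} :: 'w \<Rightarrow> real"
  let ?g = "\<lambda>\<omega>. enn2real (cond_mass A (V \<omega>))"
  interpret sigma_finite_subalgebra M "sigma_gen M V ?S" by (rule subalg_locale)
  have Am: "{\<omega> \<in> space M. V \<omega> $ i \<in> A} \<in> sets M" by measurable
  have le1: "enn2real (cond_mass A v) \<le> 1" for v
    using cond_mass_le_1[OF A, of v] by (metis enn2real_1 enn2real_mono ennreal_one_less_top)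
  have ekap: "ennreal (enn2real (cond_mass A v)) = cond_mass A v" for v
    using cond_mass_le_1[OF A, of v] by (simp add: less_top order_le_less_trans[OF _ ennreal_one_less_top])
  have intf: "integrable M ?f" by (rule integrable_const_bound[of _ 1]) (use Am in auto)
  have intg: "integrable M ?g"
    by (rule integrable_const_bound[of _ 1]) (auto simp: le1)
  have "AE \<omega> in M. real_cond_exp M (sigma_gen M V ?S) ?f \<omega> = ?g \<omega>"
  proof (rule real_cond_exp_charact)
    show "?g \<in> borel_measurable (sigma_gen M V ?S)"
    proof (rule sigma_gen_measurable)
      show "free_of k (\<lambda>v. enn2real (cond_mass A v))" if "k \<notin> ?S" for k
        using cond_mass_free[of k A] that by (auto simp: free_of_def)
    qed measurable
    fix C assume C: "C \<in> sets (sigma_gen M V ?S)"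
    then obtain H where H: "H \<in> borel_measurable borel" "\<And>k. k \<notin> ?S \<Longrightarrow> free_of k H"
      "\<And>\<omega>. \<omega> \<in> space M \<Longrightarrow> indicator C \<omega> = (H (V \<omega>) :: ennreal)" "range H \<subseteq> {0, 1}"
      by (rule sigma_gen_event) (rule that)
    have Cm: "C \<in> sets M" using C sigma_gen_subalgebra[of ?S] by (auto simp: subalgebra_def)
    have "(\<integral>\<omega>\<in>C. ?f \<omega> \<partial>M) = enn2real (\<integral>\<^sup>+\<omega>. ennreal (indicator C \<omega> * ?f \<omega>) \<partial>M)"
      unfolding set_lebesgue_integral_def using Cm Am by (subst integral_eq_nn_integral) auto
    also have "(\<integral>\<^sup>+\<omega>. ennreal (indicator C \<omega> * ?f \<omega>) \<partial>M) = (\<integral>\<^sup>+\<omega>. indicator A (V \<omega> $ i) * H (V \<omega>) \<partial>M)"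
      by (intro nn_integral_cong) (auto simp: H(3)[symmetric] indicator_def)
    also have "\<dots> = (\<integral>\<^sup>+\<omega>. cond_mass A (V \<omega>) * H (V \<omega>) \<partial>M)"
      using H(2) by (intro cond_mass_integral[OF A H(1)]) auto
    also have "\<dots> = (\<integral>\<^sup>+\<omega>. ennreal (indicator C \<omega> * ?g \<omega>) \<partial>M)"
      by (intro nn_integral_cong) (auto simp: H(3)[symmetric] ekap indicator_def)
    also have "enn2real \<dots> = (\<integral>\<omega>\<in>C. ?g \<omega> \<partial>M)"
      unfolding set_lebesgue_integral_def using Cm by (subst integral_eq_nn_integral) auto
    finally show "(\<integral>\<omega>\<in>C. ?f \<omega> \<partial>M) = (\<integral>\<omega>\<in>C. ?g \<omega> \<partial>M)" .
  qed (use intf intg in auto)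
  then show ?thesis by (simp add: cond_prob_def)
qed

text \<open>
  Shielding is used twice, with all coordinates but \<open>i\<close> and with all coordinates but
  \<open>i\<close> and \<open>j\<close>: the two conditional probabilities agree with the one given
  \<open>N\<close>, hence with each other, so that \<open>V\<^sub>j\<close> carries no further
  information about \<open>V\<^sub>i\<close>.
\<close>

lemma shields_rectangle:
  assumes sh: "shields M V i N" and j: "j \<notin> N"
    and A [measurable]: "A \<in> sets borel" and B: "\<And>k. B k \<in> sets (borel :: complex measure)"
  shows "(\<integral>\<^sup>+v. p v * (indicator A (v $ i) * indicator {v. \<forall>k. k \<noteq> i \<longrightarrow> v $ k \<in> B k} v) \<partial>lborel)
     = (\<integral>\<^sup>+v. p v * (cond_mass A v * indicator {v. \<forall>k. k \<noteq> i \<longrightarrow> v $ k \<in> B k} v) \<partial>lborel)"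
proof -
  let ?S = "UNIV - {i}" and ?f = "indicator {\<omega> \<in> space M. V \<omega> $ i \<in> A} :: 'w \<Rightarrow> real"
  let ?R = "{v. \<forall>k. k \<noteq> i \<longrightarrow> v $ k \<in> B k}"
  interpret sigma_finite_subalgebra M "sigma_gen M V ?S" by (rule subalg_locale)
  have iN: "i \<notin> N" using sh by (simp add: shields_def)
  have hyp: "AE \<omega> in M. cond_prob M V i (N \<union> C) A \<omega> = cond_prob M V i N A \<omega>" if "C \<inter> ({i} \<union> N) = {}" for C
    using sh A that unfolding shields_def by blast
  have sets: "N \<union> (UNIV - N - {i}) = ?S" "N \<union> (UNIV - N - {i, j}) = UNIV - {i, j}"
    using iN j by auto
  have 1: "AE \<omega> in M. cond_prob M V i ?S A \<omega> = cond_prob M V i N A \<omega>"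
    using hyp[of "UNIV - N - {i}"] unfolding sets by blast
  have 2: "AE \<omega> in M. cond_prob M V i (UNIV - {i, j}) A \<omega> = cond_prob M V i N A \<omega>"
    using hyp[of "UNIV - N - {i, j}"] unfolding sets by blast
  have ae: "AE \<omega> in M. cond_prob M V i ?S A \<omega> = enn2real (cond_mass A (V \<omega>))"
    using 1 2 cond_prob_rest[OF A] by eventually_elim simp
  have Am: "{\<omega> \<in> space M. V \<omega> $ i \<in> A} \<in> sets M" by measurable
  have le1: "enn2real (cond_mass A v) \<le> 1" for v
    using cond_mass_le_1[OF A, of v] by (metis enn2real_1 enn2real_mono ennreal_one_less_top)
  have ekap: "ennreal (enn2real (cond_mass A v)) = cond_mass A v" for v
    using cond_mass_le_1[OF A, of v] by (simp add: less_top order_le_less_trans[OF _ ennreal_one_less_top])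
  have intf: "integrable M ?f" by (rule integrable_const_bound[of _ 1]) (use Am in auto)
  have Rm [measurable]: "?R \<in> sets borel"
  proof -
    have "?R = (\<Inter>k\<in>UNIV - {i}. (\<lambda>v. v $ k) -` B k)" by auto
    also have "\<dots> \<in> sets borel"
      using ij by (intro sets.finite_INT measurable_sets_borel[OF measurable_vec_nth B]) auto
    finally show ?thesis .
  qed
  define C where "C = V -` ?R \<inter> space M"
  have C: "C \<in> sets (sigma_gen M V ?S)"
  proof -
    have "PiE ?S B \<in> sets (PiM ?S (\<lambda>_. borel))" using B by (intro sets_PiM_I_finite) auto
    moreover have "restr ?S \<omega> \<in> PiE ?S B \<longleftrightarrow> V \<omega> \<in> ?R" for \<omega>
      by (simp add: restrict_PiE_iff Pi_iff Ball_def)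
    then have "C = restr ?S -` PiE ?S B \<inter> space M" by (simp only: C_def vimage_def mem_Collect_eq)
    ultimately show ?thesis unfolding sigma_gen_def sets_vimage_algebra2[OF restr_space] by blast
  qed
  have Cm: "C \<in> sets M" using C sigma_gen_subalgebra[of ?S] by (auto simp: subalgebra_def)
  have "(\<integral>\<omega>\<in>C. ?f \<omega> \<partial>M) = (\<integral>\<omega>\<in>C. cond_prob M V i ?S A \<omega> \<partial>M)"
    unfolding cond_prob_def by (rule real_cond_exp_intA[OF intf C])
  also have "\<dots> = (\<integral>\<omega>\<in>C. enn2real (cond_mass A (V \<omega>)) \<partial>M)"
    using ae Cm unfolding cond_prob_def by (intro set_lebesgue_integral_cong_AE) auto
  finally have eq: "(\<integral>\<omega>\<in>C. ?f \<omega> \<partial>M) = (\<integral>\<omega>\<in>C. enn2real (cond_mass A (V \<omega>)) \<partial>M)" .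
  have 1: "ennreal (\<integral>\<omega>\<in>C. ?f \<omega> \<partial>M) = (\<integral>\<^sup>+\<omega>. ennreal (indicator C \<omega> * ?f \<omega>) \<partial>M)"
    unfolding set_lebesgue_integral_def real_scaleR_def
    using integrable_mult_indicator[OF Cm intf]
    by (intro nn_integral_eq_integral[symmetric]) auto
  have 2: "ennreal (\<integral>\<omega>\<in>C. enn2real (cond_mass A (V \<omega>)) \<partial>M) = (\<integral>\<^sup>+\<omega>. ennreal (indicator C \<omega> * enn2real (cond_mass A (V \<omega>))) \<partial>M)"
    unfolding set_lebesgue_integral_def real_scaleR_def using Cm
    by (intro nn_integral_eq_integral[symmetric] integrable_const_bound[of _ 1]) (auto simp: le1 indicator_def)
  have "(\<integral>\<^sup>+v. p v * (indicator A (v $ i) * indicator ?R v) \<partial>lborel)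
     = (\<integral>\<^sup>+\<omega>. indicator A (V \<omega> $ i) * indicator ?R (V \<omega>) \<partial>M)"
    by (rule law[symmetric]) measurable
  also have "\<dots> = (\<integral>\<^sup>+\<omega>. ennreal (indicator C \<omega> * ?f \<omega>) \<partial>M)"
    by (intro nn_integral_cong) (auto simp: C_def indicator_def)
  also have "\<dots> = (\<integral>\<^sup>+\<omega>. ennreal (indicator C \<omega> * enn2real (cond_mass A (V \<omega>))) \<partial>M)"
    using 1 2 eq by simp
  also have "\<dots> = (\<integral>\<^sup>+\<omega>. cond_mass A (V \<omega>) * indicator ?R (V \<omega>) \<partial>M)"
    by (intro nn_integral_cong) (auto simp: C_def indicator_def ekap)
  also have "\<dots> = (\<integral>\<^sup>+v. p v * (cond_mass A v * indicator ?R v) \<partial>lborel)"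
    by (rule law) measurable
  finally show ?thesis .
qed

lemma rectangle_density:
  assumes A [measurable]: "A \<in> sets borel" and H [measurable]: "H \<in> borel_measurable borel" and Hf: "free_of i H"
  shows "(\<integral>\<^sup>+v. p v * (cond_mass A v * H v) \<partial>lborel) = (\<integral>\<^sup>+v. q_ij v * (r_ij v / m_ij v) * (indicator A (v $ i) * H v) \<partial>lborel)"
proof -
  have qm [measurable]: "(\<lambda>v. q_ij v / m_ij v) \<in> borel_measurable borel" by measurable
  have qmf: "free_of i (\<lambda>v. q_ij v / m_ij v)" using rqm_free by (simp add: free_of_def)
  have "(\<integral>\<^sup>+v. p v * (cond_mass A v * H v) \<partial>lborel) = (\<integral>\<^sup>+v. q_ij v * (cond_mass A v * H v) * unit_weight (v $ i) \<partial>lborel)"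
    by (rule nn_integral_marg_mult) (auto intro!: free_of_mult Hf cond_mass_free)
  also have "\<dots> = (\<integral>\<^sup>+v. marg i (\<lambda>v. r_ij v * indicator A (v $ i)) v * (q_ij v / m_ij v * H v) * unit_weight (v $ i) \<partial>lborel)"
    unfolding cond_mass_def by (simp add: divide_ennreal_def mult_ac)
  also have "\<dots> = (\<integral>\<^sup>+v. (r_ij v * indicator A (v $ i)) * (q_ij v / m_ij v * H v) \<partial>lborel)"
    by (rule nn_integral_marg_mult[symmetric]) (auto intro!: free_of_mult Hf qmf)
  finally show ?thesis by (simp add: divide_ennreal_def mult_ac)
qed

text \<open>
  The usual formula \<open>p(i, j, rest) = p(i, rest) * p(j, rest) / p(rest)\<close>. The measures
  with these two densities agree on boxes.
\<close>

lemma density_factorises: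
  assumes sh: "shields M V i N" and j: "j \<notin> N"
  shows "AE v in lborel. p v = q_ij v * (r_ij v / m_ij v)"
proof -
  let ?h = "\<lambda>v. q_ij v * (r_ij v / m_ij v)"
  have hm [measurable]: "?h \<in> borel_measurable borel" by measurable
  have rect: "(\<integral>\<^sup>+v\<in>box l u. p v \<partial>lborel) = (\<integral>\<^sup>+v\<in>box l u. ?h v \<partial>lborel)" for l u :: "complex ^ 'v"
  proof -
    have box: "indicator (box l u) v = (indicator (box (l $ i) (u $ i)) (v $ i)
      * indicator {v. \<forall>k. k \<noteq> i \<longrightarrow> v $ k \<in> box (l $ k) (u $ k)} v :: ennreal)" for v
    proof -
      have "v \<in> box l u \<longleftrightarrow> (\<forall>k. v $ k \<in> box (l $ k) (u $ k))"
        by (auto simp: mem_box Basis_vec_def axis_inner_complex)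
      then show ?thesis by (auto simp: indicator_def)
    qed
    let ?H = "indicator {v. \<forall>k. k \<noteq> i \<longrightarrow> v $ k \<in> box (l $ k) (u $ k)} :: complex ^ 'v \<Rightarrow> ennreal"
    have Hm: "?H \<in> borel_measurable borel"
    proof -
      have "{v. \<forall>k. k \<noteq> i \<longrightarrow> v $ k \<in> box (l $ k) (u $ k)} = (\<Inter>k\<in>UNIV - {i}. (\<lambda>v. v $ k) -` box (l $ k) (u $ k))" by auto
      also have "\<dots> \<in> sets borel"
        using ij by (intro sets.finite_INT measurable_sets_borel[OF measurable_vec_nth]) auto
      finally show ?thesis by simp
    qed
    have "(\<integral>\<^sup>+v\<in>box l u. p v \<partial>lborel) = (\<integral>\<^sup>+v. p v * (indicator (box (l $ i) (u $ i)) (v $ i) * ?H v) \<partial>lborel)"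
      by (simp add: box)
    also have "\<dots> = (\<integral>\<^sup>+v. p v * (cond_mass (box (l $ i) (u $ i)) v * ?H v) \<partial>lborel)"
      by (rule shields_rectangle[OF sh j]) auto
    also have "\<dots> = (\<integral>\<^sup>+v. ?h v * (indicator (box (l $ i) (u $ i)) (v $ i) * ?H v) \<partial>lborel)"
      by (rule rectangle_density) (use Hm in \<open>auto simp: free_of_def indicator_def\<close>)
    finally show ?thesis by (simp add: box)
  qed
  have "density lborel p = density lborel ?h"
  proof (rule measure_eqI_generator_eq)
    let ?E = "range (\<lambda>(a, b). box a b :: (complex ^ 'v) set)"
    show "Int_stable ?E" by (auto simp: Int_stable_def box_Int_box)
    show "?E \<subseteq> Pow UNIV" "sets (density lborel p) = sigma_sets UNIV ?E" "sets (density lborel ?h) = sigma_sets UNIV ?E"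
      by (simp_all add: borel_eq_box)
    let ?A = "\<lambda>n::nat. box (- (real n *\<^sub>R One)) (real n *\<^sub>R One) :: (complex ^ 'v) set"
    show "range ?A \<subseteq> ?E" "(\<Union>i. ?A i) = UNIV" unfolding UN_box_eq_UNIV by auto
    show "emeasure (density lborel p) (?A n) \<noteq> \<infinity>" for n
    proof -
      have "emeasure (density lborel p) (?A n) \<le> (\<integral>\<^sup>+v. p v \<partial>lborel)"
        by (subst emeasure_density) (auto intro!: nn_integral_mono simp: indicator_def)
      then show ?thesis using total by (auto simp: top_unique)
    qed
    show "emeasure (density lborel p) X = emeasure (density lborel ?h) X" if "X \<in> ?E" for X
      using that rect by (auto simp: emeasure_density)
  qed
  then show ?thesis
    by (intro sigma_finite_measure.density_unique[OF sigma_finite_lborel]) auto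
qed

end

lemma shields_factorisation:
  assumes "shields M V i N" "j \<notin> N" "i \<noteq> j"
  obtains \<alpha> \<beta> where "free_of j \<alpha>" "free_of i \<beta>" "AE v in lborel. p v = \<alpha> v * \<beta> v"
    "\<alpha> \<in> borel_measurable borel" "\<beta> \<in> borel_measurable borel"
proof
  show "free_of j (\<lambda>v. marg j p v / marg i (marg j p) v)"
    using rqm_free[OF assms(3)] by (simp add: free_of_def)
  show "free_of i (marg i p)" by (rule rqm_free[OF assms(3)])
  show "AE v in lborel. p v = marg j p v / marg i (marg j p) v * marg i p v"
    using density_factorises[OF assms(3,1,2)] by (simp add: mult.commute)
  show "(\<lambda>v. marg j p v / marg i (marg j p) v) \<in> borel_measurable borel" "marg i p \<in> borel_measurable borel"
    by measurable
qed

end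

section \<open>Hexagons of translations\<close>

lemma prod_six: "(\<Prod>k<6. h (k::nat)) = h 0 * h 1 * h 2 * h 3 * h 4 * (h 5 :: 'a::comm_monoid_mult)"
  by (simp add: eval_nat_numeral)

lemma expanding_translation: "expanding (\<lambda>x. x + h :: 'a::euclidean_space)"
proof -
  have "distr lborel borel (\<lambda>x. x + h) = lborel"
  proof -
    have "(\<lambda>x. x + h) = (+) h" by (auto simp: add.commute)
    then show ?thesis using lborel_distr_plus[of h] by simp
  qed
  then show ?thesis by (intro expanding_if_distr_eq) auto
qed

lemma near_id_translation: "norm h < \<delta> \<Longrightarrow> near_id R \<delta> (\<lambda>x. x + h)"
  by (simp add: near_id_def dist_norm)

lemma polynomial_function_translation: "polynomial_function (\<lambda>x. x + h)"
  by (intro polynomial_function_add polynomial_function_const polynomial_function_bounded_linear bounded_linear_ident)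

context power_grid
begin

lemma real_polynomial_function_Delta_line: "real_polynomial_function (\<lambda>t. Delta (x + t *\<^sub>R h))"
  using real_polynomial_function_compose[OF _ real_polynomial_function_Delta, of "\<lambda>t. x + t *\<^sub>R h"]
  by (simp add: o_def polynomial_function_add polynomial_function_const polynomial_function_bounded_linear
      bounded_linear_scaleR_left)

lemma F_free:
  assumes "k \<noteq> a" "Some a \<notin> nbrs k" shows "free_of a (\<lambda>V. g (F V $ k))"
proof -
  have "bus_voltage V0 (upd V a t) b = bus_voltage V0 V b" if "b \<in> nbrs k" for V t b
    using that assms(2) by (cases b) (auto simp: bus_voltage_def)
  then show ?thesis using assms(1) by (simp add: free_of_def F_nth)
qed

text \<open>
  The injection at \<open>b\<close> depends on the neighbours only through one sum of currents.
\<close>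

lemma F_eq: "F V $ b = V $ b * (Ysum b * cnj (V $ b) - (\<Sum>n\<in>nbrs b. y b n * cnj (bus_voltage V0 V n)))"
  by (simp add: F_nth Ysum_def sum_distrib_right sum_distrib_left sum_subtractf algebra_simps)

text \<open>
  The form in which the failure of minimality is refuted: on a non-null set of voltages, determinant
  times densities splits into a factor without \<open>V\<^sub>j\<close> and a factor without
  \<open>V\<^sub>i\<close>.
\<close>

definition log_separable :: "(complex ^ 'v) set \<Rightarrow> ('v \<Rightarrow> complex \<Rightarrow> real) \<Rightarrow> 'v \<Rightarrow> 'v \<Rightarrow> bool" where
  "log_separable W f i j \<longleftrightarrow> W \<in> sets borel \<and> emeasure lborel W > 0 \<and>
     (\<exists>\<alpha> \<beta>. free_of j \<alpha> \<and> free_of i \<beta> \<and>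
       (\<forall>x\<in>W. \<bar>Delta x\<bar> * (\<Prod>k\<in>UNIV. f k (F x $ k)) = \<alpha> x * \<beta> x \<and> (\<Prod>k\<in>UNIV. f k (F x $ k)) \<noteq> 0))"

lemma log_separable_sym: "log_separable W f i j \<Longrightarrow> log_separable W f j i"
  unfolding log_separable_def by (elim conjE exE) (intro conjI exI, auto simp: mult.commute)

text \<open>
  The set \<open>W\<close> consists of the voltages at which the density is positive and equal to
  the product that conditional independence provides.
\<close>

lemma shields_imp_log_separable:
  assumes M: "prob_space M" and inv: "invertible_on F D" and f: "\<And>a s. f a s \<ge> 0"
    and dens: "distributed M lborel V (\<lambda>v. ennreal (indicator D v *
              (1 / abs_J_P E z V0 D v * (\<Prod>a\<in>UNIV. f a (F v $ a)))))"
    and sh: "shields M V i N" "j \<notin> N" "i \<noteq> j"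
  shows "\<exists>W. log_separable W f i j"
proof -
  define p where "p v = ennreal (indicator D v * (1 / abs_J_P E z V0 D v * (\<Prod>a\<in>UNIV. f a (F v $ a))))" for v
  interpret density_vector M V p
    using M dens by (simp add: density_vector_def density_vector_axioms_def p_def[abs_def])
  obtain \<alpha> \<beta> where ab: "free_of j \<alpha>" "free_of i \<beta>" "AE v in lborel. p v = \<alpha> v * \<beta> v"
    and [measurable]: "\<alpha> \<in> borel_measurable borel" "\<beta> \<in> borel_measurable borel"
    by (rule shields_factorisation[OF sh]) (rule that)
  define W where "W = {v. p v > 0 \<and> p v = \<alpha> v * \<beta> v}"
  have Wm: "W \<in> sets borel"
  proof -
    have "{v \<in> space borel. p v > 0 \<and> p v = \<alpha> v * \<beta> v} \<in> sets borel" by measurable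
    then show ?thesis by (simp add: W_def)
  qed
  have Wpos: "emeasure lborel W > 0"
  proof (rule ccontr)
    assume "\<not> ?thesis"
    then have "AE v in lborel. v \<notin> W"
      using Wm by (intro AE_not_in) (auto simp: null_sets_def)
    then have "AE v in lborel. p v = 0" using ab(3) by eventually_elim (auto simp: W_def)
    then have "(\<integral>\<^sup>+v. p v \<partial>lborel) = 0" by (subst nn_integral_0_iff_AE) auto
    then show False using total by simp
  qed
  have eq: "\<bar>Delta x\<bar> * (\<Prod>k\<in>UNIV. f k (F x $ k)) = enn2real (\<alpha> x) * enn2real (\<beta> x)
      \<and> (\<Prod>k\<in>UNIV. f k (F x $ k)) \<noteq> 0" if x: "x \<in> W" for x
  proof -
    have xD: "x \<in> D" using x by (cases "x \<in> D") (auto simp: W_def p_def)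
    have px: "p x = ennreal (\<bar>Delta x\<bar> * (\<Prod>k\<in>UNIV. f k (F x $ k)))"
      using abs_J_P_eq(1)[OF inv xD] xD by (simp add: p_def)
    have nn: "0 \<le> \<bar>Delta x\<bar> * (\<Prod>k\<in>UNIV. f k (F x $ k))" by (intro mult_nonneg_nonneg prod_nonneg) (auto simp: f)
    have "enn2real (p x) = enn2real (\<alpha> x * \<beta> x)" using x by (simp add: W_def)
    then have "\<bar>Delta x\<bar> * (\<Prod>k\<in>UNIV. f k (F x $ k)) = enn2real (\<alpha> x) * enn2real (\<beta> x)"
      unfolding px using nn by (simp add: enn2real_mult)
    moreover have "(\<Prod>k\<in>UNIV. f k (F x $ k)) \<noteq> 0"
    proof
      assume z: "(\<Prod>k\<in>UNIV. f k (F x $ k)) = 0"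
      have "p x = 0" unfolding px z by simp
      then show False using x by (simp add: W_def)
    qed
    ultimately show ?thesis by blast
  qed
  have "free_of j (\<lambda>x. enn2real (\<alpha> x))" "free_of i (\<lambda>x. enn2real (\<beta> x))"
    using ab by (auto simp: free_of_def)
  then have "log_separable W f i j"
    unfolding log_separable_def using Wm Wpos eq by blast
  then show ?thesis ..
qed

text \<open>
  The voltage vector at which \<open>b\<close> has voltage \<open>u\<close> and receives the
  (conjugate) currents \<open>p\<close> from \<open>a\<close> and \<open>q\<close> from
  \<open>c\<close>. The value \<open>1\<close> elsewhere only has to be nonzero.
\<close>

definition hex_point :: "'v \<Rightarrow> 'v \<Rightarrow> 'v \<Rightarrow> complex \<Rightarrow> complex \<Rightarrow> complex \<Rightarrow> complex ^ 'v" where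
  "hex_point b a c u p q = (\<chi> k. if k = a then cnj (p / y b (Some a)) else if k = c then cnj (q / y b (Some c))
      else if k = b then u else 1)"

context
  fixes b a c :: 'v
  assumes abc: "Some a \<in> nbrs b" "Some c \<in> nbrs b" "a \<noteq> c"
    and leafs: "\<And>k. k \<noteq> b \<Longrightarrow> k \<noteq> a \<Longrightarrow> Some a \<notin> nbrs k" "Some c \<notin> nbrs a"
begin

lemma ab_ne: "a \<noteq> b" "c \<noteq> b"
  using abc(1,2) by (auto simp: nbrs_def)

text \<open>
  The displacement that raises the currents from \<open>a\<close> and \<open>c\<close> to \<open>b\<close> by \<open>p\<close> and \<open>q\<close> and the voltage of \<open>b\<close> by \<open>\<eta>\<close> is
  \<open>hex_shift p q \<eta>\<close>. The pairs \<open>(\<xi>1, \<xi>3), (\<xi>2, \<xi>1), (\<xi>3, \<xi>2)\<close> and \<open>(\<xi>2, \<xi>3), (\<xi>3, \<xi>1), (\<xi>1, \<xi>2)\<close> have the same first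
  entries, the same second entries and the same sums, so that functions of one current or of the
  total current cannot tell them apart. A function that ignores \<open>V\<^sub>b\<close> may depend on both currents; for
  such functions the two triples are used once more with exchanged roles at the second voltage of \<open>b\<close>.
\<close>

definition hex_shift :: "complex \<Rightarrow> complex \<Rightarrow> complex \<Rightarrow> complex ^ 'v" where
  "hex_shift p q \<eta> = (\<chi> k. if k = a then cnj (p / y b (Some a)) else if k = c then cnj (q / y b (Some c))
      else if k = b then \<eta> else 0)"

definition hex_left :: "complex \<Rightarrow> complex \<Rightarrow> complex \<Rightarrow> complex \<Rightarrow> (complex ^ 'v) list" where
  "hex_left \<xi>1 \<xi>2 \<xi>3 \<eta> = [hex_shift \<xi>1 \<xi>3 0, hex_shift \<xi>2 \<xi>1 0, hex_shift \<xi>3 \<xi>2 0, hex_shift \<xi>2 \<xi>3 \<eta>, hex_shift \<xi>3 \<xi>1 \<eta>, hex_shift \<xi>1 \<xi>2 \<eta>]"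

definition hex_right :: "complex \<Rightarrow> complex \<Rightarrow> complex \<Rightarrow> complex \<Rightarrow> (complex ^ 'v) list" where
  "hex_right \<xi>1 \<xi>2 \<xi>3 \<eta> = [hex_shift \<xi>2 \<xi>3 0, hex_shift \<xi>3 \<xi>1 0, hex_shift \<xi>1 \<xi>2 0, hex_shift \<xi>1 \<xi>3 \<eta>, hex_shift \<xi>2 \<xi>1 \<eta>, hex_shift \<xi>3 \<xi>2 \<eta>]"

definition hex_neutral :: "(complex ^ 'v \<Rightarrow> real) \<Rightarrow> bool" where
  "hex_neutral g \<longleftrightarrow> (\<forall>\<xi>1 \<xi>2 \<xi>3 \<eta>.
     balanced 6 (\<lambda>k x. x + hex_left \<xi>1 \<xi>2 \<xi>3 \<eta> ! k) (\<lambda>k x. x + hex_right \<xi>1 \<xi>2 \<xi>3 \<eta> ! k) g)"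

lemma hex_neutral_mult: "hex_neutral g \<Longrightarrow> hex_neutral h \<Longrightarrow> hex_neutral (\<lambda>x. g x * h x)"
  unfolding hex_neutral_def by (blast intro: balanced_mult)

lemma hex_neutral_prod: "(\<And>k. k \<in> I \<Longrightarrow> hex_neutral (g k)) \<Longrightarrow> hex_neutral (\<lambda>x. \<Prod>k\<in>I. g k x)"
  unfolding hex_neutral_def by (blast intro: balanced_prod)

text \<open>
  A function that ignores one of the three voltages sees at most two of the parameters
  \<open>p\<close>, \<open>q\<close>, \<open>\<eta>\<close>.
\<close>

lemma hex_neutral_free:
  assumes "free_of a g \<or> free_of c g \<or> free_of b g" shows "hex_neutral g"
proof -
  have a: "g (x + hex_shift p q \<eta>) = g (x + hex_shift 0 q \<eta>)" if "free_of a g" for x p q \<eta>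
  proof -
    have "x + hex_shift p q \<eta> = upd (x + hex_shift 0 q \<eta>) a ((x + hex_shift p q \<eta>) $ a)" by (auto simp: vec_eq_iff hex_shift_def)
    then show ?thesis using that by (metis free_of_def)
  qed
  have c: "g (x + hex_shift p q \<eta>) = g (x + hex_shift p 0 \<eta>)" if "free_of c g" for x p q \<eta>
  proof -
    have "x + hex_shift p q \<eta> = upd (x + hex_shift p 0 \<eta>) c ((x + hex_shift p q \<eta>) $ c)"
      using abc(3) by (auto simp: vec_eq_iff hex_shift_def)
    then show ?thesis using that by (metis free_of_def)
  qed
  have b: "g (x + hex_shift p q \<eta>) = g (x + hex_shift p q 0)" if "free_of b g" for x p q \<eta>
  proof -
    have "x + hex_shift p q \<eta> = upd (x + hex_shift p q 0) b ((x + hex_shift p q \<eta>) $ b)"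
      using ab_ne by (auto simp: vec_eq_iff hex_shift_def)
    then show ?thesis using that by (metis free_of_def)
  qed
  show ?thesis
    unfolding hex_neutral_def balanced_def
  proof (intro allI)
    fix \<xi>1 \<xi>2 \<xi>3 \<eta> x
    consider (G1) G where "\<And>p q \<eta>. g (x + hex_shift p q \<eta>) = G q \<eta>" | (G2) G where "\<And>p q \<eta>. g (x + hex_shift p q \<eta>) = G p \<eta>"
      | (G3) G where "\<And>p q \<eta>. g (x + hex_shift p q \<eta>) = G p q"
    proof -
      show thesis
        using assms
      proof (elim disjE)
        assume "free_of a g"
        then show thesis by (intro that(1)[of "\<lambda>q \<eta>. g (x + hex_shift 0 q \<eta>)"] a)
      next
        assume "free_of c g"
        then show thesis by (intro that(2)[of "\<lambda>p \<eta>. g (x + hex_shift p 0 \<eta>)"] c)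
      next
        assume "free_of b g"
        then show thesis by (intro that(3)[of "\<lambda>p q. g (x + hex_shift p q 0)"] b)
      qed
    qed
    then show "(\<Prod>k<6. g (x + hex_left \<xi>1 \<xi>2 \<xi>3 \<eta> ! k)) = (\<Prod>k<6. g (x + hex_right \<xi>1 \<xi>2 \<xi>3 \<eta> ! k))"
      by cases (simp_all add: hex_left_def hex_right_def prod_six)
  qed
qed

lemma current_hex_shift:
  "(\<Sum>n\<in>nbrs b. y b n * cnj (bus_voltage V0 (x + hex_shift p q \<eta>) n)) = (\<Sum>n\<in>nbrs b. y b n * cnj (bus_voltage V0 x n)) + p + q"
proof -
  have "bus_voltage V0 (x + hex_shift p q \<eta>) n = bus_voltage V0 x n + bus_voltage 0 (hex_shift p q \<eta>) n" for n
    using bus_voltage_add[of V0 0 x] by simp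
  then have "(\<Sum>n\<in>nbrs b. y b n * cnj (bus_voltage V0 (x + hex_shift p q \<eta>) n))
    = (\<Sum>n\<in>nbrs b. y b n * cnj (bus_voltage V0 x n)) + (\<Sum>n\<in>nbrs b. y b n * cnj (bus_voltage 0 (hex_shift p q \<eta>) n))"
    by (simp add: algebra_simps sum.distrib)
  also have "(\<Sum>n\<in>nbrs b. y b n * cnj (bus_voltage 0 (hex_shift p q \<eta>) n))
     = (\<Sum>n\<in>{Some a, Some c}. y b n * cnj (bus_voltage 0 (hex_shift p q \<eta>) n))"
  proof (rule sum.mono_neutral_right)
    have "Some b \<notin> nbrs b" by (simp add: nbrs_def)
    then show "\<forall>n\<in>nbrs b - {Some a, Some c}. y b n * cnj (bus_voltage 0 (hex_shift p q \<eta>) n) = 0"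
      by (auto simp: bus_voltage_def hex_shift_def split: option.split)
  qed (use abc in auto)
  also have "\<dots> = p + q"
    using abc y_ne[OF abc(1)] y_ne[OF abc(2)] by (simp add: bus_voltage_def hex_shift_def)
  finally show ?thesis by simp
qed

lemma hex_neutral_centre: "hex_neutral (\<lambda>V. g (F V $ b))"
  unfolding hex_neutral_def balanced_def
proof (intro allI)
  fix \<xi>1 \<xi>2 \<xi>3 \<eta> x
  have "(x + hex_shift p q \<eta>) $ b = x $ b + \<eta>" for p q \<eta> using ab_ne by (simp add: hex_shift_def)
  then obtain G where "\<And>p q \<eta>. g (F (x + hex_shift p q \<eta>) $ b) = G (p + q) \<eta>"
    unfolding F_eq current_hex_shift by (simp add: add.assoc)
  then show "(\<Prod>k<6. g (F (x + hex_left \<xi>1 \<xi>2 \<xi>3 \<eta> ! k) $ b)) = (\<Prod>k<6. g (F (x + hex_right \<xi>1 \<xi>2 \<xi>3 \<eta> ! k) $ b))"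
    by (simp add: hex_left_def hex_right_def prod_six add.commute)
qed

lemma hex_shift_scale: "hex_shift (of_real t * p) (of_real t * q) (of_real t * \<eta>) = t *\<^sub>R hex_shift p q \<eta>"
  by (auto simp: hex_shift_def vec_eq_iff scaleR_conv_of_real[where 'a = complex])

text \<open>
  The cycle identity needs small displacements. Scaling all parameters by \<open>t\<close> makes
  them small, and both sides are polynomials in \<open>t\<close>, so the result for small
  \<open>t > 0\<close> reaches \<open>t = 1\<close>.
\<close>

lemma hexagon_identity:
  assumes sep: "log_separable W f i j"
    and ij: "i = a \<or> i = c \<or> i = b" "j = a \<or> j = c \<or> j = b"
  shows "(\<Prod>k<6. (Delta (x + hex_left \<xi>1 \<xi>2 \<xi>3 \<eta> ! k))\<^sup>2) = (\<Prod>k<6. (Delta (x + hex_right \<xi>1 \<xi>2 \<xi>3 \<eta> ! k))\<^sup>2)"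
proof -
  obtain \<alpha> \<beta> where W: "W \<in> sets borel" "emeasure lborel W > 0" and free: "free_of j \<alpha>" "free_of i \<beta>"
    and fact: "\<And>x. x \<in> W \<Longrightarrow> \<bar>Delta x\<bar> * (\<Prod>k\<in>UNIV. f k (F x $ k)) = \<alpha> x * \<beta> x \<and> (\<Prod>k\<in>UNIV. f k (F x $ k)) \<noteq> 0"
    using sep unfolding log_separable_def by blast
  have A: "hex_neutral (\<lambda>x. \<Prod>k\<in>UNIV. f k (F x $ k))"
  proof (rule hex_neutral_prod)
    fix k
    show "hex_neutral (\<lambda>x. f k (F x $ k))"
    proof (cases "k = b")
      case True then show ?thesis using hex_neutral_centre by simp
    next
      case kb: False
      show ?thesis
      proof (cases "k = a")
        case True
        then have "free_of c (\<lambda>x. f k (F x $ k))" using leafs(2) abc(3) by (intro F_free) auto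
        then show ?thesis using hex_neutral_free by blast
      next
        case False
        then have "free_of a (\<lambda>x. f k (F x $ k))" using leafs(1) kb by (intro F_free) auto
        then show ?thesis using hex_neutral_free by blast
      qed
    qed
  qed
  have B: "hex_neutral (\<lambda>x. \<alpha> x * \<beta> x)"
    using free ij by (intro hex_neutral_mult hex_neutral_free) auto
  obtain R \<delta> where \<delta>: "\<delta> > 0" and cyc: "\<And>T T'. small_moves 6 R \<delta> T \<Longrightarrow> small_moves 6 R \<delta> T'
      \<Longrightarrow> balanced 6 T T' (\<lambda>x. \<Prod>k\<in>UNIV. f k (F x $ k)) \<Longrightarrow> balanced 6 T T' (\<lambda>x. \<alpha> x * \<beta> x)
      \<Longrightarrow> balanced 6 T T' (\<lambda>x. (Delta x)\<^sup>2)"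
    by (rule cycle_identity[OF real_polynomial_function_Delta W fact]) (assumption | rule that)+
  define L where "L t = hex_left (of_real t * \<xi>1) (of_real t * \<xi>2) (of_real t * \<xi>3) (of_real t * \<eta>)" for t
  define L' where "L' t = hex_right (of_real t * \<xi>1) (of_real t * \<xi>2) (of_real t * \<xi>3) (of_real t * \<eta>)" for t
  have Lt: "L t ! k = t *\<^sub>R hex_left \<xi>1 \<xi>2 \<xi>3 \<eta> ! k" "L' t ! k = t *\<^sub>R hex_right \<xi>1 \<xi>2 \<xi>3 \<eta> ! k" if "k < 6" for t k
  proof -
    have s: "hex_shift (of_real t * p) (of_real t * q) 0 = t *\<^sub>R hex_shift p q 0" for p q
      using hex_shift_scale[of t p q 0] by simp
    have "L t = map (\<lambda>v. t *\<^sub>R v) (hex_left \<xi>1 \<xi>2 \<xi>3 \<eta>)" "L' t = map (\<lambda>v. t *\<^sub>R v) (hex_right \<xi>1 \<xi>2 \<xi>3 \<eta>)"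
      by (simp_all add: L_def L'_def hex_left_def hex_right_def hex_shift_scale s)
    moreover have "length (hex_left \<xi>1 \<xi>2 \<xi>3 \<eta>) = 6" "length (hex_right \<xi>1 \<xi>2 \<xi>3 \<eta>) = 6"
      by (simp_all add: hex_left_def hex_right_def)
    ultimately show "L t ! k = t *\<^sub>R hex_left \<xi>1 \<xi>2 \<xi>3 \<eta> ! k" "L' t ! k = t *\<^sub>R hex_right \<xi>1 \<xi>2 \<xi>3 \<eta> ! k"
      using that by simp_all
  qed
  define N where "N = 1 + (\<Sum>k<6. norm (hex_left \<xi>1 \<xi>2 \<xi>3 \<eta> ! k) + norm (hex_right \<xi>1 \<xi>2 \<xi>3 \<eta> ! k))"
  have N: "N > 0" unfolding N_def by (intro add_pos_nonneg sum_nonneg) auto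
  have bound: "norm (hex_left \<xi>1 \<xi>2 \<xi>3 \<eta> ! k) \<le> N" "norm (hex_right \<xi>1 \<xi>2 \<xi>3 \<eta> ! k) \<le> N" if "k < 6" for k
  proof -
    have "norm (hex_left \<xi>1 \<xi>2 \<xi>3 \<eta> ! k) + norm (hex_right \<xi>1 \<xi>2 \<xi>3 \<eta> ! k)
      \<le> (\<Sum>k<6. norm (hex_left \<xi>1 \<xi>2 \<xi>3 \<eta> ! k) + norm (hex_right \<xi>1 \<xi>2 \<xi>3 \<eta> ! k))"
      using that by (intro member_le_sum) auto
    then show "norm (hex_left \<xi>1 \<xi>2 \<xi>3 \<eta> ! k) \<le> N" "norm (hex_right \<xi>1 \<xi>2 \<xi>3 \<eta> ! k) \<le> N"
      using norm_ge_zero[of "hex_left \<xi>1 \<xi>2 \<xi>3 \<eta> ! k"] norm_ge_zero[of "hex_right \<xi>1 \<xi>2 \<xi>3 \<eta> ! k"]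
      unfolding N_def by linarith+
  qed
  have small: "(\<Prod>k<6. (Delta (x + t *\<^sub>R hex_left \<xi>1 \<xi>2 \<xi>3 \<eta> ! k))\<^sup>2) - (\<Prod>k<6. (Delta (x + t *\<^sub>R hex_right \<xi>1 \<xi>2 \<xi>3 \<eta> ! k))\<^sup>2) = 0"
    if t: "0 < t" "t < \<delta> / N" for t
  proof -
    have sm: "norm (L t ! k) < \<delta>" "norm (L' t ! k) < \<delta>" if "k < 6" for k
    proof -
      have "t * N < \<delta>" using t N by (simp add: field_simps)
      moreover have "norm (L t ! k) \<le> t * N" "norm (L' t ! k) \<le> t * N"
        using t bound[OF that] by (simp_all add: Lt[OF that])
      ultimately show "norm (L t ! k) < \<delta>" "norm (L' t ! k) < \<delta>" by linarith+
    qed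
    have "small_moves 6 R \<delta> (\<lambda>k x. x + L t ! k)" "small_moves 6 R \<delta> (\<lambda>k x. x + L' t ! k)"
      using sm by (auto simp: small_moves_def
          intro: expanding_translation near_id_translation polynomial_function_translation)
    then have "balanced 6 (\<lambda>k x. x + L t ! k) (\<lambda>k x. x + L' t ! k) (\<lambda>x. (Delta x)\<^sup>2)"
      by (rule cyc) (use A B in \<open>simp_all add: hex_neutral_def L_def L'_def\<close>)
    then have "(\<Prod>k<6. (Delta (x + L t ! k))\<^sup>2) = (\<Prod>k<6. (Delta (x + L' t ! k))\<^sup>2)"
      by (simp add: balanced_def)
    then show ?thesis by (simp add: Lt cong: prod.cong_simp)
  qed
  define P where "P t = (\<Prod>k<6. (Delta (x + t *\<^sub>R hex_left \<xi>1 \<xi>2 \<xi>3 \<eta> ! k))\<^sup>2) - (\<Prod>k<6. (Delta (x + t *\<^sub>R hex_right \<xi>1 \<xi>2 \<xi>3 \<eta> ! k))\<^sup>2)" for t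
  have "real_polynomial_function P"
    unfolding P_def
    by (intro real_polynomial_function_diff real_polynomial_function_prod real_polynomial_function_power
        real_polynomial_function_Delta_line) auto
  moreover have "infinite {t. P (0 + t *\<^sub>R 1) = 0}"
  proof -
    have "{0<..<\<delta> / N} \<subseteq> {t. P (0 + t *\<^sub>R 1) = 0}" using small by (auto simp: P_def)
    moreover have "infinite {0<..<\<delta> / N}" using \<delta> N by (intro infinite_Ioo) auto
    ultimately show ?thesis using finite_subset by blast
  qed
  ultimately have "P (0 + 1 *\<^sub>R 1) = 0" by (rule real_polynomial_function_on_line)
  then show ?thesis by (simp add: P_def)
qed

text \<open>
  Since \<open>a\<close>, \<open>b\<close>, \<open>c\<close> are on the same scale, rescaling maps
  hexagons to hexagons.
\<close>

lemma frozen_hexagon: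
  fixes \<xi>1 \<xi>2 \<xi>3 \<sigma> u u'
  assumes sep: "log_separable W f i j"
    and ij: "i = a \<or> i = c \<or> i = b" "j = a \<or> j = c \<or> j = b"
    and act: "active K m" and ex: "exponent K m (Some a) = exponent K m (Some b)"
      "exponent K m (Some c) = exponent K m (Some b)"
  defines "G \<equiv> \<lambda>u p q. (frozen_Delta K m (hex_point b a c u p q))\<^sup>2"
  shows "G u \<xi>1 (\<sigma> + \<xi>3) * G u \<xi>2 (\<sigma> + \<xi>1) * G u \<xi>3 (\<sigma> + \<xi>2) * G u' \<xi>2 (\<sigma> + \<xi>3) * G u' \<xi>3 (\<sigma> + \<xi>1) * G u' \<xi>1 (\<sigma> + \<xi>2)
    = G u \<xi>2 (\<sigma> + \<xi>3) * G u \<xi>3 (\<sigma> + \<xi>1) * G u \<xi>1 (\<sigma> + \<xi>2) * G u' \<xi>1 (\<sigma> + \<xi>3) * G u' \<xi>2 (\<sigma> + \<xi>1) * G u' \<xi>3 (\<sigma> + \<xi>2)"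
proof -
  define x where "x = hex_point b a c u 0 \<sigma>"
  have pt: "x + hex_shift p q 0 = hex_point b a c u p (\<sigma> + q)" "x + hex_shift p q (u' - u) = hex_point b a c u' p (\<sigma> + q)" for p q
    unfolding x_def hex_shift_def hex_point_def using ab_ne by (auto simp: vec_eq_iff add_divide_distrib)
  have "(\<Prod>k<6. (frozen_Delta K m (x + hex_left \<xi>1 \<xi>2 \<xi>3 (u' - u) ! k))\<^sup>2)
     = (\<Prod>k<6. (frozen_Delta K m (x + hex_right \<xi>1 \<xi>2 \<xi>3 (u' - u) ! k))\<^sup>2)"
  proof (rule frozen_identity[OF act])
    fix e :: real
    let ?t = "e ^ exponent K m (Some b)"
    have rs: "rescaled K m e (x + hex_shift p q \<eta>) = rescaled K m e x + hex_shift (of_real ?t * p) (of_real ?t * q) (of_real ?t * \<eta>)" for p q \<eta>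
      unfolding hex_shift_scale by (auto simp: vec_eq_iff rescaled_def hex_shift_def ex algebra_simps)
    have rs0: "rescaled K m e (x + hex_shift p q 0) = rescaled K m e x + hex_shift (of_real ?t * p) (of_real ?t * q) 0" for p q
      using rs[of p q 0] by simp
    show "(\<Prod>k<6. (Delta (rescaled K m e (x + hex_left \<xi>1 \<xi>2 \<xi>3 (u' - u) ! k)))\<^sup>2)
     = (\<Prod>k<6. (Delta (rescaled K m e (x + hex_right \<xi>1 \<xi>2 \<xi>3 (u' - u) ! k)))\<^sup>2)"
      using hexagon_identity[OF sep ij, of "rescaled K m e x" "of_real ?t * \<xi>1" "of_real ?t * \<xi>2" "of_real ?t * \<xi>3" "of_real ?t * (u' - u)"]
      unfolding prod_six by (simp add: hex_left_def hex_right_def rs rs0 del: of_real_power)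
  qed simp
  then show ?thesis
    unfolding prod_six G_def by (simp add: hex_left_def hex_right_def pt)
qed

end
end

section \<open>Three or more loads\<close>

context power_grid
begin

lemma nbrs_sym: "Some a \<in> nbrs k \<Longrightarrow> Some k \<in> nbrs a"
  by (simp add: nbrs_def insert_commute)

lemma hex_point_nth:
  assumes "a \<noteq> b" "c \<noteq> b" "a \<noteq> c"
  shows "hex_point b a c u p q $ b = u" "hex_point b a c u p q $ a = cnj (p / y b (Some a))"
    "hex_point b a c u p q $ c = cnj (q / y b (Some c))" "k \<noteq> a \<Longrightarrow> k \<noteq> b \<Longrightarrow> k \<noteq> c \<Longrightarrow> hex_point b a c u p q $ k = 1"
  using assms by (auto simp: hex_point_def)

text \<open>
  Here \<open>a\<close> feeds \<open>b\<close>, so its current is the source of the frozen branch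
  from \<open>b\<close> to \<open>c\<close>, and the single leaf results apply. With voltage
  \<open>1\<close> at \<open>b\<close> and \<open>1/2\<close> at \<open>c\<close> the leaf equation
  is singular, and the source \<open>\<xi> 0 = \<i> * T * y\<close> makes the whole determinant
  vanish. On the other side of the hexagon the same currents occur in different pairs. At one of
  these points the leaf equation is still singular, but the second term of \<open>branch_det\<close>
  is not zero; at the others \<open>leaf_det\<close> is not zero and a large \<open>T\<close> makes
  its factor \<open>Cf\<close> dominate.
\<close>

lemma hexagon_below_source:
  assumes a: "par b = Some a" and c: "par c = Some b" and leaf: "Desc c = {c}"
    and leafs: "\<And>k. k \<noteq> b \<Longrightarrow> k \<noteq> a \<Longrightarrow> Some a \<notin> nbrs k" "Some c \<notin> nbrs a"
    and V0: "V0 \<noteq> 0"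
    and sep: "log_separable W f i j"
    and ij: "i = a \<or> i = c \<or> i = b" "j = a \<or> j = c \<or> j = b"
  shows False
proof -
  have ne: "a \<noteq> b" "c \<noteq> b" "a \<noteq> c" using a c par_ne_self par_asym by auto
  have nb: "Some a \<in> nbrs b" "Some c \<in> nbrs b" using a c by (auto simp: nbrs_iff)
  note val = hex_point_nth[OF ne]
  let ?K = "branch b c" and ?ya = "y b (Some a)" and ?yc = "y b (Some c)" and ?Y = "Ysum b"
  have ya: "?ya \<noteq> 0" and yc: "?yc \<noteq> 0" using nb y_ne by auto
  have ex: "exponent ?K b (Some a) = exponent ?K b (Some b)" "exponent ?K b (Some c) = exponent ?K b (Some b)"
    using ne a leaf by (auto simp: exponent_def branch_def)
  let ?G = "\<lambda>u p q. (frozen_Delta ?K b (hex_point b a c u p q))\<^sup>2"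
  have hex: "?G u \<xi>1 (\<sigma> + \<xi>3) * ?G u \<xi>2 (\<sigma> + \<xi>1) * ?G u \<xi>3 (\<sigma> + \<xi>2)
       * ?G u' \<xi>2 (\<sigma> + \<xi>3) * ?G u' \<xi>3 (\<sigma> + \<xi>1) * ?G u' \<xi>1 (\<sigma> + \<xi>2)
     = ?G u \<xi>2 (\<sigma> + \<xi>3) * ?G u \<xi>3 (\<sigma> + \<xi>1) * ?G u \<xi>1 (\<sigma> + \<xi>2)
       * ?G u' \<xi>1 (\<sigma> + \<xi>3) * ?G u' \<xi>2 (\<sigma> + \<xi>1) * ?G u' \<xi>3 (\<sigma> + \<xi>2)"
    for u u' \<xi>1 \<xi>2 \<xi>3 \<sigma>
    by (rule frozen_hexagon[OF nb ne(3) leafs sep ij active_branch[OF c] ex])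
  have nz: "bus_voltage V0 (hex_point b a c u p q) d \<noteq> 0" if "u \<noteq> 0" "p \<noteq> 0" "q \<noteq> 0" for u p q d
    using that V0 ya yc by (cases d) (auto simp: bus_voltage_def hex_point_def)
  have src: "source (hex_point b a c u p q) b = p" for u p q
    using ya by (simp add: source_def a bus_voltage_def val)
  have reg: "frozen_Delta ?K b (hex_point b a c u p q) \<noteq> 0"
    if "u \<noteq> 0" "p \<noteq> 0" "q \<noteq> 0" "branch_det ?Y p ?yc u (cnj (q / ?yc)) \<noteq> 0" for u p q
    using frozen_branch(1)[OF c, of "hex_point b a c u p q" "cnj (q / ?yc)"] that nz leaf by (simp add: val src)
  have sing: "frozen_Delta ?K b (hex_point b a c u p q) = 0"
    if "u \<noteq> 0" "p \<noteq> 0" "q \<noteq> 0" "leaf_det u (cnj (q / ?yc)) = 0" "Re (cnj ?yc * p * u) = 0" for u p q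
    using frozen_branch(2)[OF c, of "hex_point b a c u p q" "cnj (q / ?yc)"] that nz leaf by (simp add: val src)
  define \<rho> where "\<rho> = cmod ?Y / cmod ?yc"
  \<comment> \<open>Chosen such that \<open>T\<^sup>2 - 4 * \<rho> * (T + 2) \<ge> 100\<close>, which bounds \<open>Cf\<close> below by \<open>100 * |y|\<^sup>2\<close>.\<close>
  define T where "T = 10 + 6 * \<rho>"
  have rho: "\<rho> \<ge> 0" by (simp add: \<rho>_def)
  define \<xi> where "\<xi> m = (\<i> * of_real T + of_real m) * ?yc" for m
  have xi0: "\<xi> m \<noteq> 0" for m
  proof -
    have "Im (\<i> * of_real T + of_real m) > 0" using rho by (simp add: T_def)
    then have "\<i> * of_real T + of_real m \<noteq> 0" by (metis less_irrefl zero_complex.sel(2))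
    then show ?thesis using yc by (simp add: \<xi>_def)
  qed
  have E: "Re (cnj ?yc * \<xi> m * of_real u) = (cmod ?yc)\<^sup>2 * m * u" for m u
  proof -
    have "cnj ?yc * \<xi> m * of_real u = (?yc * cnj ?yc) * (\<i> * of_real (T * u) + of_real (m * u))"
      by (simp add: \<xi>_def algebra_simps)
    also have "\<dots> = of_real ((cmod ?yc)\<^sup>2) * (\<i> * of_real (T * u) + of_real (m * u))"
      by (simp only: complex_norm_square)
    finally show ?thesis by (simp only: Re_of_real_mult) simp
  qed
  define Cf where "Cf m u = (cmod (\<xi> m))\<^sup>2 - 2 * Re (cnj ?Y * \<xi> m * of_real u)" for m u
  have C: "Cf m u \<ge> 100 * (cmod ?yc)\<^sup>2" if "0 \<le> m" "m \<le> 2" "\<bar>u\<bar> \<le> 2" for m u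
  proof -
    have xin: "cmod (\<xi> m) = cmod (\<i> * of_real T + of_real m) * cmod ?yc" by (simp add: \<xi>_def norm_mult)
    have sq: "(cmod (\<i> * of_real T + of_real m))\<^sup>2 = T\<^sup>2 + m\<^sup>2" by (simp add: cmod_power2)
    have lin: "cmod (\<i> * of_real T + of_real m) \<le> T + 2"
    proof -
      have "T \<ge> 0" using rho by (simp add: T_def)
      then show ?thesis
        using norm_triangle_ineq[of "\<i> * of_real T" "of_real m"] that by (simp add: norm_mult)
    qed
    have "\<bar>2 * Re (cnj ?Y * \<xi> m * of_real u)\<bar> \<le> 2 * cmod (cnj ?Y * \<xi> m * of_real u)"
      using abs_Re_le_cmod[of "cnj ?Y * \<xi> m * of_real u"] by simp
    also have "\<dots> = 2 * (cmod ?Y * (cmod (\<i> * of_real T + of_real m) * cmod ?yc) * \<bar>u\<bar>)"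
      by (simp add: norm_mult xin)
    also have "\<dots> \<le> 2 * (cmod ?Y * ((T + 2) * cmod ?yc) * 2)"
      using lin that rho by (intro mult_left_mono mult_mono mult_right_mono) (auto simp: T_def)
    also have "\<dots> = 4 * \<rho> * (T + 2) * (cmod ?yc)\<^sup>2"
      using yc by (simp add: \<rho>_def power2_eq_square)
    finally have 1: "2 * Re (cnj ?Y * \<xi> m * of_real u) \<le> 4 * \<rho> * (T + 2) * (cmod ?yc)\<^sup>2" by linarith
    have "100 \<le> T\<^sup>2 - 4 * \<rho> * (T + 2)"
    proof -
      have "T\<^sup>2 - 4 * \<rho> * (T + 2) = 100 + 72 * \<rho> + 12 * \<rho>\<^sup>2"
        by (simp add: T_def power2_eq_square algebra_simps)
      then show ?thesis using rho by simp
    qed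
    then have "100 * (cmod ?yc)\<^sup>2 \<le> (T\<^sup>2 - 4 * \<rho> * (T + 2)) * (cmod ?yc)\<^sup>2"
      by (rule mult_right_mono) simp
    also have "\<dots> \<le> (T\<^sup>2 + m\<^sup>2) * (cmod ?yc)\<^sup>2 - 4 * \<rho> * (T + 2) * (cmod ?yc)\<^sup>2"
      by (simp add: algebra_simps)
    also have "\<dots> \<le> Cf m u"
      using 1 unfolding Cf_def xin power_mult_distrib sq by simp
    finally show ?thesis .
  qed
  have P: "branch_det ?Y (\<xi> m) ?yc (of_real u) (cnj (of_real \<nu> * ?yc / ?yc)) = (u\<^sup>2 - 2 * \<nu> * u) * Cf m u - 2 * (cmod ?yc)\<^sup>2 * m * u * \<nu>\<^sup>2"
    and Q: "leaf_det (of_real u) (cnj (of_real \<nu> * ?yc / ?yc)) = u\<^sup>2 - 2 * \<nu> * u" for m u \<nu>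
  proof -
    show Q: "leaf_det (of_real u) (cnj (of_real \<nu> * ?yc / ?yc)) = u\<^sup>2 - 2 * \<nu> * u"
      using yc by (simp add: leaf_det_def)
    show "branch_det ?Y (\<xi> m) ?yc (of_real u) (cnj (of_real \<nu> * ?yc / ?yc)) = (u\<^sup>2 - 2 * \<nu> * u) * Cf m u - 2 * (cmod ?yc)\<^sup>2 * m * u * \<nu>\<^sup>2"
      unfolding branch_det_def Q E using yc by (simp add: Cf_def)
  qed
  define g where "g = (cmod ?yc)\<^sup>2"
  have g: "g > 0" using yc by (simp add: g_def)
  have reg': "frozen_Delta ?K b (hex_point b a c (of_real u) (\<xi> m) (of_real \<nu> * ?yc)) \<noteq> 0"
    if "u \<noteq> 0" "\<nu> \<noteq> 0" "(u\<^sup>2 - 2 * \<nu> * u) * Cf m u - 2 * g * m * u * \<nu>\<^sup>2 \<noteq> 0" for u m \<nu>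
    using that xi0 yc P[of m u \<nu>] by (intro reg) (auto simp: g_def)
  \<comment> \<open>The currents from \<open>c\<close> become the multiples \<open>1/2\<close>, \<open>- 3/2\<close>, \<open>- 1/2\<close> of \<open>y\<close>.\<close>
  define \<sigma> where "\<sigma> = of_real (- 3/2) * ?yc - \<i> * of_real T * ?yc"
  have q: "\<sigma> + \<xi> 2 = of_real (1/2) * ?yc" "\<sigma> + \<xi> 0 = of_real (- 3/2) * ?yc" "\<sigma> + \<xi> 1 = of_real (- 1/2) * ?yc"
    by (simp_all add: \<sigma>_def \<xi>_def algebra_simps)
  have "frozen_Delta ?K b (hex_point b a c (of_real 1) (\<xi> 0) (of_real (1/2) * ?yc)) = 0"
    using xi0 yc Q[of 1 "1/2"] E[of 0 1] by (intro sing) auto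
  moreover have "frozen_Delta ?K b (hex_point b a c (of_real 1) (\<xi> 1) (of_real (1/2) * ?yc)) \<noteq> 0"
    using g by (intro reg') auto
  moreover have "frozen_Delta ?K b (hex_point b a c (of_real 1) (\<xi> 2) (of_real (- 3/2) * ?yc)) \<noteq> 0"
    using g C[of 2 1] by (intro reg') (auto simp: g_def power2_eq_square)
  moreover have "frozen_Delta ?K b (hex_point b a c (of_real 1) (\<xi> 0) (of_real (- 1/2) * ?yc)) \<noteq> 0"
    using g C[of 0 1] by (intro reg') (auto simp: g_def)
  moreover have "frozen_Delta ?K b (hex_point b a c (of_real (-2)) (\<xi> 0) (of_real (1/2) * ?yc)) \<noteq> 0"
    using g C[of 0 "-2"] by (intro reg') (auto simp: g_def)
  moreover have "frozen_Delta ?K b (hex_point b a c (of_real (-2)) (\<xi> 1) (of_real (- 3/2) * ?yc)) \<noteq> 0"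
    using g C[of 1 "-2"] by (intro reg') (auto simp: g_def power2_eq_square)
  moreover have "frozen_Delta ?K b (hex_point b a c (of_real (-2)) (\<xi> 2) (of_real (- 1/2) * ?yc)) \<noteq> 0"
    using g C[of 2 "-2"] by (intro reg') (auto simp: g_def power2_eq_square)
  ultimately show False
    using hex[of "of_real 1" "\<xi> 0" \<sigma> "\<xi> 2" "\<xi> 1" "of_real (-2)"] unfolding q by simp
qed

lemma generic_direction:
  fixes A B :: complex assumes "A \<noteq> 0" "B \<noteq> 0"
  shows "\<exists>w. w \<noteq> 0 \<and> Re (A * w) \<noteq> 0 \<and> Re (B * w) \<noteq> 0"
proof (cases "Re (B * cnj A) = 0")
  case False
  have "Re (A * cnj A) \<noteq> 0" using assms(1) by (simp add: complex_mult_cnj complex_eq_iff sum_power2_eq_zero_iff)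
  then show ?thesis using False assms(1) by (intro exI[of _ "cnj A"]) auto
next
  case True
  then have "Re (A * cnj B) = 0" by (simp add: algebra_simps)
  then have "Re (A * (cnj A + cnj B)) = (cmod A)\<^sup>2" "Re (B * (cnj A + cnj B)) = (cmod B)\<^sup>2"
    using True by (simp_all add: distrib_left cmod_sq)
  then show ?thesis using assms by (intro exI[of _ "cnj A + cnj B"]) (auto simp: complex_eq_iff)
qed

text \<open>
  Both \<open>a\<close> and \<open>c\<close> are leaves fed by \<open>b\<close>. On one side of the
  hexagon there is a point at which both leaves have half the voltage of \<open>b\<close>, so that
  the determinant vanishes. On the other side at most one leaf has: the pairs are different at
  \<open>u\<close>, and at \<open>u' = - u\<close> the ratio \<open>1/2\<close> becomes
  \<open>- 1/2\<close>. The real number \<open>r\<close> only has to be generic, and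
  \<open>u\<close> small in a generic direction.
\<close>

lemma hexagon_two_children:
  assumes a: "par a = Some b" and c: "par c = Some b" and ac: "a \<noteq> c"
    and leaf: "nbrs a = {Some b}" "nbrs c = {Some b}"
    and V0: "V0 \<noteq> 0"
    and sep: "log_separable W f i j"
    and ij: "i = a \<or> i = c \<or> i = b" "j = a \<or> j = c \<or> j = b"
  shows False
proof -
  have ne: "a \<noteq> b" "c \<noteq> b" "a \<noteq> c" using a c ac par_ne_self by auto
  have nb: "Some a \<in> nbrs b" "Some c \<in> nbrs b" using a c by (auto simp: nbrs_iff)
  have leafs: "\<And>k. k \<noteq> b \<Longrightarrow> k \<noteq> a \<Longrightarrow> Some a \<notin> nbrs k" "Some c \<notin> nbrs a"
    using nbrs_sym[of a] nbrs_sym[of c a] ne unfolding leaf by auto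
  note val = hex_point_nth[OF ne]
  let ?K = "{b, a, c}" and ?ya = "y b (Some a)" and ?yc = "y b (Some c)" and ?Y = "Ysum b"
  have ya: "?ya \<noteq> 0" and yc: "?yc \<noteq> 0" using nb y_ne by auto
  have act: "active ?K b" by (rule active_triple[OF a c ac leaf])
  have ex: "exponent ?K b (Some a) = exponent ?K b (Some b)" "exponent ?K b (Some c) = exponent ?K b (Some b)"
    by (auto simp: exponent_def)
  let ?G = "\<lambda>u p q. (frozen_Delta ?K b (hex_point b a c u p q))\<^sup>2"
  have hex: "?G u \<xi>1 (\<sigma> + \<xi>3) * ?G u \<xi>2 (\<sigma> + \<xi>1) * ?G u \<xi>3 (\<sigma> + \<xi>2)
       * ?G u' \<xi>2 (\<sigma> + \<xi>3) * ?G u' \<xi>3 (\<sigma> + \<xi>1) * ?G u' \<xi>1 (\<sigma> + \<xi>2)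
     = ?G u \<xi>2 (\<sigma> + \<xi>3) * ?G u \<xi>3 (\<sigma> + \<xi>1) * ?G u \<xi>1 (\<sigma> + \<xi>2)
       * ?G u' \<xi>1 (\<sigma> + \<xi>3) * ?G u' \<xi>2 (\<sigma> + \<xi>1) * ?G u' \<xi>3 (\<sigma> + \<xi>2)"
    for u u' \<xi>1 \<xi>2 \<xi>3 \<sigma>
    by (rule frozen_hexagon[OF nb ne(3) leafs sep ij act ex])
  define s where "s = source (hex_point b a c 1 0 0) b"
  have pb: "par b \<noteq> Some a" "par b \<noteq> Some c" using a c by (auto dest: par_asym)
  have bus_par: "bus_voltage V0 (hex_point b a c u p q) (par b) = bus_voltage V0 (hex_point b a c 1 0 0) (par b)" for u p q
    using pb by (cases "par b") (auto simp: bus_voltage_def hex_point_def)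
  have src: "source (hex_point b a c u p q) b = s" for u p q
    unfolding s_def source_def bus_par[of u p q] by (rule refl)
  have s0: "s \<noteq> 0"
    unfolding s_def source_def using V0 y_ne[OF par_in_nbrs[of b]] pb
    by (cases "par b") (auto simp: bus_voltage_def hex_point_def)
  have nz: "bus_voltage V0 (hex_point b a c u p q) (par d) \<noteq> 0" if "u \<noteq> 0" "d \<notin> ?K" for u p q d
  proof -
    have "Some d \<notin> nbrs a" "Some d \<notin> nbrs c" using leaf that(2) by auto
    then have "par d \<noteq> Some a" "par d \<noteq> Some c" by (auto simp: nbrs_iff)
    then show ?thesis using that V0 by (cases "par d") (auto simp: bus_voltage_def hex_point_def)
  qed
  let ?sys = "\<lambda>u va vc k ba bc. (cnj va - cnj u) * ba + va * (cnj ba - cnj k) = 0 \<and>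
     (cnj vc - cnj u) * bc + vc * (cnj bc - cnj k) = 0 \<and>
     (?Y * cnj u - s - ?ya * cnj va - ?yc * cnj vc) * k + u * (?Y * cnj k - ?ya * cnj ba - ?yc * cnj bc) = 0"
  have iff: "frozen_Delta ?K b (hex_point b a c u p q) = 0 \<longleftrightarrow> (\<exists>k ba bc. (k, ba, bc) \<noteq> (0, 0, 0) \<and>
      ?sys u (cnj (p / ?ya)) (cnj (q / ?yc)) k ba bc)" if "u \<noteq> 0" for u p q
    using frozen_triple[OF a c ac leaf, of "hex_point b a c u p q"] nz[OF that] by (simp only: val src) blast
  define \<kappa> where "\<kappa> = Re (?yc / ?ya)"
  define \<gamma> where "\<gamma> = Re (?ya / (2 * ?yc))"
  obtain r :: real where r: "r \<notin> {0, 1, \<gamma>, 1 + \<gamma>, 1 / (2 * \<kappa>), - 1 / (2 * \<kappa>)}"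
    using ex_new_if_finite[of "{0, 1, \<gamma>, 1 + \<gamma>, 1 / (2 * \<kappa>), - 1 / (2 * \<kappa>)}"] infinite_UNIV_char_0 by auto
  have r\<kappa>: "r * \<kappa> \<noteq> 1/2" "r * \<kappa> \<noteq> - 1/2" 
  proof -
    have "r = 1 / (2 * \<kappa>)" if "r * \<kappa> = 1/2" using that by (cases "\<kappa> = 0") (auto simp: field_simps)
    moreover have "r = - 1 / (2 * \<kappa>)" if "r * \<kappa> = - 1/2" using that by (cases "\<kappa> = 0") (auto simp: field_simps)
    ultimately show "r * \<kappa> \<noteq> 1/2" "r * \<kappa> \<noteq> - 1/2" using r by blast+
  qed
  define \<nu>1 where "\<nu>1 = cnj (of_real r * ?yc / ?ya)"
  define \<nu>2 where "\<nu>2 = cnj (1/2 - of_real r + ?ya / (2 * ?yc))"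
  have Re1: "Re \<nu>1 = r * \<kappa>"
  proof -
    have "Re \<nu>1 = Re (of_real r * ?yc / ?ya)" by (simp only: \<nu>1_def complex_cnj complex.sel cnj.sel)
    also have "of_real r * ?yc / ?ya = of_real r * (?yc / ?ya)" by simp
    finally show ?thesis unfolding \<kappa>_def by (simp only: Re_of_real_mult)
  qed
  have Re2: "Re \<nu>2 = 1/2 - r + \<gamma>" unfolding \<nu>2_def \<gamma>_def cnj.sel(1) by simp
  let ?reg = "\<lambda>\<nu>a \<nu>c d. \<forall>u k ba bc. u \<noteq> 0 \<longrightarrow> cmod u < d \<longrightarrow> ?sys u (\<nu>a * u) (\<nu>c * u) k ba bc \<longrightarrow> k = 0 \<and> ba = 0 \<and> bc = 0"
  have tl: "\<exists>d>0. ?reg \<nu>a \<nu>c d" if nu: "Re \<nu>a \<noteq> 1/2" "Re \<nu>c \<noteq> 1/2" for \<nu>a \<nu>c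
    using two_leaves_regular[OF s0 nu, of ?Y ?ya ?yc] by (simp only: imp_conjL)
  have n1: "Re \<nu>1 \<noteq> 1/2" "Re \<nu>2 \<noteq> 1/2" using r r\<kappa> by (auto simp: Re1 Re2)
  obtain d1 where d1: "d1 > 0" "?reg \<nu>1 \<nu>2 d1"
    using tl[OF n1] by (elim exE conjE) (rule that)
  have n2: "Re (- 1/2) \<noteq> 1/2" "Re (- 1/2) \<noteq> 1/2" using r r\<kappa> by (auto simp: Re1 Re2)
  obtain d2 where d2: "d2 > 0" "?reg (- 1/2) (- 1/2) d2"
    using tl[OF n2] by (elim exE conjE) (rule that)
  have n3: "Re 0 \<noteq> 1/2" "Re (- \<nu>2) \<noteq> 1/2" using r r\<kappa> by (auto simp: Re1 Re2)
  obtain d3 where d3: "d3 > 0" "?reg 0 (- \<nu>2) d3"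
    using tl[OF n3] by (elim exE conjE) (rule that)
  have n4: "Re (- \<nu>1) \<noteq> 1/2" "Re (- (1/2 - of_real r)) \<noteq> 1/2" using r r\<kappa> by (auto simp: Re1 Re2)
  obtain d4 where d4: "d4 > 0" "?reg (- \<nu>1) (- (1/2 - of_real r)) d4"
    using tl[OF n4] by (elim exE conjE) (rule that)
  obtain w where w: "w \<noteq> 0" "Re (cnj ?ya * s * w) \<noteq> 0" "Re (cnj ?yc * s * w) \<noteq> 0"
  proof -
    have "cnj ?ya * s \<noteq> 0" "cnj ?yc * s \<noteq> 0" using ya yc s0 by simp_all
    then show thesis using generic_direction that by blast
  qed
  define d where "d = min (min d1 d2) (min d3 d4)"
  define u where "u = of_real (d / (2 * cmod w)) * w"
  have d0: "d > 0" using d1(1) d2(1) d3(1) d4(1) by (simp add: d_def)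
  have u: "u \<noteq> 0" "cmod u < d1" "cmod u < d2" "cmod u < d3" "cmod u < d4"
  proof -
    have "cmod u = d / 2" using w(1) d0 by (simp add: u_def norm_mult norm_divide)
    then show "u \<noteq> 0" "cmod u < d1" "cmod u < d2" "cmod u < d3" "cmod u < d4"
      using d0 by (auto simp: d_def)
  qed
  have e: "Re (cnj ?ya * s * u) \<noteq> 0" "Re (cnj ?yc * s * u) \<noteq> 0"
  proof -
    have "cnj x * s * u = of_real (d / (2 * cmod w)) * (cnj x * s * w)" for x
      by (simp add: u_def)
    then show "Re (cnj ?ya * s * u) \<noteq> 0" "Re (cnj ?yc * s * u) \<noteq> 0"
      using w d0 by (simp_all only: Re_of_real_mult) auto
  qed
  define \<xi>1 where "\<xi>1 = ?ya * cnj u / 2"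
  define \<xi>3 where "\<xi>3 = cnj u * of_real r * ?yc"
  define \<sigma> where "\<sigma> = cnj u * ?yc * (1/2 - of_real r)"
  have va: "cnj (\<xi>1 / ?ya) = u / 2" "cnj (0 / ?ya) = 0" "cnj (\<xi>3 / ?ya) = \<nu>1 * u"
    using ya by (simp_all add: \<xi>1_def \<xi>3_def \<nu>1_def)
  have vc: "cnj ((\<sigma> + \<xi>3) / ?yc) = u / 2" "cnj ((\<sigma> + \<xi>1) / ?yc) = \<nu>2 * u" "cnj ((\<sigma> + 0) / ?yc) = (1/2 - of_real r) * u"
    using yc by (simp_all add: \<xi>1_def \<xi>3_def \<nu>2_def \<sigma>_def field_simps)
  have half: "u / 2 = (- 1/2) * (- u)" by simp
  have nought: "0 * (- u) = 0" by simp
  have u': "- u \<noteq> 0" "cmod (- u) < d2" "cmod (- u) < d3" "cmod (- u) < d4" using u by auto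
  have "frozen_Delta ?K b (hex_point b a c u \<xi>1 (\<sigma> + \<xi>3)) = 0"
    unfolding iff[OF u(1)] va vc using two_leaves_singular[OF u(1), of ?Y s ?ya ?yc] by blast
  moreover have "frozen_Delta ?K b (hex_point b a c u 0 (\<sigma> + \<xi>3)) \<noteq> 0"
  proof
    assume "frozen_Delta ?K b (hex_point b a c u 0 (\<sigma> + \<xi>3)) = 0"
    then obtain k ba bc where k: "(k, ba, bc) \<noteq> (0, 0, 0)" "?sys u 0 (u/2) k ba bc"
      unfolding iff[OF u(1)] va vc by blast
    have "k = 0 \<and> bc = 0 \<and> ba = 0"
      by (rule two_leaves_half_regular[OF u(1), of 0 ?yc s bc k ba ?Y ?ya]) (use k e in \<open>auto simp: algebra_simps\<close>)
    then show False using k by simp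
  qed
  moreover have "frozen_Delta ?K b (hex_point b a c u \<xi>3 (\<sigma> + \<xi>1)) \<noteq> 0"
    unfolding iff[OF u(1)] va vc
    using d1(2)[rule_format, OF u(1,2)] by blast
  moreover have "frozen_Delta ?K b (hex_point b a c u \<xi>1 (\<sigma> + 0)) \<noteq> 0"
  proof
    assume "frozen_Delta ?K b (hex_point b a c u \<xi>1 (\<sigma> + 0)) = 0"
    then obtain k ba bc where k: "(k, ba, bc) \<noteq> (0, 0, 0)" "?sys u (u/2) ((1/2 - of_real r) * u) k ba bc"
      unfolding iff[OF u(1)] va vc by blast
    have rr: "of_real (1/2 - r) = (1/2 - of_real r :: complex)" by simp
    have "k = 0 \<and> ba = 0 \<and> bc = 0"
      by (rule two_leaves_half_regular[OF u(1), of "1/2 - r" ?ya s ba k bc ?Y ?yc]; (unfold rr)?)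
         (use k e r in auto)
    then show False using k by simp
  qed
  moreover have "frozen_Delta ?K b (hex_point b a c (- u) \<xi>1 (\<sigma> + \<xi>3)) \<noteq> 0"
    unfolding iff[OF u'(1)] va vc using d2(2)[rule_format, OF u'(1,2), folded half] by blast
  moreover have "frozen_Delta ?K b (hex_point b a c (- u) 0 (\<sigma> + \<xi>1)) \<noteq> 0"
    unfolding iff[OF u'(1)] va vc using d3(2)[rule_format, OF u'(1,3), unfolded nought minus_mult_minus] by blast
  moreover have "frozen_Delta ?K b (hex_point b a c (- u) \<xi>3 (\<sigma> + 0)) \<noteq> 0"
    unfolding iff[OF u'(1)] va vc using d4(2)[rule_format, OF u'(1,4), unfolded minus_mult_minus] by blast
  ultimately show False
    using hex[of u \<xi>1 \<sigma> \<xi>3 0 "- u"] by simp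
qed

end

section \<open>Two loads\<close>

lemma all_less_six: "(\<forall>k<6. Q (k::nat)) \<longleftrightarrow> Q 0 \<and> Q 1 \<and> Q 2 \<and> Q 3 \<and> Q 4 \<and> Q 5"
proof -
  have "k < 6 \<longleftrightarrow> k = 0 \<or> k = 1 \<or> k = 2 \<or> k = 3 \<or> k = 4 \<or> k = 5" for k :: nat
    by presburger
  then show ?thesis by (simp only:) (blast intro: )
qed

lemma expanding_compose:
  assumes "expanding S" "expanding T" shows "expanding (\<lambda>x. S (T x))"
  unfolding expanding_def
proof (intro conjI ballI)
  have [measurable]: "S \<in> borel_measurable borel" "T \<in> borel_measurable borel"
    using assms by (simp_all add: expanding_def)
  show "(\<lambda>x. S (T x)) \<in> borel_measurable borel" by measurable
  fix A :: "'a set" assume A: "A \<in> sets borel"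
  have SA: "S -` A \<in> sets borel" using measurable_sets[of S borel borel A] A by simp
  have "emeasure lborel A \<le> emeasure lborel (S -` A)" using assms(1) A by (simp add: expanding_def)
  also have "\<dots> \<le> emeasure lborel (T -` S -` A)" using assms(2) SA by (simp add: expanding_def)
  finally show "emeasure lborel A \<le> emeasure lborel ((\<lambda>x. S (T x)) -` A)"
    by (simp add: vimage_def)
qed

text \<open>
  Voltages are multiplied by \<open>cnj d\<close>, so that conjugate voltages and the currents they
  cause are multiplied by \<open>d\<close>.
\<close>

definition rotate_all :: "complex \<Rightarrow> complex ^ 'v \<Rightarrow> complex ^ 'v" where
  "rotate_all d x = (\<chi> k. cnj d * x $ k)"

lemma linear_rotate_all: "linear (rotate_all d)"
  by (intro linearI) (auto simp: rotate_all_def vec_eq_iff algebra_simps)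

lemma norm_rotate_all: "cmod d = 1 \<Longrightarrow> norm (rotate_all d x) = norm x"
  by (simp add: rotate_all_def norm_vec_def norm_mult)

lemma rotate_all_back: "cmod d = 1 \<Longrightarrow> rotate_all (cnj d) (rotate_all d x) = x"
proof -
  assume "cmod d = 1"
  then have "d * cnj d = 1" using complex_norm_square[of d] by simp
  then have "d * (cnj d * w) = w" for w by (simp flip: mult.assoc)
  then show ?thesis by (simp add: rotate_all_def vec_eq_iff)
qed

lemma expanding_rotated_translation:
  assumes "cmod d = 1" shows "expanding (\<lambda>x. rotate_all d (x + h))"
proof -
  have "expanding (rotate_all d)"
  proof (rule expanding_if_distr_eq)
    have "continuous_on UNIV (rotate_all d)"
      using linear_rotate_all linear_conv_bounded_linear linear_continuous_on by blast
    then show "rotate_all d \<in> borel_measurable borel" by (rule borel_measurable_continuous_onI)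
    show "distr lborel borel (rotate_all d) = lborel"
      using linear_rotate_all norm_rotate_all[OF assms] by (rule distr_lborel_isometry)
  qed
  then show ?thesis by (rule expanding_compose[OF _ expanding_translation])
qed

text \<open>
  In terms of the image \<open>w\<close> of \<open>x\<close> the displacement is
  \<open>(1 - d) * w + h\<close>, which is small wherever \<open>w\<close> is bounded.
\<close>

lemma near_id_rotated_translation:
  assumes "cmod d = 1" "cmod (1 - d) * R + norm h < \<delta>"
  shows "near_id R \<delta> (\<lambda>x. rotate_all d (x + h))"
  unfolding near_id_def
proof (intro allI impI)
  fix x assume R: "norm (rotate_all d (x + h)) \<le> R"
  define w where "w = rotate_all d (x + h)"
  have x: "x = rotate_all (cnj d) w - h" unfolding w_def rotate_all_back[OF assms(1)] by simp
  have "rotate_all d (x + h) - x = rotate_all (cnj (1 - d)) w + h"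
  proof -
    have "w - x = rotate_all (cnj (1 - d)) w + h"
      by (subst x) (simp add: rotate_all_def vec_eq_iff algebra_simps)
    then show ?thesis by (simp only: w_def)
  qed
  moreover have "norm (rotate_all (cnj (1 - d)) w) = cmod (1 - d) * norm w"
  proof -
    have "(norm (rotate_all (cnj (1 - d)) w))\<^sup>2 = (cmod (1 - d) * norm w)\<^sup>2"
      by (simp add: rotate_all_def norm_vec_def L2_set_def norm_mult power_mult_distrib sum_nonneg
          sum_distrib_left)
    then show ?thesis by (subst (asm) power2_eq_iff_nonneg) auto
  qed
  ultimately have "dist (rotate_all d (x + h)) x \<le> cmod (1 - d) * norm w + norm h"
    unfolding dist_norm using norm_triangle_ineq[of "rotate_all (cnj (1 - d)) w" h] by simp
  also have "\<dots> \<le> cmod (1 - d) * R + norm h"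
    using R by (intro add_right_mono mult_left_mono) (auto simp: w_def)
  finally show "dist (rotate_all d (x + h)) x < \<delta>" using assms(2) by simp
qed

lemma polynomial_function_rotated_translation: "polynomial_function (\<lambda>x. rotate_all d (x + h))"
proof -
  have "(\<lambda>x. rotate_all d (x + h)) = (\<lambda>x. rotate_all d x + rotate_all d h)"
    using linear_add[OF linear_rotate_all] by blast
  moreover have "bounded_linear (rotate_all d)"
    using linear_rotate_all linear_conv_bounded_linear by blast
  ultimately show ?thesis
    by (simp only:) (intro polynomial_function_add polynomial_function_const polynomial_function_bounded_linear)
qed

context power_grid
begin

definition pair_volt :: "'v \<Rightarrow> complex \<Rightarrow> complex \<Rightarrow> complex ^ 'v" where
  "pair_volt r u v = (\<chi> k. if k = r then u else v)"

context
  fixes r j :: 'v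
  assumes r: "par r = None" and j: "par j = Some r" and all: "UNIV = {r, j}"
begin

lemma rj: "r \<noteq> j" using r j by auto

lemma only_two: "k = r \<or> k = j" using all by blast

lemma Desc_last: "Desc j = {j}"
proof -
  have "r \<notin> Desc j" using Desc_par[of r j] r rj by auto
  then have "k \<in> Desc j \<longleftrightarrow> k = j" for k using only_two[of k] rj by (cases "k = j") simp_all
  then show ?thesis by blast
qed

lemma nbrs_two: "nbrs r = {None, Some j}" "nbrs j = {Some r}"
proof -
  have cr: "par k = Some r \<longleftrightarrow> k = j" for k by (metis only_two j r option.distinct(1))
  have cj: "par k \<noteq> Some j" for k by (metis only_two j r rj option.distinct(1) option.inject)
  have "b \<in> nbrs r \<longleftrightarrow> b \<in> {None, Some j}" "b \<in> nbrs j \<longleftrightarrow> b \<in> {Some r}" for b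
    unfolding nbrs_iff cr r j using cj by blast+
  then show "nbrs r = {None, Some j}" "nbrs j = {Some r}" by blast+
qed

text \<open>
  With two loads the active set is everything, all exponents are \<open>0\<close>, and freezing
  changes nothing; the formulas for a branch hold for \<open>\<Delta>\<close> itself.
\<close>

lemma Delta_pair:
  shows "branch_det (Ysum r) (y r None * cnj V0) (y r (Some j)) u v \<noteq> 0 \<Longrightarrow> Delta (pair_volt r u v) \<noteq> 0"
    and "leaf_det u v = 0 \<Longrightarrow> Re (cnj (y r (Some j)) * (y r None * cnj V0) * u) = 0 \<Longrightarrow> u \<noteq> 0
      \<Longrightarrow> Delta (pair_volt r u v) = 0"
proof -
  have K: "branch r j = UNIV" unfolding branch_def Desc_last using all by simp
  have ex: "exponent (branch r j) r (Some a) = 0" "row_exponent (branch r j) r a = 0" for a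
    by (simp_all add: exponent_def row_exponent_def K r)
  have "rescaled (branch r j) r 0 U = U" for U by (simp add: rescaled_def ex vec_eq_iff)
  then have D: "Delta U = frozen_Delta (branch r j) r U" for U
    using Delta_rescaled[OF active_branch[OF j], of 0 U]
    by (simp add: scale_factor_def ex frozen_Delta_def)
  have U: "pair_volt r u v $ a = v" if "a \<in> Desc j" for a
    using that rj by (simp add: Desc_last pair_volt_def)
  have s: "source (pair_volt r u v) r = y r None * cnj V0" by (simp add: source_def r bus_voltage_def)
  have ur: "pair_volt r u v $ r = u" by (simp add: pair_volt_def)
  note fb = frozen_branch[OF j, of "pair_volt r u v" v, OF U, unfolded s ur, folded D]
  show "branch_det (Ysum r) (y r None * cnj V0) (y r (Some j)) u v \<noteq> 0 \<Longrightarrow> Delta (pair_volt r u v) \<noteq> 0"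
    by (rule fb(1)) (auto simp: Desc_last K)
  show "leaf_det u v = 0 \<Longrightarrow> Re (cnj (y r (Some j)) * (y r None * cnj V0) * u) = 0 \<Longrightarrow> u \<noteq> 0
      \<Longrightarrow> Delta (pair_volt r u v) = 0"
    by (rule fb(2)) (auto simp: Desc_last K)
qed

text \<open>
  Shift the voltages by \<open>\<eta>\<close> and \<open>- a\<close>, then rotate both. The
  injection at \<open>j\<close> is invariant under rotations and hence depends on \<open>a\<close>
  and \<open>\<eta>\<close> only. The one at \<open>r\<close> involves the substation, whose voltage
  does not rotate; it depends on \<open>\<eta>\<close> and on \<open>a + d * pivot\<close> (see
  \<open>F_turn_root\<close>), so that a rotation can be traded for a shift of
  \<open>V\<^sub>j\<close>.
\<close>

definition turn :: "complex \<Rightarrow> complex \<Rightarrow> complex \<Rightarrow> complex ^ 'v \<Rightarrow> complex ^ 'v" where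
  "turn d \<eta> a x = rotate_all d (x + pair_volt r \<eta> (- a))"

definition pivot :: complex where
  "pivot = - cnj (y r None * cnj V0) / cnj (y r (Some j))"

text \<open>
  In the triples at \<open>0\<close> of the two lists, the rotations \<open>d\<close>, the shifts
  \<open>a\<close>, and the sums \<open>a + d * pivot\<close> are the same up to order, and likewise
  at \<open>\<eta>\<close>. As a function that ignores \<open>V\<^sub>r\<close> may depend on
  \<open>d\<close> and \<open>a\<close> together, the triples at \<open>\<eta>\<close> repeat those
  at \<open>0\<close> with the two sides exchanged.
\<close>

definition turn_left :: "complex \<Rightarrow> complex \<Rightarrow> complex \<Rightarrow> (complex ^ 'v \<Rightarrow> complex ^ 'v) list" where
  "turn_left \<zeta> w \<eta> = [turn 1 0 0, turn w 0 ((1 - \<zeta>) * pivot), turn \<zeta> 0 ((w - \<zeta>) * pivot),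
     turn \<zeta> \<eta> ((1 - \<zeta>) * pivot), turn 1 \<eta> ((w - \<zeta>) * pivot), turn w \<eta> 0]"

definition turn_right :: "complex \<Rightarrow> complex \<Rightarrow> complex \<Rightarrow> (complex ^ 'v \<Rightarrow> complex ^ 'v) list" where
  "turn_right \<zeta> w \<eta> = [turn \<zeta> 0 ((1 - \<zeta>) * pivot), turn 1 0 ((w - \<zeta>) * pivot), turn w 0 0,
     turn 1 \<eta> 0, turn w \<eta> ((1 - \<zeta>) * pivot), turn \<zeta> \<eta> ((w - \<zeta>) * pivot)]"

definition turn_neutral :: "(complex ^ 'v \<Rightarrow> real) \<Rightarrow> bool" where
  "turn_neutral g \<longleftrightarrow> (\<forall>\<zeta> w \<eta>. cmod \<zeta> = 1 \<longrightarrow> cmod w = 1 \<longrightarrow>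
     balanced 6 (\<lambda>k. turn_left \<zeta> w \<eta> ! k) (\<lambda>k. turn_right \<zeta> w \<eta> ! k) g)"

lemma turn_nth: "turn d \<eta> a x $ r = cnj d * (x $ r + \<eta>)" "turn d \<eta> a x $ j = cnj d * (x $ j - a)"
  using rj by (simp_all add: turn_def rotate_all_def pair_volt_def)

lemma turn_neutral_mult: "turn_neutral g \<Longrightarrow> turn_neutral h \<Longrightarrow> turn_neutral (\<lambda>x. g x * h x)"
  unfolding turn_neutral_def by (blast intro: balanced_mult)

lemma turn_neutral_free:
  assumes "free_of j g \<or> free_of r g" shows "turn_neutral g"
  unfolding turn_neutral_def balanced_def
proof (intro allI impI)
  fix \<zeta> w \<eta> x
  have "turn d \<eta> a x = upd (turn d \<eta> 0 x) j (turn d \<eta> a x $ j)" for d \<eta> a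
    unfolding vec_eq_iff
  proof
    fix k show "turn d \<eta> a x $ k = upd (turn d \<eta> 0 x) j (turn d \<eta> a x $ j) $ k"
      using only_two[of k] rj by (auto simp: turn_nth)
  qed
  then have 1: "g (turn d \<eta> a x) = g (turn d \<eta> 0 x)" if "free_of j g" for d \<eta> a
    using that by (metis free_of_def)
  have "turn d \<eta> a x = upd (turn d 0 a x) r (turn d \<eta> a x $ r)" for d \<eta> a
    unfolding vec_eq_iff
  proof
    fix k show "turn d \<eta> a x $ k = upd (turn d 0 a x) r (turn d \<eta> a x $ r) $ k"
      using only_two[of k] rj by (auto simp: turn_nth)
  qed
  then have 2: "g (turn d \<eta> a x) = g (turn d 0 a x)" if "free_of r g" for d \<eta> a
    using that by (metis free_of_def)
  consider (G1) G where "\<And>d \<eta> a. g (turn d \<eta> a x) = G d \<eta>" | (G2) G where "\<And>d \<eta> a. g (turn d \<eta> a x) = G d a"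
    using assms
  proof (elim disjE)
    assume "free_of j g"
    then show thesis by (intro that(1)[of "\<lambda>d \<eta>. g (turn d \<eta> 0 x)"] 1)
  next
    assume "free_of r g"
    then show thesis by (intro that(2)[of "\<lambda>d a. g (turn d 0 a x)"] 2)
  qed
  then show "(\<Prod>k<6. g ((turn_left \<zeta> w \<eta> ! k) x)) = (\<Prod>k<6. g ((turn_right \<zeta> w \<eta> ! k) x))"
    by cases (simp_all add: turn_left_def turn_right_def prod_six)
qed

lemma F_turn_leaf:
  assumes "cmod d = 1"
  shows "F (turn d \<eta> a x) $ j = y r (Some j) * ((x $ j - a) * cnj (x $ j - a - x $ r - \<eta>))"
proof -
  have d: "d * cnj d = 1" using complex_norm_square[of d] assms by simp
  have "F (turn d \<eta> a x) $ j = y r (Some j) * ((d * cnj d) * ((x $ j - a) * cnj (x $ j - a - x $ r - \<eta>)))"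
    by (simp add: F_nth nbrs_two bus_voltage_def turn_nth y_sym[of j r] algebra_simps)
  then show ?thesis by (simp add: d)
qed

lemma F_turn_root:
  assumes "cmod d = 1"
  shows "F (turn d \<eta> a x) $ r = (x $ r + \<eta>) * (Ysum r * cnj (x $ r + \<eta>) - y r (Some j) * cnj (x $ j)
     + y r (Some j) * cnj (a + d * pivot))"
proof -
  have d: "d * cnj d = 1" using complex_norm_square[of d] assms by simp
  have yj: "y r (Some j) \<noteq> 0" using y_ne[of "Some j" r] by (simp add: nbrs_two)
  have p: "y r (Some j) * cnj (d * pivot) = - (cnj d * (y r None * cnj V0))"
    using yj by (simp add: pivot_def)
  have "F (turn d \<eta> a x) $ r = (x $ r + \<eta>) * ((d * cnj d) * (Ysum r * cnj (x $ r + \<eta>) - y r (Some j) * cnj (x $ j - a))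
      - cnj d * (y r None * cnj V0))"
    unfolding F_eq by (simp add: nbrs_two bus_voltage_def turn_nth algebra_simps)
  then show ?thesis
    unfolding d complex_cnj_add distrib_left[of _ "cnj a"] p by (simp add: algebra_simps)
qed

lemma turn_neutral_injection: "turn_neutral (\<lambda>x. g (F x $ k))"
  unfolding turn_neutral_def balanced_def
proof (intro allI impI)
  fix \<zeta> w \<eta> x assume zw: "cmod \<zeta> = 1" "cmod w = 1"
  show "(\<Prod>k'<6. g (F ((turn_left \<zeta> w \<eta> ! k') x) $ k)) = (\<Prod>k'<6. g (F ((turn_right \<zeta> w \<eta> ! k') x) $ k))"
    using only_two[of k]
  proof
    assume k: "k = j"
    have "g (F (turn d \<eta> a x) $ k) =
        (\<lambda>a \<eta>. g (y r (Some j) * ((x $ j - a) * cnj (x $ j - a - x $ r - \<eta>)))) a \<eta>" if "cmod d = 1" for d \<eta> a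
      using F_turn_leaf[OF that] k by simp
    then obtain G where "\<And>d \<eta> a. cmod d = 1 \<Longrightarrow> g (F (turn d \<eta> a x) $ k) = G a \<eta>"
      by (rule that)
    then show ?thesis using zw by (simp add: turn_left_def turn_right_def prod_six)
  next
    assume k: "k = r"
    have "g (F (turn d \<eta> a x) $ k) = (\<lambda>b \<eta>. g ((x $ r + \<eta>) * (Ysum r * cnj (x $ r + \<eta>) - y r (Some j) * cnj (x $ j)
     + y r (Some j) * cnj b))) (a + d * pivot) \<eta>" if "cmod d = 1" for d \<eta> a
      using F_turn_root[OF that] k by simp
    then obtain G where G: "\<And>d \<eta> a. cmod d = 1 \<Longrightarrow> g (F (turn d \<eta> a x) $ k) = G (a + d * pivot) \<eta>"
      by (rule that)
    have e: "(1 - \<zeta>) * pivot + w * pivot = (1 + w - \<zeta>) * pivot" "(w - \<zeta>) * pivot + \<zeta> * pivot = w * pivot"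
       "(1 - \<zeta>) * pivot + \<zeta> * pivot = pivot" "(w - \<zeta>) * pivot + pivot = (1 + w - \<zeta>) * pivot"
      by (simp_all add: algebra_simps)
    show ?thesis using zw by (simp add: turn_left_def turn_right_def prod_six G e)
  qed
qed

lemma turn_pair: "turn d \<eta> a (pair_volt r u v) = pair_volt r (cnj d * (u + \<eta>)) (cnj d * (v - a))"
  unfolding vec_eq_iff
proof
  fix k show "turn d \<eta> a (pair_volt r u v) $ k = pair_volt r (cnj d * (u + \<eta>)) (cnj d * (v - a)) $ k"
    by (simp add: turn_def rotate_all_def pair_volt_def algebra_simps)
qed

text \<open>
  Unlike in the case of translations, only the displacement \<open>\<eta>\<close> can be rescaled at
  the end; the rotations have to remain small.
\<close>

lemma turn_identity:
  assumes sep: "log_separable W f r j"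
  shows "\<exists>\<delta>>0. \<forall>\<zeta> w x \<eta>. cmod \<zeta> = 1 \<longrightarrow> cmod w = 1 \<longrightarrow> cmod (1 - \<zeta>) < \<delta> \<longrightarrow> cmod (1 - w) < \<delta> \<longrightarrow>
    (\<Prod>k<6. (Delta ((turn_left \<zeta> w \<eta> ! k) x))\<^sup>2) = (\<Prod>k<6. (Delta ((turn_right \<zeta> w \<eta> ! k) x))\<^sup>2)"
proof -
  obtain \<alpha> \<beta> where W: "W \<in> sets borel" "emeasure lborel W > 0" and free: "free_of j \<alpha>" "free_of r \<beta>"
    and fact: "\<And>x. x \<in> W \<Longrightarrow> \<bar>Delta x\<bar> * (\<Prod>k\<in>UNIV. f k (F x $ k)) = \<alpha> x * \<beta> x \<and> (\<Prod>k\<in>UNIV. f k (F x $ k)) \<noteq> 0"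
    using sep unfolding log_separable_def by blast
  have U: "(\<Prod>k\<in>UNIV. f k (F x $ k)) = f r (F x $ r) * f j (F x $ j)" for x
    unfolding all using rj by simp
  have A: "turn_neutral (\<lambda>x. \<Prod>k\<in>UNIV. f k (F x $ k))"
    unfolding U by (intro turn_neutral_mult turn_neutral_injection)
  have B: "turn_neutral (\<lambda>x. \<alpha> x * \<beta> x)"
    using free by (intro turn_neutral_mult turn_neutral_free) auto
  obtain R \<delta> where \<delta>: "\<delta> > 0" and cyc: "\<And>T T'. small_moves 6 R \<delta> T \<Longrightarrow> small_moves 6 R \<delta> T'
      \<Longrightarrow> balanced 6 T T' (\<lambda>x. \<Prod>k\<in>UNIV. f k (F x $ k)) \<Longrightarrow> balanced 6 T T' (\<lambda>x. \<alpha> x * \<beta> x)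
      \<Longrightarrow> balanced 6 T T' (\<lambda>x. (Delta x)\<^sup>2)"
    by (rule cycle_identity[OF real_polynomial_function_Delta W fact]) (assumption | rule that)+
  define N where "N = \<bar>R\<bar> + 2 * cmod pivot + 1"
  have N: "N > 0" unfolding N_def using abs_ge_zero[of R] norm_ge_zero[of pivot] by linarith
  define \<delta>' where "\<delta>' = \<delta> / (2 * N)"
  have \<delta>': "\<delta>' > 0" "\<delta>' * N = \<delta> / 2" using \<delta> N by (simp_all add: \<delta>'_def)
  have good: "expanding (turn d \<eta> a) \<and> near_id R \<delta> (turn d \<eta> a) \<and> polynomial_function (turn d \<eta> a)"
    if d: "cmod d = 1" "cmod (1 - d) \<le> \<delta>'" and a: "cmod a \<le> \<delta>' * (2 * cmod pivot)" and \<eta>: "cmod \<eta> < \<delta> / 4" for d \<eta> a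
  proof -
    have "norm (pair_volt r \<eta> (- a)) \<le> (\<Sum>k\<in>UNIV. norm (pair_volt r \<eta> (- a) $ k))"
      unfolding norm_vec_def by (rule L2_set_le_sum) simp
    also have "\<dots> = cmod \<eta> + cmod a" unfolding all using rj by (simp add: pair_volt_def)
    finally have h: "norm (pair_volt r \<eta> (- a)) \<le> cmod \<eta> + cmod a" .
    have "cmod (1 - d) * R \<le> cmod (1 - d) * \<bar>R\<bar>" by (rule mult_left_mono) auto
    also have "\<dots> \<le> \<delta>' * \<bar>R\<bar>" using d(2) by (rule mult_right_mono) simp
    finally have "cmod (1 - d) * R \<le> \<delta>' * \<bar>R\<bar>" .
    then have "cmod (1 - d) * R + norm (pair_volt r \<eta> (- a)) < \<delta>' * N + \<delta> / 4"
      using h a \<eta> \<delta>'(1) by (simp add: N_def distrib_left)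
    then have "cmod (1 - d) * R + norm (pair_volt r \<eta> (- a)) < \<delta>" using \<delta>'(2) \<delta> by simp
    then show ?thesis
      unfolding turn_def[abs_def]
      by (intro conjI expanding_rotated_translation near_id_rotated_translation
          polynomial_function_rotated_translation d(1))
  qed
  show ?thesis
  proof (rule exI[of _ \<delta>'], intro conjI \<delta>'(1) allI impI)
    fix \<zeta> w x \<eta>
    assume u: "cmod \<zeta> = 1" "cmod w = 1" and sm: "cmod (1 - \<zeta>) < \<delta>'" "cmod (1 - w) < \<delta>'"
    have a1: "cmod ((1 - \<zeta>) * pivot) \<le> \<delta>' * (2 * cmod pivot)"
    proof -
      have "cmod (1 - \<zeta>) * cmod pivot \<le> (2 * \<delta>') * cmod pivot" using sm \<delta>' by (intro mult_right_mono) auto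
      then show ?thesis by (simp add: norm_mult)
    qed
    have a2: "cmod ((w - \<zeta>) * pivot) \<le> \<delta>' * (2 * cmod pivot)"
    proof -
      have "cmod (w - \<zeta>) \<le> cmod (1 - \<zeta>) + cmod (1 - w)"
        using norm_triangle_ineq4[of "1 - \<zeta>" "1 - w"] by simp
      then have "cmod (w - \<zeta>) * cmod pivot \<le> (2 * \<delta>') * cmod pivot" using sm by (intro mult_right_mono) auto
      then show ?thesis by (simp add: norm_mult)
    qed
    have small: "(\<Prod>k<6. (Delta ((turn_left \<zeta> w (of_real t * \<eta>) ! k) x))\<^sup>2)
        - (\<Prod>k<6. (Delta ((turn_right \<zeta> w (of_real t * \<eta>) ! k) x))\<^sup>2) = 0"
      if t: "0 < t" "t < \<delta> / (4 * (cmod \<eta> + 1))" for t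
    proof -
      have "t * (4 * (cmod \<eta> + 1)) < \<delta>" using t(2) by (simp add: pos_less_divide_eq add_nonneg_pos)
      then have e: "cmod (of_real t * \<eta>) < \<delta> / 4" using t(1) by (simp add: norm_mult algebra_simps)
      have "small_moves 6 R \<delta> (\<lambda>k. turn_left \<zeta> w (of_real t * \<eta>) ! k)"
        "small_moves 6 R \<delta> (\<lambda>k. turn_right \<zeta> w (of_real t * \<eta>) ! k)"
        unfolding small_moves_def turn_left_def turn_right_def all_less_six
        using e \<delta> \<delta>'(1) sm u a1 a2 by (simp_all add: good less_imp_le)
      then have "balanced 6 (\<lambda>k. turn_left \<zeta> w (of_real t * \<eta>) ! k) (\<lambda>k. turn_right \<zeta> w (of_real t * \<eta>) ! k) (\<lambda>x. (Delta x)\<^sup>2)"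
        by (rule cyc) (use A B u in \<open>simp_all add: turn_neutral_def\<close>)
      then show ?thesis by (simp add: balanced_def)
    qed
    have lin: "turn d (of_real t * \<eta>) a x = turn d 0 a x + t *\<^sub>R rotate_all d (pair_volt r \<eta> 0)" for d a t
      by (simp add: turn_def rotate_all_def pair_volt_def vec_eq_iff scaleR_conv_of_real[where 'a = complex] algebra_simps)
    have poly: "real_polynomial_function (\<lambda>t. (Delta (turn d (of_real t * \<eta>) a x))\<^sup>2)"
      "real_polynomial_function (\<lambda>t::real. (Delta (turn d 0 a x))\<^sup>2)" for d a
      unfolding lin by (intro real_polynomial_function_power real_polynomial_function_Delta_line
          real_polynomial_function.intros(2))+
    define P where "P t = (\<Prod>k<6. (Delta ((turn_left \<zeta> w (of_real t * \<eta>) ! k) x))\<^sup>2)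
        - (\<Prod>k<6. (Delta ((turn_right \<zeta> w (of_real t * \<eta>) ! k) x))\<^sup>2)" for t
    have "real_polynomial_function P"
      unfolding P_def[abs_def] prod_six turn_left_def turn_right_def
      by simp (intro real_polynomial_function_diff real_polynomial_function.intros(4) poly)
    moreover have "infinite {t. P (0 + t *\<^sub>R 1) = 0}"
    proof -
      have "{0<..<\<delta> / (4 * (cmod \<eta> + 1))} \<subseteq> {t. P (0 + t *\<^sub>R 1) = 0}" using small by (auto simp: P_def)
      moreover have "0 < \<delta> / (4 * (cmod \<eta> + 1))" using \<delta> by (simp add: add_nonneg_pos)
      then have "infinite {0<..<\<delta> / (4 * (cmod \<eta> + 1))}" by (rule infinite_Ioo)
      ultimately show ?thesis using finite_subset by blast
    qed
    ultimately have "P (0 + 1 *\<^sub>R 1) = 0" by (rule real_polynomial_function_on_line)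
    then show "(\<Prod>k<6. (Delta ((turn_left \<zeta> w \<eta> ! k) x))\<^sup>2) = (\<Prod>k<6. (Delta ((turn_right \<zeta> w \<eta> ! k) x))\<^sup>2)"
      by (simp add: P_def)
  qed
qed

text \<open>
  Take \<open>\<zeta> = cis \<theta>\<close>, \<open>w = cnj \<zeta>\<close>, start at the leaf
  voltage \<open>(1 - \<zeta>) * pivot\<close>, and let \<open>u\<close> be the centre voltage in
  the direction \<open>\<i> * y * cnj s\<close> for which the leaf equation is singular there. Then
  \<open>branch_det\<close> vanishes at the starting point. On the other side, the three points at
  \<open>u\<close> give explicit nonzero values, and the three points at a fixed \<open>u'\<close>
  tend to centre voltage \<open>u'\<close> and leaf voltage \<open>0\<close> as
  \<open>\<theta> \<rightarrow> 0\<close>, where \<open>branch_det\<close> is nonzero.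
\<close>

lemma two_loads_not_log_separable:
  assumes sep: "log_separable W f r j" and V0: "V0 \<noteq> 0"
  shows False
proof -
  let ?Y = "Ysum r" and ?s = "y r None * cnj V0" and ?y = "y r (Some j)"
  have yj: "?y \<noteq> 0" and s: "?s \<noteq> 0" using y_ne[of "Some j" r] y_ne[of None r] V0 by (simp_all add: nbrs_two)
  have piv: "pivot \<noteq> 0" using s yj by (simp add: pivot_def)
  obtain \<delta> where \<delta>: "\<delta> > 0" and id: "\<forall>\<zeta> w x \<eta>. cmod \<zeta> = 1 \<longrightarrow> cmod w = 1 \<longrightarrow> cmod (1 - \<zeta>) < \<delta> \<longrightarrow> cmod (1 - w) < \<delta> \<longrightarrow>
    (\<Prod>k<6. (Delta ((turn_left \<zeta> w \<eta> ! k) x))\<^sup>2) = (\<Prod>k<6. (Delta ((turn_right \<zeta> w \<eta> ! k) x))\<^sup>2)"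
    using turn_identity[OF sep] by (elim exE conjE) (rule that)
  \<comment> \<open>Small enough that the feeding current dominates the total admittance (fact \<open>u'C\<close>).\<close>
  define u' where "u' = (of_real (cmod ?s / (4 * (cmod ?Y + 1))) :: complex)"
  define u where "u \<theta> = \<i> * of_real (2 * sin \<theta> / (cmod ?y)\<^sup>2) * (?y * cnj ?s)" for \<theta>
  define \<omega> where "\<omega> \<theta> = (1 - cis \<theta>) * pivot" for \<theta>
  have C: "(cmod ?s)\<^sup>2 - 2 * Re (cnj ?Y * ?s * x) > 0" if "2 * cmod ?Y * cmod x < cmod ?s" for x
  proof -
    have "2 * Re (cnj ?Y * ?s * x) \<le> cmod ?s * (2 * cmod ?Y * cmod x)"
    proof -
      have "2 * Re (cnj ?Y * ?s * x) \<le> 2 * cmod (cnj ?Y * ?s * x)"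
        by (rule mult_left_mono[OF complex_Re_le_cmod]) simp
      also have "\<dots> = cmod ?s * (2 * cmod ?Y * cmod x)" by (simp add: norm_mult)
      finally show ?thesis .
    qed
    also have "\<dots> < cmod ?s * cmod ?s" using that s by (intro mult_strict_left_mono) auto
    finally show ?thesis by (simp add: power2_eq_square)
  qed
  have u'0: "u' \<noteq> 0" and u'C: "2 * cmod ?Y * cmod u' < cmod ?s"
  proof -
    have p: "0 < 4 * (cmod ?Y + 1)" by (simp add: add_nonneg_pos)
    then show "u' \<noteq> 0" using s unfolding u'_def of_real_eq_0_iff by simp
    have "cmod u' = cmod ?s / (4 * (cmod ?Y + 1))" using p by (simp only: u'_def norm_of_real) simp
    then have "2 * cmod ?Y * cmod u' = cmod ?s * (2 * cmod ?Y) / (4 * (cmod ?Y + 1))" by simp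
    also have "\<dots> < cmod ?s"
    proof -
      have "2 * x < 4 * (x + 1)" if "x \<ge> 0" for x :: real using that by simp
      then have "2 * cmod ?Y < 4 * (cmod ?Y + 1)" using norm_ge_zero by blast
      then have "cmod ?s * (2 * cmod ?Y) < cmod ?s * (4 * (cmod ?Y + 1))"
        using s by (intro mult_strict_left_mono) auto
      then show ?thesis using p by (simp only: pos_divide_less_eq)
    qed
    finally show "2 * cmod ?Y * cmod u' < cmod ?s" .
  qed
  have P0: "branch_det ?Y ?s ?y x 0 \<noteq> 0" if "x \<noteq> 0" "2 * cmod ?Y * cmod x < cmod ?s" for x
    using C[OF that(2)] that(1) by (simp add: branch_det_def leaf_det_def)
  have lim: "eventually (\<lambda>\<theta>. branch_det ?Y ?s ?y (g \<theta>) (h \<theta>) \<noteq> 0) (at_right 0)"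
    if g: "(g \<longlongrightarrow> u') (at_right 0)" and h: "(h \<longlongrightarrow> 0) (at_right 0)" for g h :: "real \<Rightarrow> complex"
  proof -
    have "((\<lambda>\<theta>. branch_det ?Y ?s ?y (g \<theta>) (h \<theta>)) \<longlongrightarrow> branch_det ?Y ?s ?y u' 0) (at_right 0)"
      unfolding branch_det_def leaf_det_def by (intro tendsto_intros g h)
    then show ?thesis using P0[OF u'0 u'C] by (rule tendsto_imp_eventually_ne)
  qed
  have cis0: "(cis \<longlongrightarrow> 1) (at_right 0)"
  proof -
    have "isCont cis 0" using continuous_on_cis[OF continuous_on_id[of UNIV]]
      by (simp add: continuous_on_eq_continuous_at)
    then have "(cis \<longlongrightarrow> cis 0) (at 0)" by (simp add: isCont_def)
    then show ?thesis using filterlim_at_split[of cis "nhds 1" 0] by simp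
  qed
  have om0: "(\<omega> \<longlongrightarrow> 0) (at_right 0)"
  proof -
    have "(\<omega> \<longlongrightarrow> (1 - 1) * pivot) (at_right 0)"
      unfolding \<omega>_def[abs_def] by (intro tendsto_intros cis0)
    then show ?thesis by simp
  qed
  have u0: "(u \<longlongrightarrow> 0) (at_right 0)"
  proof -
    have "(sin \<longlongrightarrow> (0::real)) (at_right 0)" using tendsto_sin[OF tendsto_ident_at, of 0 "{0<..}"] by simp
    then have "(u \<longlongrightarrow> \<i> * of_real (2 * 0 / (cmod ?y)\<^sup>2) * (?y * cnj ?s)) (at_right 0)"
      unfolding u_def[abs_def] by (intro tendsto_intros) (use yj in simp_all)
    then show ?thesis by simp
  qed
  have "((\<lambda>\<theta>. cis \<theta> * u') \<longlongrightarrow> 1 * u') (at_right 0)" by (intro tendsto_intros cis0)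
  then have cu: "((\<lambda>\<theta>. cis \<theta> * u') \<longlongrightarrow> u') (at_right 0)" by simp
  have "((\<lambda>\<theta>. cnj (cis \<theta>) * u') \<longlongrightarrow> cnj 1 * u') (at_right 0)" by (intro tendsto_intros tendsto_cnj cis0)
  then have ccu: "((\<lambda>\<theta>. cnj (cis \<theta>) * u') \<longlongrightarrow> u') (at_right 0)" by simp
  have "((\<lambda>\<theta>. cnj (cis \<theta>) * ((1 - cnj (cis \<theta>)) * pivot)) \<longlongrightarrow> cnj 1 * ((1 - cnj 1) * pivot)) (at_right 0)"
    by (intro tendsto_intros tendsto_cnj cis0)
  then have cco: "((\<lambda>\<theta>. cnj (cis \<theta>) * ((1 - cnj (cis \<theta>)) * pivot)) \<longlongrightarrow> 0) (at_right 0)" by simp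
  have ev: "eventually (\<lambda>\<theta>. 0 < \<theta> \<and> \<theta> < pi \<and> cmod (1 - cis \<theta>) < \<delta> \<and> 2 * cmod ?Y * cmod (u \<theta>) < cmod ?s \<and>
      branch_det ?Y ?s ?y u' (\<omega> \<theta>) \<noteq> 0 \<and> branch_det ?Y ?s ?y (cis \<theta> * u') 0 \<noteq> 0 \<and>
      branch_det ?Y ?s ?y (cnj (cis \<theta>) * u') (cnj (cis \<theta>) * ((1 - cnj (cis \<theta>)) * pivot)) \<noteq> 0) (at_right 0)"
  proof (intro eventually_conj)
    show "eventually (\<lambda>\<theta>::real. 0 < \<theta>) (at_right 0)" by (simp add: eventually_at_right_less)
    show "eventually (\<lambda>\<theta>::real. \<theta> < pi) (at_right 0)"
      using eventually_at_right_real[of 0 pi] by (simp add: eventually_mono)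
    have "((\<lambda>\<theta>. cmod (1 - cis \<theta>)) \<longlongrightarrow> cmod (1 - 1)) (at_right 0)" by (intro tendsto_intros cis0)
    then have "((\<lambda>\<theta>. cmod (1 - cis \<theta>)) \<longlongrightarrow> 0) (at_right 0)" by simp
    then show "eventually (\<lambda>\<theta>. cmod (1 - cis \<theta>) < \<delta>) (at_right 0)" using \<delta> by (rule order_tendstoD(2))
    have "((\<lambda>\<theta>. 2 * cmod ?Y * cmod (u \<theta>)) \<longlongrightarrow> 2 * cmod ?Y * cmod 0) (at_right 0)"
      by (intro tendsto_intros u0)
    then have "((\<lambda>\<theta>. 2 * cmod ?Y * cmod (u \<theta>)) \<longlongrightarrow> 0) (at_right 0)" by simp
    then show "eventually (\<lambda>\<theta>. 2 * cmod ?Y * cmod (u \<theta>) < cmod ?s) (at_right 0)"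
      using s by (intro order_tendstoD(2)) auto
    show "eventually (\<lambda>\<theta>. branch_det ?Y ?s ?y u' (\<omega> \<theta>) \<noteq> 0) (at_right 0)" by (intro lim om0 tendsto_const)
    show "eventually (\<lambda>\<theta>. branch_det ?Y ?s ?y (cis \<theta> * u') 0 \<noteq> 0) (at_right 0)"
      by (rule lim[OF cu tendsto_const])
    show "eventually (\<lambda>\<theta>. branch_det ?Y ?s ?y (cnj (cis \<theta>) * u') (cnj (cis \<theta>) * ((1 - cnj (cis \<theta>)) * pivot)) \<noteq> 0) (at_right 0)"
      by (rule lim[OF ccu cco])
  qed
  obtain \<theta> where \<theta>: "0 < \<theta>" "\<theta> < pi" "cmod (1 - cis \<theta>) < \<delta>" "2 * cmod ?Y * cmod (u \<theta>) < cmod ?s"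
    "branch_det ?Y ?s ?y u' (\<omega> \<theta>) \<noteq> 0" "branch_det ?Y ?s ?y (cis \<theta> * u') 0 \<noteq> 0"
    "branch_det ?Y ?s ?y (cnj (cis \<theta>) * u') (cnj (cis \<theta>) * ((1 - cnj (cis \<theta>)) * pivot)) \<noteq> 0"
    using eventually_happens'[OF trivial_limit_at_right_real ev] by (elim exE conjE) (rule that)
  define \<zeta> where "\<zeta> = cis \<theta>"
  define uu where "uu = u \<theta>"
  have sin: "sin \<theta> > 0" using \<theta> by (intro sin_gt_zero)
  have z1: "cmod \<zeta> = 1" by (simp add: \<zeta>_def)
  have zz: "\<zeta> * cnj \<zeta> = 1" using complex_norm_square[of \<zeta>] z1 by simp
  have zne: "\<zeta> \<noteq> 1" "\<zeta> \<noteq> 0" using sin z1 by (auto simp: \<zeta>_def complex_eq_iff)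
  have cz: "cmod (1 - cnj \<zeta>) = cmod (1 - \<zeta>)" by (metis complex_cnj_diff complex_cnj_one complex_mod_cnj)
  define t where "t = 2 * sin \<theta> / (cmod ?y)\<^sup>2"
  have t: "t > 0" "t * (cmod ?y)\<^sup>2 = 2 * sin \<theta>" using sin yj by (simp_all add: t_def)
  have uu: "uu = \<i> * of_real t * (?y * cnj ?s)" by (simp add: uu_def u_def t_def)
  have uu0: "uu \<noteq> 0" using t(1) yj s by (simp add: uu)
  have usq: "(cmod uu)\<^sup>2 = t * (2 * sin \<theta>) * (cmod ?s)\<^sup>2"
    unfolding t(2)[symmetric] uu using t(1) by (simp add: norm_mult power_mult_distrib power2_eq_square)
  have piv_u: "pivot * cnj uu = \<i> * of_real (t * (cmod ?s)\<^sup>2)"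
  proof -
    have "pivot * cnj uu = \<i> * of_real t * (?s * cnj ?s)" using yj by (simp add: pivot_def uu)
    then show ?thesis by (simp only: complex_norm_square of_real_mult mult.assoc)
  qed
  have Qgen: "leaf_det uu ((1 - x) * pivot) = (cmod uu)\<^sup>2 - 2 * t * (cmod ?s)\<^sup>2 * Im x" for x
  proof -
    have "(1 - x) * pivot * cnj uu = (1 - x) * (\<i> * of_real (t * (cmod ?s)\<^sup>2))"
      by (simp only: mult.assoc piv_u)
    also have "\<dots> = of_real (t * (cmod ?s)\<^sup>2) * (\<i> * (1 - x))" by (simp only: mult_ac)
    finally show ?thesis unfolding leaf_det_def by (simp only: Re_of_real_mult) simp
  qed
  have Q1: "leaf_det uu ((1 - \<zeta>) * pivot) = 0" by (simp add: Qgen usq \<zeta>_def)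
  have Q2: "leaf_det uu ((1 - cnj \<zeta>) * pivot) = 4 * t * sin \<theta> * (cmod ?s)\<^sup>2" by (simp add: Qgen usq \<zeta>_def)
  have Egen: "Re (cnj ?y * ?s * (x * uu)) = - (2 * sin \<theta> * (cmod ?s)\<^sup>2) * Im x" for x
  proof -
    have "cnj ?y * ?s * (x * uu) = of_real t * (?y * cnj ?y) * (?s * cnj ?s) * (\<i> * x)" by (simp add: uu)
    also have "\<dots> = of_real (t * (cmod ?y)\<^sup>2 * (cmod ?s)\<^sup>2) * (\<i> * x)"
      by (simp only: complex_norm_square of_real_mult)
    finally show ?thesis unfolding t(2) by (simp only: Re_of_real_mult) simp
  qed
  have E1: "Re (cnj ?y * ?s * uu) = 0" using Egen[of 1] by simp
  have Cz: "2 * cmod ?Y * cmod (x * uu) < cmod ?s" if "cmod x = 1" for x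
    using \<theta>(4) that by (simp add: norm_mult uu_def)
  have R1: "Delta (pair_volt r (cnj \<zeta> * uu) 0) \<noteq> 0"
    using zne uu0 z1 by (intro Delta_pair(1) P0 Cz) auto
  have R2: "Delta (pair_volt r uu ((1 - cnj \<zeta>) * pivot)) \<noteq> 0"
  proof (rule Delta_pair(1))
    have "(cmod ?s)\<^sup>2 - 2 * Re (cnj ?Y * ?s * uu) > 0" using C Cz[of 1] by simp
    then show "branch_det ?Y ?s ?y uu ((1 - cnj \<zeta>) * pivot) \<noteq> 0"
      unfolding branch_det_def Q2 E1 using t(1) sin s by simp
  qed
  have R3: "Delta (pair_volt r (\<zeta> * uu) (\<zeta> * ((1 - \<zeta>) * pivot))) \<noteq> 0"
  proof (rule Delta_pair(1))
    have "leaf_det (\<zeta> * uu) (\<zeta> * ((1 - \<zeta>) * pivot)) = leaf_det uu ((1 - \<zeta>) * pivot)"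
    proof -
      have "\<zeta> * ((1 - \<zeta>) * pivot) * cnj (\<zeta> * uu) = (\<zeta> * cnj \<zeta>) * ((1 - \<zeta>) * pivot * cnj uu)" by simp
      then have "Re (\<zeta> * ((1 - \<zeta>) * pivot) * cnj (\<zeta> * uu)) = Re ((1 - \<zeta>) * pivot * cnj uu)"
        by (simp only: zz mult_1_left)
      then show ?thesis unfolding leaf_det_def norm_mult z1 by (simp only: mult_1_left)
    qed
    then have "leaf_det (\<zeta> * uu) (\<zeta> * ((1 - \<zeta>) * pivot)) = 0" using Q1 by simp
    moreover have "Re (cnj ?y * ?s * (\<zeta> * uu)) \<noteq> 0" unfolding Egen using sin s by (simp add: \<zeta>_def)
    moreover have "\<zeta> * ((1 - \<zeta>) * pivot) \<noteq> 0" using zne piv by simp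
    ultimately show "branch_det ?Y ?s ?y (\<zeta> * uu) (\<zeta> * ((1 - \<zeta>) * pivot)) \<noteq> 0"
      unfolding branch_det_def by simp
  qed
  have R4: "Delta (pair_volt r u' ((1 - \<zeta>) * pivot)) \<noteq> 0" "Delta (pair_volt r (\<zeta> * u') 0) \<noteq> 0"
    "Delta (pair_volt r (cnj \<zeta> * u') (cnj \<zeta> * ((1 - cnj \<zeta>) * pivot))) \<noteq> 0"
    using \<theta>(5,6,7) unfolding \<zeta>_def \<omega>_def by (auto intro!: Delta_pair(1) simp del: cis_cnj)
  have L1: "Delta (pair_volt r uu ((1 - \<zeta>) * pivot)) = 0"
    using Q1 E1 uu0 by (rule Delta_pair(2))
  define x where "x = pair_volt r uu ((1 - \<zeta>) * pivot)"
  have v: "(1 - \<zeta>) * pivot - (cnj \<zeta> - \<zeta>) * pivot = (1 - cnj \<zeta>) * pivot" by (simp add: algebra_simps)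
  have zero: "(\<Prod>k<6. (Delta ((turn_left \<zeta> (cnj \<zeta>) (u' - uu) ! k) x))\<^sup>2) = 0"
    unfolding prod_six turn_left_def x_def by (simp add: turn_pair L1)
  have nonzero: "(\<Prod>k<6. (Delta ((turn_right \<zeta> (cnj \<zeta>) (u' - uu) ! k) x))\<^sup>2) \<noteq> 0"
    unfolding prod_six turn_right_def x_def by (simp add: turn_pair v R1 R2 R3 R4)
  have "(\<Prod>k<6. (Delta ((turn_left \<zeta> (cnj \<zeta>) (u' - uu) ! k) x))\<^sup>2)
      = (\<Prod>k<6. (Delta ((turn_right \<zeta> (cnj \<zeta>) (u' - uu) ! k) x))\<^sup>2)"
    using \<theta>(3) z1 cz by (intro id[rule_format]) (simp_all add: \<zeta>_def)
  then show False using zero nonzero by simp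
qed

end
end

section \<open>The graphical model\<close>

context power_grid
begin

text \<open>
  The pair \<open>i, j\<close> is completed to the centre and two of its neighbours; which lemma
  applies depends on whether one of these neighbours is the parent of the centre.
\<close>

lemma star_not_log_separable:
  assumes star: "\<And>a. a \<noteq> b \<Longrightarrow> par a = Some b \<or> par b = Some a"
    and V0: "V0 \<noteq> 0" and sep: "log_separable W f i j" and ij: "i \<noteq> j"
  shows False
proof (cases "UNIV = {i, j}")
  case True
  have two: False if par: "par r = None" "par l = Some r" and rl: "{r, l} = {i, j}" for r l
  proof -
    have "log_separable W f r l"
      using rl sep log_separable_sym[OF sep] by (auto simp: doubleton_eq_iff)
    moreover have "UNIV = {r, l}" using True rl by simp
    ultimately show False using two_loads_not_log_separable[OF par] V0 by blast
  qed
  have "b \<in> {i, j}" using True by blast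
  then obtain l where l: "{b, l} = {i, j}" "l \<noteq> b" using ij by auto
  have k: "k = b \<or> k = l" for k using True l(1) by blast
  show False
    using star[OF l(2)]
  proof
    assume lb: "par l = Some b"
    have "par b = None"
    proof (cases "par b")
      case (Some k)
      then show ?thesis using k[of k] par_asym[OF lb] par_ne_self[of b] by metis
    qed
    then show False using lb l(1) by (rule two)
  next
    assume bl: "par b = Some l"
    have "par l = None"
    proof (cases "par l")
      case (Some k)
      then show ?thesis using k[of k] par_asym[OF bl] par_ne_self[of l] by metis
    qed
    then show False using two[OF _ bl] l(1) by (simp add: insert_commute)
  qed
next
  case False
  then obtain k where k: "k \<noteq> i" "k \<noteq> j" by blast
  obtain a c where ac: "a \<noteq> b" "c \<noteq> b" "a \<noteq> c"
    and sub: "i = a \<or> i = c \<or> i = b" "j = a \<or> j = c \<or> j = b"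
  proof (cases "i = b \<or> j = b")
    case True
    then show thesis
    proof
      assume "i = b" then show thesis using that[of j k] k ij by auto
    next
      assume "j = b" then show thesis using that[of i k] k ij by auto
    qed
  next
    case False then show thesis using that[of i j] ij by auto
  qed
  note leaf = star_leaf_nbrs[OF star]
  have below: False if b: "par b = Some a'" and "c' \<noteq> a'" "c' \<noteq> b"
    and ij': "i = a' \<or> i = c' \<or> i = b" "j = a' \<or> j = c' \<or> j = b" for a' c'
  proof -
    have child: "par d = Some b" if "d \<noteq> b" "d \<noteq> a'" for d
      using star[OF that(1)] that(2) by (auto simp: b)
    have c: "par c' = Some b" using child that(2,3) by blast
    have out: "Some a' \<notin> nbrs d" if "d \<noteq> b" "d \<noteq> a'" for d
      using leaf(1)[OF _ child[OF that]] par_ne_self[of b] b by auto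
    have "Some c' \<notin> nbrs a'"
      using nbrs_sym[of c' a'] out[of c'] that(2,3) by blast
    then show False
      using hexagon_below_source[OF b c leaf(2)[OF _ c] out _ V0 sep ij'] by blast
  qed
  consider "par b = Some a" | "par b = Some c" | "par a = Some b" "par c = Some b"
    using star[OF ac(1)] star[OF ac(2)] by blast
  then show False
  proof cases
    case 1
    then show False using below[of a c] ac sub by blast
  next
    case 2
    then show False using below[of c a] ac sub by blast
  next
    case 3
    show False
      by (rule hexagon_two_children[OF 3 ac(3) leaf(1)[OF _ 3(1)] leaf(1)[OF _ 3(2)] V0 sep sub])
  qed
qed

end

theorem lemma1:
  fixes M :: "'w measure"
    and E :: "('v::finite) option set set"
    and z :: "'v option set \<Rightarrow> complex"
    and V0 :: complex
    and P V :: "'w \<Rightarrow> complex ^ 'v"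
    and f :: "'v \<Rightarrow> complex \<Rightarrow> real"
    and D :: "(complex ^ 'v) set"
  assumes "prob_space M"
    and "radial_grid E"
    and "\<And>e. e \<in> E \<Longrightarrow> z e \<noteq> 0"
    and "prob_space.indep_vars M (\<lambda>_. borel) (\<lambda>a \<omega>. P \<omega> $ a) UNIV"
    and "\<And>a s. f a s \<ge> 0"
    and "\<And>a. distributed M lborel (\<lambda>\<omega>. P \<omega> $ a) (\<lambda>s. ennreal (f a s))"
    and "invertible_on (injection E z V0) D"
    and "AE \<omega> in M. V \<omega> \<in> D \<and> P \<omega> = injection E z V0 (V \<omega>)"
    and "distributed M lborel V
           (\<lambda>v. ennreal (indicator D v *
              (1 / abs_J_P E z V0 D v * (\<Prod>a\<in>UNIV. f a (injection E z V0 v $ a)))))"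
    and "\<And>a. \<exists>B \<subseteq> N2 E (Some a).
           product_separable D (abs_J_P E z V0 D) {k. Some k \<in> B \<union> {Some a}}"
  shows "graphical_model M V (two_hop_graph E)"
proof -
  interpret prob_space M by fact
  interpret power_grid E z V0 using assms(2,3) by unfold_locales auto
  have "D \<noteq> {}"
  proof
    assume "D = {}"
    then have "AE \<omega> in M. False" using assms(8) by simp
    then show False by simp
  qed
  then obtain x0 where x0: "x0 \<in> D" by blast
  have close: "Some c \<in> N2 E (Some a)" if "a \<noteq> c" for a c
  proof -
    obtain B where B: "B \<subseteq> N2 E (Some a)"
      "product_separable D (abs_J_P E z V0 D) {k. Some k \<in> B \<union> {Some a}}"
      using assms(10) by blast
    have "{k. Some k \<in> B \<union> {Some a}} = UNIV"
      by (rule separable_imp_UNIV[OF B(2) assms(7) x0, of a]) simp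
    then have "c \<in> {k. Some k \<in> B \<union> {Some a}}" by simp
    then show ?thesis using that B(1) by auto
  qed
  have complete: "{a, c} \<in> two_hop_graph E" if "a \<noteq> c" for a c
    using N2_cases[OF close[OF that]] that unfolding two_hop_graph_def by blast
  have loopfree: "card e = 2" if e: "e \<in> two_hop_graph E" for e
  proof -
    obtain a c where "e = {a, c}" "a \<noteq> c"
    proof -
      have "a \<noteq> c" if "{Some a, Some c} \<in> E" for a c using that no_loop[of "Some a"] by auto
      then show thesis using e that unfolding two_hop_graph_def by blast
    qed
    then show ?thesis by simp
  qed
  have nb: "neighbors (two_hop_graph E) i = - {i}" for i
  proof -
    have "{i, i} \<notin> two_hop_graph E" using loopfree[of "{i, i}"] by auto
    then show ?thesis using complete[of i] by (auto simp: neighbors_def)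
  qed
  \<comment> \<open>A set disjoint from \<open>{i} \<union> - {i}\<close> is empty, so both sides of the shielding condition coincide.\<close>
  have self: "shields M V i (- {i})" for i
    unfolding shields_def by (auto simp: Compl_eq_Diff_UNIV)
  have least: "- {i} \<subseteq> N" if sh: "shields M V i N" for i N
  proof (rule ccontr)
    assume "\<not> - {i} \<subseteq> N"
    then obtain j where j: "j \<notin> N" "i \<noteq> j" by auto
    obtain W where W: "log_separable W f i j"
      using shields_imp_log_separable[OF assms(1,7,5,9) sh j] by blast
    obtain b where b: "\<forall>a. a \<noteq> b \<longrightarrow> par a = Some b \<or> par b = Some a"
    proof -
      have "\<exists>b. \<forall>a. a \<noteq> b \<longrightarrow> par a = Some b \<or> par b = Some a" by (rule star_centre) (rule close)
      then show thesis using that by blast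
    qed
    show False
      by (rule star_not_log_separable[OF b[rule_format] V0_ne_0[OF assms(7) x0] W j(2)])
  qed
  show ?thesis
    unfolding graphical_model_def nb using loopfree self least by blast
qed

end
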